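(* Suppose that the starting point $x\in\mathbb{R}$, as well as the parameters $c>0$ and $\lambda>0$, may depend on $T$ in such a way that $\lambda T\to\infty$ and $(c^2T/\lambda)^{-1/2}\,x\to a\in\mathbb{R}$ as $T\to\infty$. Then, as $T\to\infty$, each of $\eta_T(x)$, $\eta_T^{+}(x)$ and $\eta_T^{-}(x)$ converges in distribution to $$\begin{cases} Y_{-a}, & a\le0,\\ 1-Y_a, & a\ge0.\end{cases}$$ In particular, for $a=0$ the limit is given by the arcsine distribution, with distribution function $\frac{2}{\pi}\arcsin\sqrt{y}$, $0\le y\le1$.
   Context: For $\lambda>0$, $c>0$, let $(N_t,\,t\ge0)$ be a homogeneous Poisson process with rate $\lambda$, and let $V_0$ be a random variable independent of $(N_t)$ taking the values $+c$ and $-c$ with probability $1/2$ each. The telegraph process is $X_t:=V_0\int_0^t(-1)^{N_u}\,du$ and the conditional telegraph processes are $X_t^{\pm}:=\pm c\int_0^t(-1)^{N_u}\,du$, $t\ge0$. Let $H(x)=1$ for $x>0$ and $H(x)=0$ for $x\le0$. For $T>0$ and $x\in\mathbb{R}$ set $$\eta_T(x):=\frac1T\int_0^T H(x+X_t)\,dt,\qquad \eta_T^{\pm}(x):=\frac1T\int_0^T H(x+X_t^{\pm})\,dt.$$ The arcsine density is $p_{\mathrm{as}}(y):=\frac{1}{\pi\sqrt{y(1-y)}}$, $0<y<1$. For $a>0$ set $q_a(t):=\frac{a}{\sqrt{2\pi t^3}}\exp\left(-\frac{a^2}{2t}\right)$, $t>0$. Let $Y_a$ ($a\ge0$) be random variables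 with values in $[0,1]$ such that $Y_0$ has the arcsine distribution (density $p_{\mathrm{as}}$), while for $a>0$ $$\mathbb{P}\{Y_a\in dy\}=m_a\,\delta_0(dy)+f_a(y)\,dy,$$ where $\delta_0$ is the Dirac measure at $0$ and $$m_a:=\int_1^\infty q_a(u)\,du,\qquad f_a(y):=\int_0^{1-y}\frac{q_a(u)}{1-u}\,p_{\mathrm{as}}\!\left(\frac{y}{1-u}\right)du .$$ *)

theory Defs
  imports "HOL-Probability.Probability"
begin

text \<open>
  Homogeneous Poisson process \<open>(N\<^sub>t)\<close>, \<open>t \<ge> 0\<close>: only time indices \<open>t \<ge> 0\<close> are
  constrained. All paths (not just almost all) are nondecreasing and right-continuous, so the
  truncated subtraction on \<^typ>\<open>nat\<close> gives the actual increments, and path integrals are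
  random variables without completing the probability space.
\<close>

definition poisson_process :: "'a measure \<Rightarrow> real \<Rightarrow> (real \<Rightarrow> 'a \<Rightarrow> nat) \<Rightarrow> bool" where
  "poisson_process M rate N \<longleftrightarrow>
     prob_space M \<and>
     (\<forall>t\<ge>0. N t \<in> measurable M (count_space UNIV)) \<and>
     (\<forall>\<omega>\<in>space M. N 0 \<omega> = 0) \<and>
     (\<forall>\<omega>\<in>space M. \<forall>s t. 0 \<le> s \<longrightarrow> s \<le> t \<longrightarrow> N s \<omega> \<le> N t \<omega>) \<and>
     (\<forall>\<omega>\<in>space M. \<forall>t\<ge>0. continuous (at_right t) (\<lambda>s. real (N s \<omega>))) \<and>
     (\<forall>(n::nat) (t :: nat \<Rightarrow> real). 0 \<le> t 0 \<longrightarrow> (\<forall>i<n. t i < t (Suc i)) \<longrightarrow>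
        prob_space.indep_vars M (\<lambda>_. count_space UNIV)
          (\<lambda>i \<omega>. N (t (Suc i)) \<omega> - N (t i) \<omega>) {..<n}) \<and>
     (\<forall>s t. 0 \<le> s \<longrightarrow> s < t \<longrightarrow>
        distr M (count_space UNIV) (\<lambda>\<omega>. N t \<omega> - N s \<omega>) = measure_pmf (poisson_pmf (rate * (t - s))))"

text \<open>
  Independence of \<open>V\<^sub>0\<close> and the whole process \<open>(N\<^sub>t)\<close> is independence of \<open>V\<^sub>0\<close> and the process
  viewed as a random element of the product space over the time set \<open>{0..}\<close>. It is stated for
  the generated sigma-algebras because \<open>indep_var\<close> needs both variables to have the same type.
\<close>

definition telegraph_data ::
  "'a measure \<Rightarrow> real \<Rightarrow> real \<Rightarrow> (real \<Rightarrow> 'a \<Rightarrow> nat) \<Rightarrow> ('a \<Rightarrow> real) \<Rightarrow> bool" where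
  "telegraph_data M rate c N V\<^sub>0 \<longleftrightarrow>
     poisson_process M rate N \<and>
     V\<^sub>0 \<in> borel_measurable M \<and>
     measure M {\<omega> \<in> space M. V\<^sub>0 \<omega> = c} = 1 / 2 \<and>
     measure M {\<omega> \<in> space M. V\<^sub>0 \<omega> = - c} = 1 / 2 \<and>
     prob_space.indep_set M
       (sets (vimage_algebra (space M) V\<^sub>0 borel))
       (sets (vimage_algebra (space M) (\<lambda>\<omega>. \<lambda>t\<in>{0..}. N t \<omega>) (PiM {0..} (\<lambda>_. count_space UNIV))))"

text \<open>
  The telegraph path with initial velocity \<open>v\<close> driven by the counting path \<open>n\<close>: taking
  \<open>v = V\<^sub>0 \<omega>\<close> gives \<open>X\<^sub>t\<close>, and \<open>v = c\<close>, \<open>v = - c\<close> give the conditional processes.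
\<close>

definition telegraph :: "real \<Rightarrow> (real \<Rightarrow> nat) \<Rightarrow> real \<Rightarrow> real" where
  "telegraph v n t = v * (LBINT u:{0..t}. (-1) ^ n u)"

definition heaviside :: "real \<Rightarrow> real" where
  "heaviside x = (if x > 0 then 1 else 0)"

definition occupation :: "real \<Rightarrow> real \<Rightarrow> (real \<Rightarrow> real) \<Rightarrow> real" where
  "occupation T x X = 1 / T * (LBINT t:{0..T}. heaviside (x + X t))"

definition arcsine_density :: "real \<Rightarrow> real" where
  "arcsine_density y = 1 / (pi * sqrt (y * (1 - y)))"

definition arcsine_distribution :: "real measure" where
  "arcsine_distribution =
     density lborel (\<lambda>y. ennreal (indicator {0<..<1} y * arcsine_density y))"

definition hitting_density :: "real \<Rightarrow> real \<Rightarrow> real" where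
  "hitting_density a t = a / sqrt (2 * pi * t ^ 3) * exp (- (a\<^sup>2 / (2 * t)))"

definition limit_atom :: "real \<Rightarrow> real" where
  "limit_atom a = (LBINT u:{1<..}. hitting_density a u)"

definition limit_density :: "real \<Rightarrow> real \<Rightarrow> real" where
  "limit_density a y =
     (LBINT u:{0<..<1 - y}. hitting_density a u / (1 - u) * arcsine_density (y / (1 - u)))"

definition is_limit_variable :: "'b measure \<Rightarrow> real \<Rightarrow> ('b \<Rightarrow> real) \<Rightarrow> bool" where
  "is_limit_variable Q a Y \<longleftrightarrow>
     Y \<in> borel_measurable Q \<and>
     (\<forall>\<omega>\<in>space Q. Y \<omega> \<in> {0..1}) \<and>
     (if a = 0 then distr Q borel Y = arcsine_distribution
      else \<forall>A\<in>sets borel. emeasure (distr Q borel Y) A =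
             ennreal (limit_atom a) * indicator A 0 +
             (\<integral>\<^sup>+ y \<in> A \<inter> {0<..<1}. ennreal (limit_density a y) \<partial>lborel))"

text \<open>
  The library's \<^const>\<open>weak_conv_m\<close> covers sequences only; here the parameter may run along any
  filter, in particular \<open>T \<rightarrow> \<infinity>\<close> through the reals.
\<close>

definition converges_in_distribution ::
  "('t \<Rightarrow> real measure) \<Rightarrow> real measure \<Rightarrow> 't filter \<Rightarrow> bool" where
  "converges_in_distribution \<mu> \<nu> F \<longleftrightarrow>
     (\<forall>y. isCont (cdf \<nu>) y \<longrightarrow> ((\<lambda>T. cdf (\<mu> T) y) \<longlongrightarrow> cdf \<nu> y) F)"

lemma converges_in_distribution_sequentially:
  "converges_in_distribution \<mu> \<nu> sequentially \<longleftrightarrow> weak_conv_m \<mu> \<nu>"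
  by (simp add: converges_in_distribution_def weak_conv_m_def weak_conv_def)

end

theory Submission
  imports Defs "HOL-Real_Asymp.Real_Asymp"
begin

text \<open>
  Scaling reduces the statement to horizon \<open>1\<close>, speed \<open>1\<close>, rate \<open>n = \<lambda>T \<rightarrow> \<infinity>\<close> and a starting point \<open>y\<close> with
  \<open>y \<surd>n \<rightarrow> a\<close>. Let \<open>A\<^sub>t\<close> be the time spent above \<open>0\<close> up to \<open>t\<close>. The double Laplace transform
  \<open>\<integral> e\<^bsup>- s t\<^esup> E e\<^bsup>- \<mu> A\<^sub>t\<^esup> dt\<close> is the value at \<open>y\<close> of the bounded solution of the backward equation
  \<open>v \<phi>\<^sub>v' + n (\<phi>\<^sub>-\<^sub>v - \<phi>\<^sub>v) - (s + \<mu> H) \<phi>\<^sub>v + 1 = 0\<close>: the mean of the discounted potential has derivative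
  \<open>- E e\<^bsup>- s t - \<mu> A\<^sub>t\<^esup>\<close>, since over a short interval \<open>h\<close> the effects of no jump and of one jump cancel up to
  \<open>O(h\<^sup>2)\<close>. The equation has constant coefficients on each half-line, and its explicit solution tends to
  \<open>1/s - e\<^bsup>a \<surd>(2s)\<^esup> (1/s - 1/\<surd>(s (s + \<mu>)))\<close> for \<open>a \<le> 0\<close>. The same expression is the Laplace transform of a first
  passage time followed by an arcsine time, that is, of the limit law run up to time \<open>t\<close>. Equicontinuity in \<open>t\<close>
  turns this into convergence of \<open>E e\<^bsup>- \<mu> A\<^sub>1\<^esup>\<close>, hence of the laws on \<open>[0, 1]\<close>. The case \<open>a \<ge> 0\<close> follows by
  reflection, because a path has only countably many zeros.
\<close>

section \<open>Counting paths and telegraph paths\<close>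

text \<open>The hypotheses describe finitely many Poisson increments at a time and do not exclude,
  path by path, jumps larger than 1. So the proof rests on one fact: a functional of the path up to
  time \<open>t\<close> is independent of a single later increment. It is obtained by freezing paths
  on finite grids, and jumps of size at least 2 are paid for by their probability O(h^2). The
  cancellation between no jump and one jump comes from P(J = 1) = a P(J = 0) for a Poisson variable
  of mean a. The initial velocity disappears in the limit because the two velocity components of the
  decaying modes of the backward equation have a ratio tending to 1. The limit law is handled
  through 1 - exp instead of exp: this quantity is zero until the passage, so late or absent
  passages contribute nothing to the integral over passage times. Each \<open>T\<close> may carry
  its own probability space, so all bounds are uniform in the index and the convergence lemmas are
  stated for an arbitrary filter.\<close>

definition counting_path :: "(real \<Rightarrow> nat) \<Rightarrow> bool" where
  "counting_path n \<longleftrightarrow> (\<forall>s t. 0 \<le> s \<longrightarrow> s \<le> t \<longrightarrow> n s \<le> n t)"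

lemma counting_path_mono: "counting_path n \<Longrightarrow> 0 \<le> s \<Longrightarrow> s \<le> t \<Longrightarrow> n s \<le> n t"
  by (simp add: counting_path_def)

text \<open>Nothing is known about \<open>n\<close> at negative times, hence the composition with
  \<open>max 0\<close>. A monotone real function is Borel, and the floor recovers the natural number
  from its real image.\<close>

lemma counting_path_measurable:
  assumes "counting_path n"
  shows "(\<lambda>u. n (max 0 u)) \<in> measurable borel (count_space UNIV)"
proof -
  have "mono (\<lambda>u. real (n (max 0 u)))"
    using assms by (auto simp: mono_def counting_path_def)
  then have m: "(\<lambda>u. real (n (max 0 u))) \<in> borel_measurable borel"
    by (rule borel_measurable_mono)
  have "(\<lambda>u. nat \<lfloor>real (n (max 0 u))\<rfloor>) \<in> measurable borel (count_space UNIV)"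
    using m by measurable
  then show ?thesis by simp
qed

lemma set_integrable_bounded_half_line:
  fixes f :: "real \<Rightarrow> real"
  assumes "(\<lambda>u. f (max 0 u)) \<in> borel_measurable borel" "\<And>u. \<bar>f u\<bar> \<le> 1" "0 \<le> a"
  shows "set_integrable lborel {a..b} f"
proof -
  have "set_integrable lborel {a..b} (\<lambda>u. f (max 0 u))"
    unfolding set_integrable_def
    by (rule integrableI_bounded_set_indicator[where B = 1]) (use assms in \<open>auto simp: emeasure_lborel_Icc_eq\<close>)
  moreover have "(\<lambda>u. indicator {a..b} u *\<^sub>R f (max 0 u)) = (\<lambda>u. indicator {a..b} u *\<^sub>R f u)"
    using assms(3) by (auto simp: indicator_def max_def)
  ultimately show ?thesis by (simp add: set_integrable_def)
qed

lemma set_integrable_sign: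
  assumes "counting_path n" "0 \<le> a"
  shows "set_integrable lborel {a..b} (\<lambda>u. (-1::real) ^ n u)"
  by (rule set_integrable_bounded_half_line[OF measurable_compose[OF counting_path_measurable[OF assms(1)]] _ assms(2)])
     (auto simp: power_abs)

lemma integrable_sign:
  assumes "counting_path n" "0 \<le> a"
  shows "(\<lambda>u. (-1::real) ^ n u) integrable_on {a..b}"
  using set_borel_integral_eq_integral(1)[OF set_integrable_sign[OF assms]] .

lemma telegraph_eq_integral:
  assumes "counting_path n"
  shows "telegraph v n t = v * integral {0..t} (\<lambda>u. (-1) ^ n u)"
  using set_borel_integral_eq_integral(2)[OF set_integrable_sign[OF assms order_refl]]
  by (simp add: telegraph_def)

lemma telegraph_0 [simp]: "telegraph v n 0 = 0"
proof -
  have "(LBINT u:{0..0}. (-1::real) ^ n u) = 0"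
    unfolding set_lebesgue_integral_def by (rule integral_eq_zero_AE) (use AE_lborel_singleton[of 0] in eventually_elim, auto)
  then show ?thesis by (simp add: telegraph_def)
qed

lemma telegraph_uminus: "telegraph (- v) n t = - telegraph v n t"
  by (simp add: telegraph_def)

lemma telegraph_diff:
  assumes "counting_path n" "0 \<le> s" "s \<le> t"
  shows "telegraph v n t - telegraph v n s = v * integral {s..t} (\<lambda>u. (-1) ^ n u)"
proof -
  have "integral {0..s} (\<lambda>u. (-1::real) ^ n u) + integral {s..t} (\<lambda>u. (-1) ^ n u) = integral {0..t} (\<lambda>u. (-1) ^ n u)"
    by (rule Henstock_Kurzweil_Integration.integral_combine) (use assms integrable_sign in auto)
  then show ?thesis
    by (simp add: telegraph_eq_integral[OF assms(1)] flip: right_diff_distrib)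
qed

lemma telegraph_lipschitz:
  assumes "counting_path n" "0 \<le> s" "s \<le> t"
  shows "\<bar>telegraph v n t - telegraph v n s\<bar> \<le> \<bar>v\<bar> * (t - s)"
proof -
  have "norm (integral {s..t} (\<lambda>u. (-1::real) ^ n u)) \<le> 1 * (t - s)"
    using has_integral_bound_real[OF _ _ integrable_integral[OF integrable_sign[OF assms(1,2)]], of 1 "{}" t] assms(3)
    by (simp add: power_abs)
  then show ?thesis
    by (simp add: telegraph_diff[OF assms] abs_mult mult_left_mono)
qed

lemma continuous_on_telegraph:
  assumes "counting_path n"
  shows "continuous_on {0..} (telegraph v n)"
proof -
  have "\<bar>v\<bar>-lipschitz_on {0..} (telegraph v n)"
  proof (rule lipschitz_onI)
    fix s t :: real assume "s \<in> {0..}" "t \<in> {0..}"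
    then show "dist (telegraph v n s) (telegraph v n t) \<le> \<bar>v\<bar> * dist s t"
      using telegraph_lipschitz[OF assms, of s t v] telegraph_lipschitz[OF assms, of t s v]
      by (cases "s \<le> t") (auto simp: dist_real_def abs_minus_commute)
  qed simp
  then show ?thesis by (rule lipschitz_on_continuous_on)
qed

text \<open>By monotonicity, equal counts at both ends leave no room for a jump in between, so the
  path is a straight segment there.\<close>

lemma telegraph_linear:
  assumes "counting_path n" "0 \<le> s" "s \<le> r" "r \<le> t" "n s = n t"
  shows "telegraph v n r = telegraph v n s + v * (-1) ^ n s * (r - s)"
proof -
  have same: "n u = n s" if "u \<in> {s..r}" for u
  proof (rule order.antisym)
    show "n u \<le> n s"
      using counting_path_mono[OF assms(1), of u t] that assms(2-5) by simp
    show "n s \<le> n u"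
      using counting_path_mono[OF assms(1), of s u] that assms(2-5) by simp
  qed
  have "integral {s..r} (\<lambda>u. (-1::real) ^ n u) = integral {s..r} (\<lambda>u. (-1) ^ n s)"
    by (rule integral_cong) (simp only: same)
  also have "\<dots> = (-1) ^ n s * (r - s)" using assms by simp
  finally show ?thesis using telegraph_diff[OF assms(1-3), of v] by simp
qed

section \<open>Occupation time of the positive half-line along a path\<close>

lemma heaviside_measurable [measurable]: "heaviside \<in> borel_measurable borel"
  unfolding heaviside_def by measurable

lemma heaviside_bounds: "0 \<le> heaviside x" "heaviside x \<le> 1" "\<bar>heaviside x\<bar> \<le> 1"
  by (auto simp: heaviside_def)

lemma telegraph_max_measurable:
  assumes "counting_path n"
  shows "(\<lambda>r. telegraph v n (max 0 r)) \<in> borel_measurable borel"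
  by (intro borel_measurable_continuous_onI continuous_on_compose2[OF continuous_on_telegraph[OF assms]])
     (auto intro!: continuous_intros)

definition time_above :: "real \<Rightarrow> real \<Rightarrow> (real \<Rightarrow> nat) \<Rightarrow> real \<Rightarrow> real" where
  "time_above y v n t = (LBINT r:{0..t}. heaviside (y + telegraph v n r))"

lemma set_integrable_heaviside:
  assumes "counting_path n" "0 \<le> a"
  shows "set_integrable lborel {a..b} (\<lambda>r. heaviside (y + telegraph v n r))"
  by (rule set_integrable_bounded_half_line)
     (use telegraph_max_measurable[OF assms(1)] assms(2) in \<open>auto simp: heaviside_bounds\<close>)

lemma integrable_heaviside:
  assumes "counting_path n" "0 \<le> a"
  shows "(\<lambda>r. heaviside (y + telegraph v n r)) integrable_on {a..b}"
  using set_borel_integral_eq_integral(1)[OF set_integrable_heaviside[OF assms]] .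

lemma time_above_eq_integral:
  assumes "counting_path n"
  shows "time_above y v n t = integral {0..t} (\<lambda>r. heaviside (y + telegraph v n r))"
  using set_borel_integral_eq_integral(2)[OF set_integrable_heaviside[OF assms order_refl]]
  by (simp add: time_above_def)

lemma time_above_diff:
  assumes "counting_path n" "0 \<le> s" "s \<le> t"
  shows "time_above y v n t - time_above y v n s = integral {s..t} (\<lambda>r. heaviside (y + telegraph v n r))"
proof -
  have "integral {0..s} (\<lambda>r. heaviside (y + telegraph v n r)) + integral {s..t} (\<lambda>r. heaviside (y + telegraph v n r))
      = integral {0..t} (\<lambda>r. heaviside (y + telegraph v n r))"
    by (rule Henstock_Kurzweil_Integration.integral_combine) (use assms integrable_heaviside in auto)
  then show ?thesis
    by (simp add: time_above_eq_integral[OF assms(1)])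
qed

lemma time_above_diff_bounds:
  assumes "counting_path n" "0 \<le> s" "s \<le> t"
  shows "0 \<le> time_above y v n t - time_above y v n s" "time_above y v n t - time_above y v n s \<le> t - s"
proof -
  show "0 \<le> time_above y v n t - time_above y v n s"
    unfolding time_above_diff[OF assms]
    by (rule integral_nonneg) (use assms integrable_heaviside heaviside_bounds in auto)
  have "norm (integral {s..t} (\<lambda>r. heaviside (y + telegraph v n r))) \<le> 1 * (t - s)"
    using has_integral_bound_real[OF _ _ integrable_integral[OF integrable_heaviside[OF assms(1,2)]], of 1 "{}" t y v] assms(3)
    by (simp add: heaviside_bounds)
  then show "time_above y v n t - time_above y v n s \<le> t - s"
    unfolding time_above_diff[OF assms] by simp
qed

lemma time_above_0 [simp]: "time_above y v n 0 = 0"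
  unfolding time_above_def set_lebesgue_integral_def by (rule integral_eq_zero_AE) (use AE_lborel_singleton[of 0] in eventually_elim, auto)

lemma time_above_bounds:
  assumes "counting_path n" "0 \<le> t"
  shows "0 \<le> time_above y v n t" "time_above y v n t \<le> t"
  using time_above_diff_bounds[OF assms(1) order_refl assms(2), of y v] by auto

text \<open>The counting path is injective on the zeros: two zeros with the same count would be
  joined by a straight segment of nonzero slope.\<close>

lemma countable_zeros:
  assumes "counting_path n" "v \<noteq> 0"
  shows "countable {r. 0 \<le> r \<and> y + telegraph v n r = 0}" (is "countable ?Z")
proof -
  have *: "r = r'" if "r \<in> ?Z" "r' \<in> ?Z" "n r = n r'" "r \<le> r'" for r r'
  proof -
    have "telegraph v n r' = telegraph v n r + v * (-1) ^ n r * (r' - r)"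
      by (rule telegraph_linear) (use that assms in auto)
    moreover have "telegraph v n r' = telegraph v n r" using that by simp
    ultimately have "v * (-1) ^ n r * (r' - r) = 0" by linarith
    then show ?thesis using assms(2) by simp
  qed
  have "inj_on n ?Z"
  proof (rule inj_onI)
    fix r r' assume "r \<in> ?Z" "r' \<in> ?Z" "n r = n r'"
    then show "r = r'" using *[of r r'] *[of r' r] by (cases "r \<le> r'") auto
  qed
  then show ?thesis by (rule countableI)
qed

lemma AE_not_zero:
  assumes "counting_path n" "v \<noteq> 0"
  shows "AE r in lborel. 0 \<le> r \<longrightarrow> y + telegraph v n r \<noteq> 0"
proof -
  have "{r. 0 \<le> r \<and> y + telegraph v n r = 0} \<in> null_sets lborel"
    by (intro countable_imp_null_set_lborel countable_zeros assms)
  then show ?thesis by (rule AE_I') auto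
qed

text \<open>\<open>heaviside (- z)\<close> and \<open>1 - heaviside z\<close> differ only at
  \<open>z = 0\<close>, and the path is there only for a null set of times.\<close>

lemma time_above_reflect:
  assumes "counting_path n" "v \<noteq> 0" "0 \<le> t"
  shows "time_above (- y) (- v) n t = t - time_above y v n t"
proof -
  have one: "set_integrable lborel {0..t} (\<lambda>r. 1 :: real)"
    by (simp add: set_integrable_def emeasure_lborel_Icc_eq integrable_real_indicator)
  have "time_above (- y) (- v) n t = (LBINT r:{0..t}. 1 - heaviside (y + telegraph v n r))"
    unfolding time_above_def set_lebesgue_integral_def
  proof (rule integral_cong_AE)
    show "(\<lambda>r. indicator {0..t} r *\<^sub>R heaviside (- y + telegraph (- v) n r)) \<in> borel_measurable lborel"
      using set_integrable_heaviside[OF assms(1) order_refl, of t "- y" "- v"]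
      unfolding set_integrable_def by (rule borel_measurable_integrable)
    have "set_integrable lborel {0..t} (\<lambda>r. 1 - heaviside (y + telegraph v n r))"
      by (rule set_integral_diff(1)[OF one set_integrable_heaviside[OF assms(1) order_refl]])
    then show "(\<lambda>r. indicator {0..t} r *\<^sub>R (1 - heaviside (y + telegraph v n r))) \<in> borel_measurable lborel"
      unfolding set_integrable_def by (rule borel_measurable_integrable)
    show "AE r in lborel. indicator {0..t} r *\<^sub>R heaviside (- y + telegraph (- v) n r) =
        indicator {0..t} r *\<^sub>R (1 - heaviside (y + telegraph v n r))"
      using AE_not_zero[OF assms(1,2), of y]
      by eventually_elim (auto simp: heaviside_def telegraph_uminus split: split_indicator)
  qed
  also have "\<dots> = t - time_above y v n t"
    unfolding time_above_def
    using set_integral_diff(2)[OF one set_integrable_heaviside[OF assms(1) order_refl], of y v] assms(3)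
    by (simp add: set_lebesgue_integral_def)
  finally show ?thesis .
qed

text \<open>Pointwise convergence in the discrete space of naturals, hence eventual equality at each
  time without any rate. Dominated convergence needs no more to pass to path integrals.\<close>

definition paths_converge :: "real \<Rightarrow> (nat \<Rightarrow> real \<Rightarrow> nat) \<Rightarrow> (real \<Rightarrow> nat) \<Rightarrow> bool" where
  "paths_converge t p n \<longleftrightarrow> counting_path n \<and> (\<forall>m. counting_path (p m)) \<and>
     (\<forall>u\<in>{0..t}. eventually (\<lambda>m. p m u = n u) sequentially)"

lemma telegraph_tendsto:
  assumes "paths_converge t p n" "0 \<le> r" "r \<le> t"
  shows "(\<lambda>m. telegraph v (p m) r) \<longlonglongrightarrow> telegraph v n r"
proof -
  have c: "counting_path n" "\<And>m. counting_path (p m)" using assms by (auto simp: paths_converge_def)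
  have "(\<lambda>m. LBINT u:{0..r}. (-1::real) ^ p m u) \<longlonglongrightarrow> (LBINT u:{0..r}. (-1) ^ n u)"
    unfolding set_lebesgue_integral_def
  proof (rule integral_dominated_convergence[where w = "indicator {0..r}"])
    show "integrable lborel (indicator {0..r} :: real \<Rightarrow> real)" by (simp add: emeasure_lborel_Icc_eq)
    show "AE u in lborel. (\<lambda>m. indicator {0..r} u *\<^sub>R (-1::real) ^ p m u) \<longlonglongrightarrow> indicator {0..r} u *\<^sub>R (-1) ^ n u"
    proof (intro AE_I2)
      fix u :: real
      show "(\<lambda>m. indicator {0..r} u *\<^sub>R (-1::real) ^ p m u) \<longlonglongrightarrow> indicator {0..r} u *\<^sub>R (-1) ^ n u"
      proof (cases "u \<in> {0..r}")
        case True
        then have "eventually (\<lambda>m. p m u = n u) sequentially"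
          using assms by (auto simp: paths_converge_def)
        then have "eventually (\<lambda>m. indicator {0..r} u *\<^sub>R (-1::real) ^ p m u = indicator {0..r} u *\<^sub>R (-1) ^ n u) sequentially"
          by eventually_elim simp
        then show ?thesis by (rule tendsto_eventually)
      qed simp
    qed
  qed (use set_integrable_sign[OF c(1) order_refl] set_integrable_sign[OF c(2) order_refl] in
        \<open>auto simp: set_integrable_def power_abs split: split_indicator\<close>)
  then show ?thesis unfolding telegraph_def by (intro tendsto_mult tendsto_const)
qed

text \<open>The integrand is discontinuous only at level 0, which the limiting path occupies for a
  null set of times; elsewhere the sign of the position is eventually that of the limit.\<close>

lemma time_above_tendsto:
  assumes "paths_converge t p n" "v \<noteq> 0"
  shows "(\<lambda>m. time_above y v (p m) t) \<longlonglongrightarrow> time_above y v n t"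
proof -
  have c: "counting_path n" "\<And>m. counting_path (p m)" using assms by (auto simp: paths_converge_def)
  show ?thesis
    unfolding time_above_def set_lebesgue_integral_def
  proof (rule integral_dominated_convergence[where w = "indicator {0..t}"])
    show "integrable lborel (indicator {0..t} :: real \<Rightarrow> real)" by (simp add: emeasure_lborel_Icc_eq)
    show "AE r in lborel. (\<lambda>m. indicator {0..t} r *\<^sub>R heaviside (y + telegraph v (p m) r)) \<longlonglongrightarrow>
        indicator {0..t} r *\<^sub>R heaviside (y + telegraph v n r)"
      using AE_not_zero[OF c(1) assms(2), of y]
    proof eventually_elim
      case (elim r)
      show ?case
      proof (cases "r \<in> {0..t}")
        case True
        then have lim: "(\<lambda>m. y + telegraph v (p m) r) \<longlonglongrightarrow> y + telegraph v n r"
          by (intro tendsto_add tendsto_const telegraph_tendsto[OF assms(1)]) auto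
        consider "y + telegraph v n r > 0" | "y + telegraph v n r < 0" using elim True by force
        then have "eventually (\<lambda>m. heaviside (y + telegraph v (p m) r) = heaviside (y + telegraph v n r)) sequentially"
        proof cases
          case 1
          then show ?thesis using order_tendstoD(1)[OF lim 1]
            by (auto elim!: eventually_mono simp: heaviside_def)
        next
          case 2
          then show ?thesis using order_tendstoD(2)[OF lim 2]
            by (auto elim!: eventually_mono simp: heaviside_def)
        qed
        then show ?thesis by (intro tendsto_eventually) (rule eventually_mono, auto)
      qed simp
    qed
  qed (use set_integrable_heaviside[OF c(1) order_refl] set_integrable_heaviside[OF c(2) order_refl] in
        \<open>auto simp: set_integrable_def heaviside_bounds split: split_indicator\<close>)
qed

section \<open>Increments of the potential along a path\<close>

lemma max_0_has_derivative:
  assumes "x \<noteq> 0"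
  shows "((\<lambda>x. max 0 x) has_real_derivative heaviside x) (at x)"
proof (cases "x > 0")
  case True
  have "((\<lambda>x. x) has_real_derivative heaviside x) (at x)"
    using True by (auto simp: heaviside_def)
  moreover have "eventually (\<lambda>z. z = max 0 z) (nhds x)"
    using eventually_nhds_in_open[of "{0<..}" x] True by (auto elim!: eventually_mono)
  ultimately show ?thesis by (subst (asm) DERIV_cong_ev[OF refl _ refl]) auto
next
  case False
  have "((\<lambda>x. 0) has_real_derivative heaviside x) (at x)"
    using False by (auto simp: heaviside_def)
  moreover have "eventually (\<lambda>z. 0 = max 0 z) (nhds x)"
    using eventually_nhds_in_open[of "{..<0}" x] False assms by (auto elim!: eventually_mono)
  ultimately show ?thesis by (subst (asm) DERIV_cong_ev[OF refl _ refl]) auto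
qed

lemma max_0_line_has_derivative:
  assumes "z + V * (w - t) \<noteq> 0"
  shows "((\<lambda>w. max 0 (z + V * (w - t))) has_real_derivative heaviside (z + V * (w - t)) * V) (at w)"
  by (rule DERIV_chain2[where f = "max 0" and g = "\<lambda>w. z + V * (w - t)"])
     (auto intro!: max_0_has_derivative assms derivative_eq_intros)

lemma exp_minus_lipschitz:
  fixes a b :: real
  assumes "0 \<le> a" "0 \<le> b"
  shows "\<bar>exp (- a) - exp (- b)\<bar> \<le> \<bar>a - b\<bar>"
proof -
  have *: "exp (- a) - exp (- b) \<le> b - a" if "0 \<le> a" "a \<le> b" for a b :: real
  proof -
    have "exp (- a) - exp (- b) = exp (- a) * (1 - exp (a - b))"
      by (simp add: algebra_simps flip: exp_add)
    also have "\<dots> \<le> 1 * (b - a)"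
    proof (rule mult_mono)
      show "1 - exp (a - b) \<le> b - a" using exp_ge_add_one_self[of "a - b"] by linarith
    qed (use that in auto)
    finally show ?thesis by simp
  qed
  show ?thesis
    using *[of a b] *[of b a] assms by (cases "a \<le> b") auto
qed

text \<open>Since \<open>V * V = 1\<close>, a primitive is
  \<open>V * max 0 (z + V * (r - t))\<close>. It fails to be differentiable only at the crossing
  time \<open>t - V * z\<close>, the exceptional point of the fundamental theorem.\<close>

lemma integral_heaviside_line:
  assumes "V = 1 \<or> V = - 1" "0 \<le> w"
  shows "integral {t..t + w} (\<lambda>r. heaviside (z + V * (r - t))) = V * (max 0 (z + V * w) - max 0 z)"
proof -
  have "((\<lambda>r. heaviside (z + V * (r - t))) has_integral
      (V * max 0 (z + V * (t + w - t)) - V * max 0 (z + V * (t - t)))) {t..t + w}"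
  proof (rule fundamental_theorem_of_calculus_interior_strong[where S = "{t - V * z}"])
    show "continuous_on {t..t + w} (\<lambda>r. V * max 0 (z + V * (r - t)))"
      by (intro continuous_intros)
    fix r assume r: "r \<in> {t<..<t + w} - {t - V * z}"
    then have nz: "z + V * (r - t) \<noteq> 0" using assms(1) by auto
    have "((\<lambda>r. V * max 0 (z + V * (r - t))) has_real_derivative V * (heaviside (z + V * (r - t)) * V)) (at r)"
      by (intro DERIV_cmult max_0_line_has_derivative nz)
    then show "((\<lambda>r. V * max 0 (z + V * (r - t))) has_vector_derivative heaviside (z + V * (r - t))) (at r)"
      using assms(1) by (auto simp: has_real_derivative_iff_has_vector_derivative)
  qed (use assms in auto)
  then show ?thesis by (simp add: integral_unique right_diff_distrib)
qed

text \<open>The potential \<open>\<phi>\<close> solves the backward equation of the killed telegraph process; the kink of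
  \<^const>\<open>heaviside\<close> forces the exclusion of the origin.\<close>

locale telegraph_potential =
  fixes s \<mu> rate K L y v :: real and \<phi> :: "real \<Rightarrow> real \<Rightarrow> real"
  assumes s_pos: "0 < s" and mu_nonneg: "0 \<le> \<mu>" and rate_pos: "0 < rate"
    and K_nonneg: "0 \<le> K" and L_nonneg: "0 \<le> L"
    and velocity: "v = 1 \<or> v = - 1"
    and phi_bound: "\<And>V x. V = 1 \<or> V = - 1 \<Longrightarrow> \<bar>\<phi> V x\<bar> \<le> K"
    and phi_lipschitz: "\<And>V x z. V = 1 \<or> V = - 1 \<Longrightarrow> \<bar>\<phi> V x - \<phi> V z\<bar> \<le> L * \<bar>x - z\<bar>"
    and phi_ode: "\<And>V x. V = 1 \<or> V = - 1 \<Longrightarrow> x \<noteq> 0 \<Longrightarrow>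
      (\<phi> V has_real_derivative
        V * ((s + \<mu> * heaviside x) * \<phi> V x - 1 - rate * (\<phi> (- V) x - \<phi> V x))) (at x)"
begin

definition position :: "(real \<Rightarrow> nat) \<Rightarrow> real \<Rightarrow> real" where
  "position n t = y + telegraph v n t"

definition velocity_at :: "(real \<Rightarrow> nat) \<Rightarrow> real \<Rightarrow> real" where
  "velocity_at n t = v * (-1) ^ n t"

definition discount :: "(real \<Rightarrow> nat) \<Rightarrow> real \<Rightarrow> real" where
  "discount n t = exp (- (s * t + \<mu> * time_above y v n t))"

definition potential_at :: "(real \<Rightarrow> nat) \<Rightarrow> real \<Rightarrow> real" where
  "potential_at n t = discount n t * \<phi> (velocity_at n t) (position n t)"

text \<open>The leading effect of one velocity reversal on the discounted potential; times
  \<open>rate\<close>, it is the jump term of the generator.\<close>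

definition flip_gain :: "(real \<Rightarrow> nat) \<Rightarrow> real \<Rightarrow> real" where
  "flip_gain n t = discount n t * (\<phi> (- velocity_at n t) (position n t) - \<phi> (velocity_at n t) (position n t))"

lemma continuous_phi: "V = 1 \<or> V = - 1 \<Longrightarrow> continuous_on UNIV (\<phi> V)"
  by (rule lipschitz_on_continuous_on[of L])
     (use phi_lipschitz[of V] L_nonneg in \<open>auto simp: lipschitz_on_def dist_real_def\<close>)

lemma velocity_at_cases: "velocity_at n t = 1 \<or> velocity_at n t = - 1"
  using velocity by (cases "even (n t)") (auto simp: velocity_at_def)

lemma uminus_velocity_at_cases: "- velocity_at n t = 1 \<or> - velocity_at n t = - 1"
  using velocity_at_cases[of n t] by auto

lemma discount_bounds:
  assumes "counting_path n" "0 \<le> t"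
  shows "0 < discount n t" "discount n t \<le> 1"
proof -
  have "0 \<le> s * t + \<mu> * time_above y v n t"
    using time_above_bounds[OF assms, of y v] s_pos mu_nonneg assms(2) by simp
  then show "0 < discount n t" "discount n t \<le> 1" by (auto simp: discount_def)
qed

lemma discount_lipschitz:
  assumes "counting_path n" "0 \<le> t" "0 \<le> h"
  shows "\<bar>discount n (t + h) - discount n t\<bar> \<le> (s + \<mu>) * h"
proof -
  note a = time_above_diff_bounds[OF assms(1,2), of "t + h" y v]
  have "\<bar>discount n (t + h) - discount n t\<bar> \<le>
      \<bar>(s * (t + h) + \<mu> * time_above y v n (t + h)) - (s * t + \<mu> * time_above y v n t)\<bar>"
    unfolding discount_def
    by (rule exp_minus_lipschitz)
       (use time_above_bounds(1)[OF assms(1)] s_pos mu_nonneg assms in auto)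
  also have "\<dots> = s * h + \<mu> * (time_above y v n (t + h) - time_above y v n t)"
  proof -
    have "(s * (t + h) + \<mu> * time_above y v n (t + h)) - (s * t + \<mu> * time_above y v n t)
        = s * h + \<mu> * (time_above y v n (t + h) - time_above y v n t)"
      by (simp only: distrib_left right_diff_distrib)
    moreover have "0 \<le> s * h + \<mu> * (time_above y v n (t + h) - time_above y v n t)"
      using a(1) s_pos mu_nonneg assms(3) by (intro add_nonneg_nonneg mult_nonneg_nonneg) linarith+
    ultimately show ?thesis by simp
  qed
  also have "\<dots> \<le> s * h + \<mu> * h"
    using a assms(3) s_pos mu_nonneg by (intro add_mono mult_left_mono) auto
  finally show ?thesis by (simp add: algebra_simps)
qed

lemma position_lipschitz:
  assumes "counting_path n" "0 \<le> t" "0 \<le> h"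
  shows "\<bar>position n (t + h) - position n t\<bar> \<le> h"
  using telegraph_lipschitz[OF assms(1,2), of "t + h" v] assms(3) velocity
  by (auto simp: position_def)

lemma abs_discount_phi_le:
  assumes "counting_path n" "0 \<le> t" "V = 1 \<or> V = - 1"
  shows "\<bar>discount n t * \<phi> V x\<bar> \<le> K"
  using mult_mono[OF discount_bounds(2)[OF assms(1,2)] phi_bound[OF assms(3), of x]]
    discount_bounds(1)[OF assms(1,2)] by (simp add: abs_mult)

lemma abs_potential_le: "counting_path n \<Longrightarrow> 0 \<le> t \<Longrightarrow> \<bar>potential_at n t\<bar> \<le> K"
  unfolding potential_at_def by (intro abs_discount_phi_le velocity_at_cases)

lemma abs_flip_gain_le: "counting_path n \<Longrightarrow> 0 \<le> t \<Longrightarrow> \<bar>flip_gain n t\<bar> \<le> 2 * K"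
  using abs_discount_phi_le[OF _ _ velocity_at_cases, of n t n t "position n t"]
    abs_discount_phi_le[OF _ _ uminus_velocity_at_cases, of n t n t "position n t"]
  by (auto simp: flip_gain_def right_diff_distrib)

text \<open>A crude bound is enough for two or more jumps, since their probability is already of
  order h^2.\<close>

lemma step_two:
  assumes "counting_path n" "0 \<le> t" "0 \<le> h"
  shows "\<bar>potential_at n (t + h) - potential_at n t\<bar> \<le> 2 * K"
  using abs_potential_le[OF assms(1,2)] abs_potential_le[OF assms(1), of "t + h"] assms(2,3) by auto

text \<open>The jump time inside the interval is unknown, but position and discount move by O(h)
  only. This error is multiplied later by the probability of a jump, again O(h).\<close>

lemma step_one:
  assumes "counting_path n" "0 \<le> t" "0 \<le> h" "n (t + h) = Suc (n t)"
  shows "\<bar>potential_at n (t + h) - potential_at n t - flip_gain n t\<bar> \<le> ((s + \<mu>) * K + L) * h"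
proof -
  let ?V = "- velocity_at n t"
  have V: "velocity_at n (t + h) = ?V" by (simp add: velocity_at_def assms(4))
  have "potential_at n (t + h) - potential_at n t - flip_gain n t =
      (discount n (t + h) - discount n t) * \<phi> ?V (position n (t + h))
      + discount n t * (\<phi> ?V (position n (t + h)) - \<phi> ?V (position n t))"
    unfolding potential_at_def flip_gain_def V by (simp only: left_diff_distrib right_diff_distrib)
  also have "\<bar>\<dots>\<bar> \<le> \<bar>discount n (t + h) - discount n t\<bar> * \<bar>\<phi> ?V (position n (t + h))\<bar>
      + \<bar>discount n t\<bar> * \<bar>\<phi> ?V (position n (t + h)) - \<phi> ?V (position n t)\<bar>"
    using abs_triangle_ineq by (simp add: abs_mult[symmetric])
  also have "\<dots> \<le> ((s + \<mu>) * h) * K + 1 * (L * h)"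
  proof (intro add_mono mult_mono)
    show "\<bar>\<phi> ?V (position n (t + h)) - \<phi> ?V (position n t)\<bar> \<le> L * h"
      using phi_lipschitz[OF uminus_velocity_at_cases, of n t "position n (t + h)" "position n t"]
        mult_left_mono[OF position_lipschitz[OF assms(1-3)] L_nonneg] by linarith
  qed (use discount_lipschitz[OF assms(1-3)] phi_bound[OF uminus_velocity_at_cases]
        discount_bounds[OF assms(1,2)] s_pos mu_nonneg assms K_nonneg in auto)
  finally show ?thesis by (simp add: algebra_simps)
qed

text \<open>Without a jump the motion is straight and everything is explicit. The backward equation
  makes the derivative of the discounted potential along the segment equal to minus the discount
  minus \<open>rate\<close> times the flip gain. Freezing this derivative at the left end costs its
  Lipschitz constant times h^2.\<close>

lemma step_zero:
  assumes n: "counting_path n" and t: "0 \<le> t" and h: "0 \<le> h" and same: "n t = n (t + h)"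
  shows "\<bar>potential_at n (t + h) - potential_at n t + h * discount n t + rate * h * flip_gain n t\<bar>
    \<le> ((s + \<mu>) * (1 + 2 * rate * K) + 2 * rate * L) * h\<^sup>2"
proof -
  define V where "V = velocity_at n t"
  define z where "z = position n t"
  define C where "C = (s + \<mu>) * (1 + 2 * rate * K) + 2 * rate * L"
  have V: "V = 1 \<or> V = - 1" using velocity_at_cases by (simp add: V_def)
  then have V': "- V = 1 \<or> - V = - 1" by auto
  have VV: "V * V = 1" using V by auto
  define d where "d w = discount n t * exp (- (s * w + \<mu> * (V * (max 0 (z + V * w) - max 0 z))))" for w
  define \<Delta> where "\<Delta> x = \<phi> (- V) x - \<phi> V x" for x
  have tele: "telegraph v n (t + w) = telegraph v n t + V * w" if "w \<in> {0..h}" for w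
    using telegraph_linear[OF n t _ _ same, of "t + w" v] that by (simp add: V_def velocity_at_def)
  have pos: "position n (t + w) = z + V * w" if "w \<in> {0..h}" for w
    using tele[OF that] by (simp add: position_def z_def)
  have d_eq: "discount n (t + w) = d w" if w: "w \<in> {0..h}" for w
  proof -
    have "time_above y v n (t + w) - time_above y v n t
        = integral {t..t + w} (\<lambda>r. heaviside (y + telegraph v n r))"
      by (rule time_above_diff) (use n t w in auto)
    also have "\<dots> = integral {t..t + w} (\<lambda>r. heaviside (z + V * (r - t)))"
    proof (rule integral_cong)
      fix r assume "r \<in> {t..t + w}"
      then have "position n (t + (r - t)) = z + V * (r - t)" using w by (intro pos) auto
      then show "heaviside (y + telegraph v n r) = heaviside (z + V * (r - t))"
        by (simp add: position_def)
    qed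
    also have "\<dots> = V * (max 0 (z + V * w) - max 0 z)"
      by (rule integral_heaviside_line) (use V w in auto)
    finally have eq: "time_above y v n (t + w) = time_above y v n t + V * (max 0 (z + V * w) - max 0 z)"
      by simp
    show ?thesis
      unfolding discount_def d_def eq exp_add[symmetric]
      by (simp only: distrib_left right_diff_distrib) simp
  qed
  have vel: "velocity_at n (t + h) = V" using same by (simp add: V_def velocity_at_def)
  have d0: "d 0 = discount n t" by (simp add: d_def)
  define E where "E w = d w * (- 1 - rate * \<Delta> (z + V * w))" for w
  define D where "D w = d w * \<phi> V (z + V * w)" for w
  note cont_phi = continuous_phi[OF V]
  have deriv: "(D has_real_derivative E w) (at w)" if nz: "z + V * w \<noteq> 0" for w
  proof -
    have 1: "((\<lambda>w. max 0 (z + V * w)) has_real_derivative heaviside (z + V * w) * V) (at w)"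
      using max_0_line_has_derivative[of z V w 0] nz by simp
    have 2: "(d has_real_derivative d w * (- (s + \<mu> * (V * (heaviside (z + V * w) * V))))) (at w)"
      unfolding d_def by (rule derivative_eq_intros 1 refl)+ (simp add: algebra_simps)
    have 3: "((\<lambda>w. \<phi> V (z + V * w)) has_real_derivative
        V * ((s + \<mu> * heaviside (z + V * w)) * \<phi> V (z + V * w) - 1 - rate * \<Delta> (z + V * w)) * V) (at w)"
      unfolding \<Delta>_def by (rule DERIV_chain2[where f = "\<phi> V" and g = "\<lambda>w. z + V * w", OF phi_ode[OF V nz]])
         (auto intro!: derivative_eq_intros)
    have "(D has_real_derivative
        d w * (- (s + \<mu> * (V * (heaviside (z + V * w) * V)))) * \<phi> V (z + V * w)
        + V * ((s + \<mu> * heaviside (z + V * w)) * \<phi> V (z + V * w) - 1 - rate * \<Delta> (z + V * w)) * V * d w) (at w)"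
      unfolding D_def by (rule DERIV_mult[OF 2 3])
    moreover have "d w * (- (s + \<mu> * (V * (heaviside (z + V * w) * V)))) * \<phi> V (z + V * w)
        + V * ((s + \<mu> * heaviside (z + V * w)) * \<phi> V (z + V * w) - 1 - rate * \<Delta> (z + V * w)) * V * d w = E w"
    \<comment> \<open>The decay of the discount cancels the killing term of the equation. With
      \<open>V\<close> kept symbolic, the leftover carries the factor \<open>V * V - 1\<close>,
      which is zero.\<close>
    proof -
      have "\<forall>H p q. d w * (- (s + \<mu> * (V * (H * V)))) * p + V * ((s + \<mu> * H) * p - 1 - rate * q) * V * d w
          = d w * ((V * V) * (- 1 - rate * q) + (V * V - 1) * s * p)"
        by (simp add: algebra_simps)
      then show ?thesis by (simp add: E_def VV)
    qed
    ultimately show ?thesis by simp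
  qed
  have Delta_bound: "\<bar>\<Delta> x\<bar> \<le> 2 * K" for x
    using phi_bound[OF V, of x] phi_bound[OF V', of x] by (auto simp: \<Delta>_def)
  have Delta_lip: "\<bar>\<Delta> x - \<Delta> x'\<bar> \<le> 2 * L * \<bar>x - x'\<bar>" for x x'
    using phi_lipschitz[OF V, of x x'] phi_lipschitz[OF V', of x x'] by (auto simp: \<Delta>_def)
  have C_nonneg: "0 \<le> C"
    using s_pos mu_nonneg rate_pos K_nonneg L_nonneg by (simp add: C_def)
  have E_lip: "\<bar>E w - E 0\<bar> \<le> C * h" if w: "w \<in> {0..h}" for w
  proof -
    have dw: "\<bar>d w - d 0\<bar> \<le> (s + \<mu>) * h"
    proof -
      have "\<bar>d w - d 0\<bar> \<le> (s + \<mu>) * w"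
        using discount_lipschitz[OF n t, of w] w d_eq[OF w] d0 by simp
      also have "\<dots> \<le> (s + \<mu>) * h" using w s_pos mu_nonneg by (intro mult_left_mono) auto
      finally show ?thesis .
    qed
    have "E w - E 0 = (d w - d 0) * (- 1 - rate * \<Delta> (z + V * w)) + d 0 * (rate * (\<Delta> z - \<Delta> (z + V * w)))"
      by (simp add: E_def algebra_simps)
    also have "\<bar>\<dots>\<bar> \<le> \<bar>d w - d 0\<bar> * \<bar>- 1 - rate * \<Delta> (z + V * w)\<bar> + \<bar>d 0\<bar> * (rate * \<bar>\<Delta> z - \<Delta> (z + V * w)\<bar>)"
      using rate_pos by (intro order_trans[OF abs_triangle_ineq]) (simp add: abs_mult)
    also have "\<dots> \<le> ((s + \<mu>) * h) * (1 + 2 * rate * K) + 1 * (rate * (2 * L * h))"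
    proof (intro add_mono mult_mono)
      have "\<bar>- 1 - rate * \<Delta> (z + V * w)\<bar> \<le> 1 + rate * \<bar>\<Delta> (z + V * w)\<bar>"
        using rate_pos abs_triangle_ineq[of "-1" "- rate * \<Delta> (z + V * w)"] by (simp add: abs_mult)
      also have "\<dots> \<le> 1 + rate * (2 * K)"
        using rate_pos Delta_bound by (intro add_mono mult_left_mono) auto
      finally show "\<bar>- 1 - rate * \<Delta> (z + V * w)\<bar> \<le> 1 + 2 * rate * K" by (simp add: algebra_simps)
      have "\<bar>\<Delta> z - \<Delta> (z + V * w)\<bar> \<le> 2 * L * \<bar>V * w\<bar>"
        using Delta_lip[of z "z + V * w"] by (simp add: abs_minus_commute)
      also have "\<dots> \<le> 2 * L * h" using V w L_nonneg by (intro mult_left_mono) auto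
      finally show "\<bar>\<Delta> z - \<Delta> (z + V * w)\<bar> \<le> 2 * L * h" .
      show "\<bar>d 0\<bar> \<le> 1" using discount_bounds[OF n t] d0 by simp
    qed (use dw rate_pos s_pos mu_nonneg h K_nonneg L_nonneg in auto)
    finally show ?thesis by (simp add: C_def algebra_simps)
  qed
  \<comment> \<open>Subtracting the initial slope leaves an integrand of size at most
    \<open>C * h\<close> on an interval of length \<open>h\<close>. The path crosses 0 at
    \<open>w = - V * z\<close>, where the potential may have a kink.\<close>
  have "((\<lambda>w. E w - E 0) has_integral ((D h - h * E 0) - (D 0 - 0 * E 0))) {0..h}"
  proof (rule fundamental_theorem_of_calculus_interior_strong[where S = "{- V * z}"])
    show "continuous_on {0..h} (\<lambda>w. D w - w * E 0)"
      unfolding D_def d_def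
      by (intro continuous_intros continuous_on_compose2[OF cont_phi]) auto
    fix w assume "w \<in> {0<..<h} - {- V * z}"
    then have nz: "z + V * w \<noteq> 0" using V by auto
    show "((\<lambda>w. D w - w * E 0) has_vector_derivative E w - E 0) (at w)"
      unfolding has_real_derivative_iff_has_vector_derivative[symmetric]
      using DERIV_diff[OF deriv[OF nz] DERIV_cmult_right[OF DERIV_ident, of "E 0"]] by simp
  qed (use h in auto)
  then have "norm ((D h - h * E 0) - (D 0 - 0 * E 0)) \<le> (C * h) * measure lborel {0..h}"
    by (rule has_integral_bound_real[where S = "{}", rotated 2]) (use C_nonneg h E_lip in auto)
  then have "\<bar>D h - D 0 - h * E 0\<bar> \<le> C * h\<^sup>2"
    using h by (simp add: power2_eq_square algebra_simps)
  moreover have "D h = potential_at n (t + h)"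
    using d_eq[of h] pos[of h] vel h by (simp add: D_def potential_at_def)
  moreover have "D 0 = potential_at n t"
    by (simp add: D_def potential_at_def d0 V_def z_def)
  moreover have "E 0 = - discount n t - rate * flip_gain n t"
    by (simp add: E_def d0 flip_gain_def \<Delta>_def V_def z_def algebra_simps)
  ultimately show ?thesis by (simp add: C_def algebra_simps)
qed

text \<open>One inequality covers all numbers of jumps, so expectations can be taken term by term.
  The weight of \<open>flip_gain\<close> is chosen for its mean: a Poisson variable of mean
  \<open>rate * h\<close> satisfies P(J = 1) = \<open>rate * h\<close> P(J = 0), so the weight has
  mean zero. The extra 1 in the last two constants absorbs \<open>h * discount n t\<close>, which is
  at most \<open>h\<close> and at most 1.\<close>

lemma potential_increment:
  assumes n: "counting_path n" and t: "0 \<le> t" and h: "0 \<le> h" "h \<le> 1"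
  defines "J \<equiv> n (t + h) - n t"
  shows "\<bar>potential_at n (t + h) - potential_at n t + h * discount n t
      + (rate * h * indicator {0} J - indicator {1} J) * flip_gain n t\<bar>
    \<le> ((s + \<mu>) * (1 + 2 * rate * K) + 2 * rate * L) * h\<^sup>2
      + ((s + \<mu>) * K + L + 1) * (h * indicator {1..} J) + (2 * K + 1) * indicator {2..} J" (is "?l \<le> ?r")
proof -
  have le: "n t \<le> n (t + h)" using counting_path_mono[OF n t, of "t + h"] h by simp
  have nonneg: "0 \<le> ((s + \<mu>) * (1 + 2 * rate * K) + 2 * rate * L) * h\<^sup>2"
      "0 \<le> (s + \<mu>) * K + L"
    using s_pos mu_nonneg rate_pos K_nonneg L_nonneg by auto
  have dh: "0 \<le> h * discount n t" "h * discount n t \<le> h"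
    using discount_bounds[OF n t] h by (auto simp: mult_left_le)
  consider "J = 0" | "J = 1" | "J \<ge> 2" by linarith
  then show ?thesis
  proof cases
    case 1
    then have "n t = n (t + h)" using le by (simp add: J_def)
    from step_zero[OF n t h(1) this] 1 show ?thesis by (simp add: algebra_simps)
  next
    case 2
    then have "n (t + h) = Suc (n t)" using le by (simp add: J_def)
    from step_one[OF n t h(1) this] have "?l \<le> ((s + \<mu>) * K + L) * h + h"
      using 2 dh by simp
    then show ?thesis using 2 nonneg(1) by (simp add: algebra_simps)
  next
    case 3
    then have "?l \<le> 2 * K + 1" using step_two[OF n t h(1)] dh h by auto
    moreover have "0 \<le> ((s + \<mu>) * K + L + 1) * h" using nonneg(2) h by simp
    ultimately show ?thesis using 3 nonneg(1) by (simp add: algebra_simps)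
  qed
qed

lemma discount_tendsto:
  assumes "paths_converge t p n"
  shows "(\<lambda>m. discount (p m) t) \<longlonglongrightarrow> discount n t"
  unfolding discount_def using velocity
  by (intro tendsto_exp tendsto_minus tendsto_add tendsto_mult tendsto_const time_above_tendsto[OF assms]) auto

lemma phi_tendsto:
  assumes "V = 1 \<or> V = - 1" "f \<longlonglongrightarrow> x"
  shows "(\<lambda>m. \<phi> V (f m)) \<longlonglongrightarrow> \<phi> V x"
  by (rule continuous_on_tendsto_compose[OF continuous_phi[OF assms(1)] assms(2)]) auto

lemma phi_velocity_tendsto:
  assumes "paths_converge t p n" "0 \<le> t" "c = 1 \<or> c = - 1"
  shows "(\<lambda>m. \<phi> (c * velocity_at (p m) t) (position (p m) t)) \<longlonglongrightarrow> \<phi> (c * velocity_at n t) (position n t)"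
proof -
  have "(\<lambda>m. \<phi> (c * velocity_at n t) (position (p m) t)) \<longlonglongrightarrow> \<phi> (c * velocity_at n t) (position n t)"
    unfolding position_def
    by (intro phi_tendsto tendsto_intros telegraph_tendsto[OF assms(1)])
       (use velocity_at_cases[of n t] assms in auto)
  moreover have "eventually (\<lambda>m. p m t = n t) sequentially"
    using assms by (auto simp: paths_converge_def)
  then have "eventually (\<lambda>m. \<phi> (c * velocity_at n t) (position (p m) t) = \<phi> (c * velocity_at (p m) t) (position (p m) t)) sequentially"
    by eventually_elim (simp add: velocity_at_def)
  ultimately show ?thesis by (rule Lim_transform_eventually)
qed

lemma potential_tendsto:
  assumes "paths_converge t p n" "0 \<le> t"
  shows "(\<lambda>m. potential_at (p m) t) \<longlonglongrightarrow> potential_at n t"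
  unfolding potential_at_def
  using tendsto_mult[OF discount_tendsto[OF assms(1)] phi_velocity_tendsto[OF assms, of 1]] by simp

lemma flip_gain_tendsto:
  assumes "paths_converge t p n" "0 \<le> t"
  shows "(\<lambda>m. flip_gain (p m) t) \<longlonglongrightarrow> flip_gain n t"
  unfolding flip_gain_def
  using tendsto_mult[OF discount_tendsto[OF assms(1)]
    tendsto_diff[OF phi_velocity_tendsto[OF assms, of "-1"] phi_velocity_tendsto[OF assms, of 1]]] by simp

end

section \<open>Path functionals and Poisson increments\<close>

text \<open>Times are rounded up, because right-continuity controls a path just after a given time.
  With \<open>Suc m\<close> cells there is no division by zero, and \<open>min\<close> keeps the
  rounded time at most \<open>t\<close>, so a frozen path is determined by finitely many values at
  times up to \<open>t\<close>.\<close>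

definition grid_index :: "real \<Rightarrow> nat \<Rightarrow> real \<Rightarrow> nat" where
  "grid_index t m u = min (Suc m) (nat \<lceil>u * real (Suc m) / t\<rceil>)"

definition grid_time :: "real \<Rightarrow> nat \<Rightarrow> nat \<Rightarrow> real" where
  "grid_time t m i = t * real i / real (Suc m)"

lemma grid_index_le: "grid_index t m u \<le> Suc m"
  by (simp add: grid_index_def)

lemma grid_time_bounds: "0 \<le> t \<Longrightarrow> i \<le> Suc m \<Longrightarrow> 0 \<le> grid_time t m i \<and> grid_time t m i \<le> t"
  using mult_left_mono[of "real i" "real (Suc m)" t] by (auto simp: grid_time_def field_simps)

lemma grid_time_mono: "0 \<le> t \<Longrightarrow> i \<le> j \<Longrightarrow> grid_time t m i \<le> grid_time t m j"
  by (auto simp: grid_time_def intro!: divide_right_mono mult_left_mono)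

lemma grid_index_mono: "0 \<le> t \<Longrightarrow> u \<le> u' \<Longrightarrow> grid_index t m u \<le> grid_index t m u'"
  unfolding grid_index_def
  by (intro min.mono order_refl nat_mono ceiling_mono divide_right_mono mult_right_mono) auto

lemma grid_time_index_bounds:
  assumes "0 < t" "0 \<le> u" "u \<le> t"
  shows "u \<le> grid_time t m (grid_index t m u)" "grid_time t m (grid_index t m u) \<le> u + t / real (Suc m)"
proof -
  define x where "x = u * real (Suc m) / t"
  have x: "0 \<le> x" "x \<le> real (Suc m)"
    using assms mult_right_mono[of u t "real (Suc m)"] by (auto simp: x_def field_simps)
  have "\<lceil>x\<rceil> \<le> int (Suc m)" using x(2) by (simp add: ceiling_le_iff)
  then have i: "real (grid_index t m u) = of_int \<lceil>x\<rceil>"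
  proof -
    have "nat \<lceil>x\<rceil> \<le> Suc m" using \<open>\<lceil>x\<rceil> \<le> int (Suc m)\<close> by linarith
    then show ?thesis using x(1) unfolding grid_index_def x_def[symmetric] by (simp add: min.absorb2)
  qed
  have u: "u = t * x / real (Suc m)" using assms by (simp add: x_def)
  show "u \<le> grid_time t m (grid_index t m u)"
    unfolding grid_time_def i by (subst u) (use assms in \<open>auto intro!: divide_right_mono mult_left_mono\<close>)
  have "grid_time t m (grid_index t m u) \<le> t * (x + 1) / real (Suc m)"
    unfolding grid_time_def i
    by (intro divide_right_mono mult_left_mono) (use assms of_int_ceiling_le_add_one[of x] in auto)
  also have "\<dots> = u + t / real (Suc m)" by (simp add: u add_divide_distrib distrib_left)
  finally show "grid_time t m (grid_index t m u) \<le> u + t / real (Suc m)" .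
qed

text \<open>A right-continuous path with values in the naturals is constant on some interval to the
  right of \<open>u\<close>, and the rounding error \<open>t / Suc m\<close> eventually stays inside
  that interval.\<close>

lemma grid_paths_converge:
  assumes n: "counting_path n" and rc: "\<And>u. 0 \<le> u \<Longrightarrow> continuous (at_right u) (\<lambda>s. real (n s))"
    and t: "0 \<le> t"
  shows "paths_converge t (\<lambda>m u. n (grid_time t m (grid_index t m u))) n"
  unfolding paths_converge_def
proof (intro conjI allI ballI)
  show "counting_path n" by fact
  show "counting_path (\<lambda>u. n (grid_time t m (grid_index t m u)))" for m
    unfolding counting_path_def using grid_time_bounds[OF t grid_index_le]
    by (auto intro!: counting_path_mono[OF n] grid_time_mono grid_index_mono t)
  fix u assume u: "u \<in> {0..t}"
  show "eventually (\<lambda>m. n (grid_time t m (grid_index t m u)) = n u) sequentially"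
  proof (cases "t = 0")
    case True
    then show ?thesis using u by (auto simp: grid_time_def)
  next
    case False
    then have t0: "0 < t" using t by simp
    have "((\<lambda>s. real (n s)) \<longlongrightarrow> real (n u)) (at_right u)"
      using rc[of u] u by (simp add: continuous_within)
    then have "eventually (\<lambda>s. dist (real (n s)) (real (n u)) < 1) (at_right u)"
      by (rule tendstoD) simp
    then obtain b where b: "u < b" "\<And>s. u < s \<Longrightarrow> s < b \<Longrightarrow> dist (real (n s)) (real (n u)) < 1"
      by (auto simp: eventually_at_right_field)
    have eq: "n s = n u" if "u \<le> s" "s < b" for s
    proof (cases "s = u")
      case False
      then have "\<bar>real (n s) - real (n u)\<bar> < 1" using b(2)[of s] that by (simp add: dist_real_def)
      then show ?thesis by linarith
    qed simp
    have "(\<lambda>m. u + t * (1 / real (Suc m))) \<longlonglongrightarrow> u + t * 0"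
      by (intro tendsto_intros LIMSEQ_Suc[OF lim_1_over_n])
    then have "eventually (\<lambda>m. u + t / real (Suc m) < b) sequentially"
      using order_tendstoD(2)[of _ u _ b] b(1) by simp
    then show ?thesis
    proof eventually_elim
      case (elim m)
      show ?case
        using grid_time_index_bounds[OF t0, of u m] u elim by (intro eq) auto
    qed
  qed
qed

text \<open>Sequential continuity in the path. It lets measurability, and independence from later
  increments, pass from frozen grid paths to the true path.\<close>

definition path_continuous :: "real \<Rightarrow> ((real \<Rightarrow> nat) \<Rightarrow> real) \<Rightarrow> bool" where
  "path_continuous t \<Psi> \<longleftrightarrow> (\<forall>p n. paths_converge t p n \<longrightarrow> (\<lambda>m. \<Psi> (p m)) \<longlonglongrightarrow> \<Psi> n)"

definition right_continuous_path :: "(real \<Rightarrow> nat) \<Rightarrow> bool" where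
  "right_continuous_path n \<longleftrightarrow> (\<forall>u\<ge>0. continuous (at_right u) (\<lambda>s. real (n s)))"

lemma path_continuous_grid:
  assumes "path_continuous t \<Psi>" "counting_path n" "right_continuous_path n" "0 \<le> t"
  shows "(\<lambda>m. \<Psi> (\<lambda>u. n (grid_time t m (grid_index t m u)))) \<longlonglongrightarrow> \<Psi> n"
  using assms grid_paths_converge[of n t] by (auto simp: path_continuous_def right_continuous_path_def)

lemma measurable_finite_grid:
  fixes N :: "real \<Rightarrow> 'a \<Rightarrow> nat" and F :: "(real \<Rightarrow> nat) \<Rightarrow> real"
  assumes "\<And>u. 0 \<le> u \<Longrightarrow> N u \<in> measurable M (count_space UNIV)" "0 \<le> t"
  shows "(\<lambda>\<omega>. F (\<lambda>u. N (grid_time t m (grid_index t m u)) \<omega>)) \<in> borel_measurable M"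
proof -
  let ?r = "\<lambda>\<omega>. \<lambda>i\<in>{..Suc m}. N (grid_time t m i) \<omega>"
  have "?r \<in> measurable M (PiM {..Suc m} (\<lambda>_. count_space UNIV))"
    using assms grid_time_bounds by (intro measurable_restrict) auto
  then have "?r \<in> measurable M (count_space (PiE {..Suc m} (\<lambda>_. UNIV)))"
    by (simp add: count_space_PiM_finite)
  then have "(\<lambda>\<omega>. (\<lambda>x. F (\<lambda>u. x (grid_index t m u))) (?r \<omega>)) \<in> borel_measurable M"
    by (rule measurable_compose) simp
  then show ?thesis using grid_index_le by simp
qed

lemma path_functional_measurable:
  fixes N :: "real \<Rightarrow> 'a \<Rightarrow> nat"
  assumes "path_continuous t \<Psi>" "0 \<le> t"
    and "\<And>u. 0 \<le> u \<Longrightarrow> N u \<in> measurable M (count_space UNIV)"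
    and "\<And>\<omega>. \<omega> \<in> space M \<Longrightarrow> counting_path (\<lambda>u. N u \<omega>)"
    and "\<And>\<omega>. \<omega> \<in> space M \<Longrightarrow> right_continuous_path (\<lambda>u. N u \<omega>)"
  shows "(\<lambda>\<omega>. \<Psi> (\<lambda>u. N u \<omega>)) \<in> borel_measurable M"
  proof (rule borel_measurable_LIMSEQ_real)
  fix \<omega> assume "\<omega> \<in> space M"
  then show "(\<lambda>m. \<Psi> (\<lambda>u. N (grid_time t m (grid_index t m u)) \<omega>)) \<longlonglongrightarrow> \<Psi> (\<lambda>u. N u \<omega>)"
    by (intro path_continuous_grid assms)
qed (intro measurable_finite_grid assms)

section \<open>Independence of the past and a later increment\<close>

lemma poisson_processD:
  assumes "poisson_process M rate N"
  shows "prob_space M" "\<And>t. 0 \<le> t \<Longrightarrow> N t \<in> measurable M (count_space UNIV)"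
    "\<And>\<omega>. \<omega> \<in> space M \<Longrightarrow> N 0 \<omega> = 0"
    "\<And>\<omega>. \<omega> \<in> space M \<Longrightarrow> counting_path (\<lambda>u. N u \<omega>)"
    "\<And>\<omega>. \<omega> \<in> space M \<Longrightarrow> right_continuous_path (\<lambda>u. N u \<omega>)"
    "\<And>s t. 0 \<le> s \<Longrightarrow> s < t \<Longrightarrow>
        distr M (count_space UNIV) (\<lambda>\<omega>. N t \<omega> - N s \<omega>) = measure_pmf (poisson_pmf (rate * (t - s)))"
    "\<And>n t. 0 \<le> t 0 \<Longrightarrow> (\<And>i. i < n \<Longrightarrow> t i < t (Suc i)) \<Longrightarrow>
        prob_space.indep_vars M (\<lambda>_. count_space UNIV) (\<lambda>i \<omega>. N (t (Suc i)) \<omega> - N (t i) \<omega>) {..<(n::nat)}"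
  using assms by (auto simp: poisson_process_def counting_path_def right_continuous_path_def)

lemma grid_increment_indep:
  fixes F :: "(real \<Rightarrow> nat) \<Rightarrow> real" and f :: "nat \<Rightarrow> real"
  assumes P: "poisson_process M rate N" and t: "0 < t" and h: "0 < h"
    and F: "\<And>n. counting_path n \<Longrightarrow> \<bar>F n\<bar> \<le> K" and f: "\<And>k. \<bar>f k\<bar> \<le> B"
  shows "(\<integral>\<omega>. F (\<lambda>u. N (grid_time t m (grid_index t m u)) \<omega>) * f (N (t + h) \<omega> - N t \<omega>) \<partial>M) =
    (\<integral>\<omega>. F (\<lambda>u. N (grid_time t m (grid_index t m u)) \<omega>) \<partial>M) * (\<integral>\<omega>. f (N (t + h) \<omega> - N t \<omega>) \<partial>M)"
proof -
  interpret prob_space M using poisson_processD(1)[OF P] .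
  \<comment> \<open>The grid of [0, t] with \<open>t + h\<close> appended as one further time, so
    that the cell with index \<open>Suc m\<close> is the later increment.\<close>
  define \<tau> where "\<tau> i = (if i \<le> Suc m then grid_time t m i else t + h)" for i
  define D where "D i \<omega> = N (\<tau> (Suc i)) \<omega> - N (\<tau> i) \<omega>" for i \<omega>
  have tau0: "\<tau> 0 = 0" and tau1: "\<tau> (Suc m) = t" and tau2: "\<tau> (Suc (Suc m)) = t + h"
    by (auto simp: \<tau>_def grid_time_def)
  have inc: "\<tau> i < \<tau> (Suc i)" if "i < Suc (Suc m)" for i
  proof (cases "i = Suc m")
    case True then show ?thesis using tau1 tau2 h by simp
  next
    case False
    then show ?thesis using that t by (auto simp: \<tau>_def grid_time_def divide_strict_right_mono)
  qed
  have nonneg: "0 \<le> \<tau> i" for i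
    using t h grid_time_bounds[of t i m] by (auto simp: \<tau>_def)
  have indep: "indep_vars (\<lambda>_. count_space UNIV) D {..<Suc (Suc m)}"
    unfolding D_def by (rule poisson_processD(7)[OF P]) (use inc nonneg in auto)
  let ?A = "{..<Suc m}" and ?B = "{Suc m}"
  \<comment> \<open>Because \<open>N 0\<close> is zero on every path, partial sums of increments
    recover the path values.\<close>
  define G where "G d = F (\<lambda>u. \<Sum>j<grid_index t m u. d j)" for d :: "nat \<Rightarrow> nat"
  have ind: "indep_var borel (G \<circ> (\<lambda>\<omega>. restrict (\<lambda>i. D i \<omega>) ?A)) borel ((\<lambda>d. f (d (Suc m))) \<circ> (\<lambda>\<omega>. restrict (\<lambda>i. D i \<omega>) ?B))"
    by (rule indep_var_compose[OF indep_var_restrict[OF indep]])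
       (auto simp: count_space_PiM_finite)
  have N_eq: "N (\<tau> i) \<omega> = (\<Sum>j<i. D j \<omega>)" if "\<omega> \<in> space M" "i \<le> Suc m" for i \<omega>
    using that(2)
  proof (induction i)
    case 0 then show ?case using poisson_processD(3)[OF P that(1)] tau0 by simp
  next
    case (Suc i)
    have "N (\<tau> i) \<omega> \<le> N (\<tau> (Suc i)) \<omega>"
      using counting_path_mono[OF poisson_processD(4)[OF P that(1)] nonneg[of i]] inc[of i] Suc.prems
      by (simp add: less_imp_le)
    then show ?case using Suc by (simp add: D_def)
  qed
  let ?X = "G \<circ> (\<lambda>\<omega>. restrict (\<lambda>i. D i \<omega>) ?A)"
  let ?Y = "(\<lambda>d. f (d (Suc m))) \<circ> (\<lambda>\<omega>. restrict (\<lambda>i. D i \<omega>) ?B)"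
  have X: "?X \<omega> = F (\<lambda>u. N (grid_time t m (grid_index t m u)) \<omega>)" if "\<omega> \<in> space M" for \<omega>
  proof -
    have "(\<Sum>j<grid_index t m u. restrict (\<lambda>i. D i \<omega>) ?A j) = N (grid_time t m (grid_index t m u)) \<omega>" for u
      using N_eq[OF that grid_index_le, of t u] grid_index_le[of t m u] by (simp add: \<tau>_def)
    then show ?thesis by (simp add: G_def)
  qed
  have Y: "?Y \<omega> = f (N (t + h) \<omega> - N t \<omega>)" for \<omega>
    using tau1 tau2 by (simp add: D_def)
  have X_bound: "\<bar>?X \<omega>\<bar> \<le> K" for \<omega>
  proof -
    have "counting_path (\<lambda>u. \<Sum>j<grid_index t m u. restrict (\<lambda>i. D i \<omega>) ?A j)"
      unfolding counting_path_def using t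
      by (auto intro!: sum_mono2 grid_index_mono dest: less_le_trans[OF _ grid_index_mono])
    then show ?thesis using F by (simp add: G_def)
  qed
  have Y_bound: "\<bar>?Y \<omega>\<bar> \<le> B" for \<omega> unfolding Y by (rule f)
  have "integrable M ?X"
    by (rule integrable_const_bound[where B = K]) (use indep_var_rv1[OF ind] X_bound in auto)
  moreover have "integrable M ?Y"
    by (rule integrable_const_bound[where B = B]) (use indep_var_rv2[OF ind] Y_bound in auto)
  ultimately have "(\<integral>\<omega>. ?X \<omega> * ?Y \<omega> \<partial>M) = (\<integral>\<omega>. ?X \<omega> \<partial>M) * (\<integral>\<omega>. ?Y \<omega> \<partial>M)"
    by (rule indep_var_lebesgue_integral[OF ind])
  then show ?thesis
    using X Y by (simp cong: Bochner_Integration.integral_cong)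
qed

text \<open>Both sides pass to the limit along the grids by dominated convergence.\<close>

lemma increment_indep:
  fixes \<Psi> :: "(real \<Rightarrow> nat) \<Rightarrow> real" and f :: "nat \<Rightarrow> real"
  assumes P: "poisson_process M rate N" and t: "0 \<le> t" and h: "0 < h"
    and \<Psi>: "path_continuous t \<Psi>"
    and bound: "\<And>n. counting_path n \<Longrightarrow> \<bar>\<Psi> n\<bar> \<le> K" and f: "\<And>k. \<bar>f k\<bar> \<le> B"
  shows "(\<integral>\<omega>. \<Psi> (\<lambda>u. N u \<omega>) * f (N (t + h) \<omega> - N t \<omega>) \<partial>M) =
    (\<integral>\<omega>. \<Psi> (\<lambda>u. N u \<omega>) \<partial>M) * (\<integral>\<omega>. f (N (t + h) \<omega> - N t \<omega>) \<partial>M)"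
proof -
  interpret prob_space M using poisson_processD(1)[OF P] .
  have [measurable]: "N u \<in> measurable M (count_space UNIV)" if "0 \<le> u" for u
    using poisson_processD(2)[OF P that] .
  have J: "(\<lambda>\<omega>. N (t + h) \<omega> - N t \<omega>) \<in> measurable M (count_space UNIV)"
  proof -
    have [measurable]: "N (t + h) \<in> measurable M (count_space UNIV)" "N t \<in> measurable M (count_space UNIV)"
      using t h poisson_processD(2)[OF P] by auto
    show ?thesis by measurable
  qed
  then have fJ: "(\<lambda>\<omega>. f (N (t + h) \<omega> - N t \<omega>)) \<in> borel_measurable M"
    by (rule measurable_compose) simp
  define g where "g m \<omega> = \<Psi> (\<lambda>u. N (grid_time t m (grid_index t m u)) \<omega>)" for m \<omega>
  have g_meas: "g m \<in> borel_measurable M" for m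
    unfolding g_def by (intro measurable_finite_grid poisson_processD(2)[OF P] t)
  have Psi_meas: "(\<lambda>\<omega>. \<Psi> (\<lambda>u. N u \<omega>)) \<in> borel_measurable M"
    by (intro path_functional_measurable[OF \<Psi> t] poisson_processD[OF P])
  have conv: "paths_converge t (\<lambda>m u. N (grid_time t m (grid_index t m u)) \<omega>) (\<lambda>u. N u \<omega>)" if "\<omega> \<in> space M" for \<omega>
    using poisson_processD(4,5)[OF P that] t by (intro grid_paths_converge) (auto simp: right_continuous_path_def)
  have lim: "(\<lambda>m. g m \<omega>) \<longlonglongrightarrow> \<Psi> (\<lambda>u. N u \<omega>)" if "\<omega> \<in> space M" for \<omega>
    using conv[OF that] \<Psi> by (auto simp: g_def path_continuous_def)
  have g_bound: "\<bar>g m \<omega>\<bar> \<le> K" if "\<omega> \<in> space M" for m \<omega>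
    unfolding g_def using conv[OF that] by (intro bound) (auto simp: paths_converge_def)
  have eq: "(\<integral>\<omega>. g m \<omega> * f (N (t + h) \<omega> - N t \<omega>) \<partial>M) = (\<integral>\<omega>. g m \<omega> \<partial>M) * (\<integral>\<omega>. f (N (t + h) \<omega> - N t \<omega>) \<partial>M)" for m
  proof (cases "t = 0")
    case True
    have "(\<integral>\<omega>. g m \<omega> * f (N (t + h) \<omega> - N t \<omega>) \<partial>M) = (\<integral>\<omega>. \<Psi> (\<lambda>_. 0) * f (N (t + h) \<omega> - N t \<omega>) \<partial>M)"
      by (rule Bochner_Integration.integral_cong) (use True poisson_processD(3)[OF P] in \<open>auto simp: g_def grid_time_def\<close>)
    moreover have "(\<integral>\<omega>. g m \<omega> \<partial>M) = (\<integral>\<omega>. \<Psi> (\<lambda>_. 0) \<partial>M)"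
      by (rule Bochner_Integration.integral_cong) (use True poisson_processD(3)[OF P] in \<open>auto simp: g_def grid_time_def\<close>)
    ultimately show ?thesis by (simp add: prob_space)
  next
    case False
    then show ?thesis
      unfolding g_def using t by (intro grid_increment_indep[OF P _ h bound f]) auto
  qed
  have 1: "(\<lambda>m. \<integral>\<omega>. g m \<omega> * f (N (t + h) \<omega> - N t \<omega>) \<partial>M) \<longlonglongrightarrow> (\<integral>\<omega>. \<Psi> (\<lambda>u. N u \<omega>) * f (N (t + h) \<omega> - N t \<omega>) \<partial>M)"
  proof (rule integral_dominated_convergence[where w = "\<lambda>_. K * B"])
    have "0 \<le> K" using bound[of "\<lambda>_. 0"] by (force simp: counting_path_def)
    then show "AE \<omega> in M. norm (g m \<omega> * f (N (t + h) \<omega> - N t \<omega>)) \<le> K * B" for m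
      using g_bound f by (auto simp: abs_mult intro!: mult_mono)
    show "AE \<omega> in M. (\<lambda>m. g m \<omega> * f (N (t + h) \<omega> - N t \<omega>)) \<longlonglongrightarrow> \<Psi> (\<lambda>u. N u \<omega>) * f (N (t + h) \<omega> - N t \<omega>)"
      using lim by (auto intro!: tendsto_mult)
  qed (use g_meas fJ Psi_meas in auto)
  have 2: "(\<lambda>m. \<integral>\<omega>. g m \<omega> \<partial>M) \<longlonglongrightarrow> (\<integral>\<omega>. \<Psi> (\<lambda>u. N u \<omega>) \<partial>M)"
    by (rule integral_dominated_convergence[where w = "\<lambda>_. K"])
       (use g_meas Psi_meas g_bound lim in auto)
  show ?thesis
    using LIMSEQ_unique[OF 1[unfolded eq] tendsto_mult_right[OF 2]] .
qed

lemma poisson_increment: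
  assumes P: "poisson_process M rate N" and s: "0 \<le> s" "s < t" and rate: "0 < rate"
  shows "measure M {\<omega> \<in> space M. N t \<omega> - N s \<omega> = k} = pmf (poisson_pmf (rate * (t - s))) k"
proof -
  have "N t \<in> measurable M (count_space UNIV)" "N s \<in> measurable M (count_space UNIV)"
    using s poisson_processD(2)[OF P] by auto
  then have J: "(\<lambda>\<omega>. N t \<omega> - N s \<omega>) \<in> measurable M (count_space UNIV)" by measurable
  have "measure M {\<omega> \<in> space M. N t \<omega> - N s \<omega> = k} = measure (distr M (count_space UNIV) (\<lambda>\<omega>. N t \<omega> - N s \<omega>)) {k}"
    by (subst measure_distr[OF J]) (auto intro!: arg_cong2[where f = measure])
  also have "\<dots> = pmf (poisson_pmf (rate * (t - s))) k"
    unfolding poisson_processD(6)[OF P s] by (simp add: pmf.rep_eq)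
  finally show ?thesis .
qed

section \<open>The Feynman--Kac formula\<close>

text \<open>The hypothesis looks forward only. For a point \<open>u\<close> to the left of
  \<open>t\<close> it is applied with base point \<open>u\<close>, and the Lipschitz bound then
  replaces \<open>g u\<close> by \<open>g t\<close> at a cost of the same quadratic order.\<close>

lemma has_derivative_of_quadratic_remainder:
  fixes f g :: "real \<Rightarrow> real"
  assumes t: "0 < t"
    and step: "\<And>t h. 0 \<le> t \<Longrightarrow> 0 < h \<Longrightarrow> h \<le> 1 \<Longrightarrow> \<bar>f (t + h) - f t - h * g t\<bar> \<le> C * h\<^sup>2"
    and lip: "\<And>t h. 0 \<le> t \<Longrightarrow> 0 \<le> h \<Longrightarrow> \<bar>g (t + h) - g t\<bar> \<le> B * h"
  shows "(f has_real_derivative g t) (at t)"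
  unfolding has_field_derivative_iff LIM_eq
proof (intro allI impI)
  fix r :: real assume r: "0 < r"
  define E where "E = max 0 C + max 0 B + 1"
  have E: "0 < E" "C + B \<le> E" "C \<le> E" by (auto simp: E_def)
  define d where "d = min (min 1 t) (r / E)"
  have d: "0 < d" using t r E by (simp add: d_def)
  have main: "\<bar>f u - f t - (u - t) * g t\<bar> \<le> E * (u - t)\<^sup>2" if u: "\<bar>u - t\<bar> < d" "u \<noteq> t" for u
  proof (cases "t < u")
    case True
    then have "\<bar>f (t + (u - t)) - f t - (u - t) * g t\<bar> \<le> C * (u - t)\<^sup>2"
      using u t by (intro step) (auto simp: d_def)
    also have "\<dots> \<le> E * (u - t)\<^sup>2" using E by (intro mult_right_mono) auto
    finally show ?thesis by simp
  next
    case False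
    then have *: "0 \<le> u" "0 < t - u" "t - u \<le> 1" using u t by (auto simp: d_def)
    have "f u - f t - (u - t) * g t = - (f (u + (t - u)) - f u - (t - u) * g u) + (t - u) * (g (u + (t - u)) - g u)"
      by (simp add: algebra_simps)
    also have "\<bar>\<dots>\<bar> \<le> \<bar>f (u + (t - u)) - f u - (t - u) * g u\<bar> + (t - u) * \<bar>g (u + (t - u)) - g u\<bar>"
      using * by (intro order_trans[OF abs_triangle_ineq]) (simp add: abs_mult)
    also have "\<dots> \<le> C * (t - u)\<^sup>2 + (t - u) * (B * (t - u))"
      using * by (intro add_mono step mult_left_mono lip) auto
    also have "\<dots> = (C + B) * (u - t)\<^sup>2" by (simp add: power2_eq_square algebra_simps)
    also have "\<dots> \<le> E * (u - t)\<^sup>2" using E by (intro mult_right_mono) auto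
    finally show ?thesis .
  qed
  show "\<exists>s>0. \<forall>x. x \<noteq> t \<and> norm (x - t) < s \<longrightarrow> norm ((f x - f t) / (x - t) - g t) < r"
  proof (intro exI[of _ d] conjI d allI impI)
    fix x assume x: "x \<noteq> t \<and> norm (x - t) < d"
    have "norm ((f x - f t) / (x - t) - g t) = \<bar>f x - f t - (x - t) * g t\<bar> / \<bar>x - t\<bar>"
      using x by (simp add: field_simps flip: abs_divide)
    also have "\<dots> \<le> E * (x - t)\<^sup>2 / \<bar>x - t\<bar>"
      using main[of x] x by (intro divide_right_mono) auto
    also have "\<dots> = E * \<bar>x - t\<bar>"
    proof -
      have "(x - t)\<^sup>2 = \<bar>x - t\<bar> * \<bar>x - t\<bar>" by (simp add: power2_eq_square)
      moreover have "E * (q * q) / q = E * q" if "q > 0" for q :: real using that by simp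
      ultimately show ?thesis using x by (metis right_minus_eq zero_less_abs_iff)
    qed
    also have "\<dots> < E * (r / E)" using x E by (intro mult_strict_left_mono) (auto simp: d_def)
    also have "\<dots> = r" using E by simp
    finally show "norm ((f x - f t) / (x - t) - g t) < r" .
  qed
qed

text \<open>The left sides are the probabilities that a Poisson variable of mean \<open>a\<close> is
  at least 1 and at least 2.\<close>

lemma exp_minus_bounds:
  fixes a :: real
  assumes "0 \<le> a"
  shows "1 - exp (- a) \<le> a" "1 - exp (- a) - a * exp (- a) \<le> a\<^sup>2"
proof -
  have 1: "1 - a \<le> exp (- a)" using exp_ge_add_one_self[of "- a"] by simp
  then show "1 - exp (- a) \<le> a" by simp
  have "(1 + a) * (1 - a) \<le> (1 + a) * exp (- a)" using 1 assms by (intro mult_left_mono) auto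
  then show "1 - exp (- a) - a * exp (- a) \<le> a\<^sup>2" by (simp add: algebra_simps power2_eq_square)
qed

lemma abs_integral_le:
  fixes f g :: "'a \<Rightarrow> real"
  assumes "integrable M f" "integrable M g" "\<And>x. x \<in> space M \<Longrightarrow> \<bar>f x\<bar> \<le> g x"
  shows "\<bar>\<integral>x. f x \<partial>M\<bar> \<le> (\<integral>x. g x \<partial>M)"
  using order_trans[OF integral_abs_bound integral_mono[OF integrable_abs[OF assms(1)] assms(2,3)]] .

section \<open>Mean of the discounted potential and its time derivative\<close>

locale poisson_potential = telegraph_potential s \<mu> rate K L y v \<phi> + prob_space M
  for s \<mu> rate K L y v :: real and \<phi> :: "real \<Rightarrow> real \<Rightarrow> real" and M :: "'a measure" +
  fixes N :: "real \<Rightarrow> 'a \<Rightarrow> nat"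
  assumes poisson: "poisson_process M rate N"
begin

lemma path: "\<omega> \<in> space M \<Longrightarrow> counting_path (\<lambda>u. N u \<omega>)"
  using poisson_processD(4)[OF poisson] .

lemma path_continuous_functionals:
  "0 \<le> t \<Longrightarrow> path_continuous t (\<lambda>n. discount n t)"
  "0 \<le> t \<Longrightarrow> path_continuous t (\<lambda>n. potential_at n t)"
  "0 \<le> t \<Longrightarrow> path_continuous t (\<lambda>n. flip_gain n t)"
  using discount_tendsto potential_tendsto flip_gain_tendsto by (auto simp: path_continuous_def)

lemma integrable_functional:
  assumes "path_continuous t \<Psi>" "0 \<le> t" "\<And>n. counting_path n \<Longrightarrow> \<bar>\<Psi> n\<bar> \<le> B"
  shows "integrable M (\<lambda>\<omega>. \<Psi> (\<lambda>u. N u \<omega>))"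
proof (rule integrable_const_bound[where B = B])
  show "(\<lambda>\<omega>. \<Psi> (\<lambda>u. N u \<omega>)) \<in> borel_measurable M"
    by (intro path_functional_measurable[OF assms(1,2)] poisson_processD[OF poisson])
qed (use assms(3) path in auto)

lemma abs_discount_le: "counting_path n \<Longrightarrow> 0 \<le> t \<Longrightarrow> \<bar>discount n t\<bar> \<le> 1"
  using discount_bounds[of n t] by simp

lemma integrable_functionals:
  assumes "0 \<le> t"
  shows "integrable M (\<lambda>\<omega>. discount (\<lambda>u. N u \<omega>) t)"
    "integrable M (\<lambda>\<omega>. potential_at (\<lambda>u. N u \<omega>) t)"
    "integrable M (\<lambda>\<omega>. flip_gain (\<lambda>u. N u \<omega>) t)"
  using assms abs_discount_le abs_potential_le abs_flip_gain_le
  by (auto intro!: integrable_functional path_continuous_functionals)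

definition mean_discount :: "real \<Rightarrow> real" where
  "mean_discount t = (\<integral>\<omega>. discount (\<lambda>u. N u \<omega>) t \<partial>M)"

definition mean_potential :: "real \<Rightarrow> real" where
  "mean_potential t = (\<integral>\<omega>. potential_at (\<lambda>u. N u \<omega>) t \<partial>M)"

text \<open>No jump, one jump and several jumps have probabilities of order 1, h and h^2, against
  errors of order h^2, h and 1. The constant collects these products and depends on neither
  \<open>t\<close> nor \<open>h\<close>.\<close>

lemma mean_potential_increment:
  "\<exists>C. \<forall>t h. 0 \<le> t \<longrightarrow> 0 < h \<longrightarrow> h \<le> 1 \<longrightarrow>
    \<bar>mean_potential (t + h) - mean_potential t + h * mean_discount t\<bar> \<le> C * h\<^sup>2"
proof -
  define C0 where "C0 = (s + \<mu>) * (1 + 2 * rate * K) + 2 * rate * L"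
  define C1 where "C1 = (s + \<mu>) * K + L + 1"
  define C2 where "C2 = 2 * K + 1"
  have C: "0 \<le> C1" "0 \<le> C2" using s_pos mu_nonneg K_nonneg L_nonneg by (auto simp: C1_def C2_def)
  have "\<bar>mean_potential (t + h) - mean_potential t + h * mean_discount t\<bar> \<le> (C0 + C1 * rate + C2 * rate\<^sup>2) * h\<^sup>2"
    if t: "0 \<le> t" and h: "0 < h" "h \<le> 1" for t h
  proof -
    define J where "J \<omega> = N (t + h) \<omega> - N t \<omega>" for \<omega>
    define n where "n \<omega> = (\<lambda>u. N u \<omega>)" for \<omega>
    define w where "w k = rate * h * indicator {0} k - indicator {1} k" for k :: nat
    have "N (t + h) \<in> measurable M (count_space UNIV)" "N t \<in> measurable M (count_space UNIV)"
      using t h poisson_processD(2)[OF poisson] by auto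
    then have J[measurable]: "J \<in> measurable M (count_space UNIV)" unfolding J_def by measurable
    have set_J: "(\<integral>\<omega>. (indicator A (J \<omega>) :: real) \<partial>M) = measure M {\<omega> \<in> space M. J \<omega> \<in> A}" for A
    proof -
      have "(\<integral>\<omega>. (indicator A (J \<omega>) :: real) \<partial>M) = (\<integral>\<omega>. indicator {\<omega> \<in> space M. J \<omega> \<in> A} \<omega> \<partial>M)"
        by (rule Bochner_Integration.integral_cong) (auto simp: indicator_def)
      then show ?thesis by simp
    qed
    have integrable_J: "integrable M (\<lambda>\<omega>. indicator A (J \<omega>) :: real)" for A
      by (rule integrable_const_bound[where B = 1]) (auto simp: indicator_def)
    define a where "a = rate * h"
    have a: "0 < a" using h rate_pos by (simp add: a_def)
    have p0: "(\<integral>\<omega>. indicator {0} (J \<omega>) \<partial>M) = exp (- a)"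
      using poisson_increment[OF poisson t _ rate_pos, of "t + h" 0] h a
      unfolding set_J by (simp add: J_def a_def)
    have p1: "(\<integral>\<omega>. indicator {1} (J \<omega>) \<partial>M) = a * exp (- a)"
      using poisson_increment[OF poisson t _ rate_pos, of "t + h" 1] h a
      unfolding set_J by (simp add: J_def a_def)
    have i1: "indicator {1..} k = 1 - (indicator {0} k :: real)" for k :: nat
      by (auto simp: indicator_def)
    have i2: "indicator {2..} k = 1 - (indicator {0} k :: real) - indicator {1} k" for k :: nat
      by (auto simp: indicator_def)
    have p1': "(\<integral>\<omega>. indicator {1..} (J \<omega>) \<partial>M) = 1 - exp (- a)"
      unfolding i1 by (subst Bochner_Integration.integral_diff) (auto simp: integrable_J p0 prob_space)
    have p2': "(\<integral>\<omega>. indicator {2..} (J \<omega>) \<partial>M) = 1 - exp (- a) - a * exp (- a)"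
      unfolding i2 by (subst Bochner_Integration.integral_diff, (auto simp: integrable_J)[2])+
        (use p0 p1 in \<open>auto simp: prob_space\<close>)
    have wJ: "(\<integral>\<omega>. w (J \<omega>) \<partial>M) = 0"
      unfolding w_def using p0 p1
      by (subst Bochner_Integration.integral_diff) (auto simp: integrable_J a_def)
    have wb: "\<bar>w k\<bar> \<le> rate * h + 1" for k using a by (auto simp: w_def a_def indicator_def)
    \<comment> \<open>\<open>flip_gain\<close> looks at the path up to \<open>t\<close> and the
      weight at the increment after \<open>t\<close>, so the mean factorises and the zero mean of
      the weight annihilates it.\<close>
    have flip: "(\<integral>\<omega>. flip_gain (n \<omega>) t * w (J \<omega>) \<partial>M) = 0"
    proof -
      have "(\<integral>\<omega>. flip_gain (n \<omega>) t * w (J \<omega>) \<partial>M) = (\<integral>\<omega>. flip_gain (n \<omega>) t \<partial>M) * (\<integral>\<omega>. w (J \<omega>) \<partial>M)"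
        unfolding J_def n_def
        by (rule increment_indep[OF poisson t h(1) path_continuous_functionals(3)[OF t] abs_flip_gain_le[OF _ t] wb])
      then show ?thesis using wJ by simp
    qed
    have int_flip: "integrable M (\<lambda>\<omega>. w (J \<omega>) * flip_gain (n \<omega>) t)"
    proof (rule integrable_const_bound[where B = "(rate * h + 1) * (2 * K)"])
      show "AE \<omega> in M. norm (w (J \<omega>) * flip_gain (n \<omega>) t) \<le> (rate * h + 1) * (2 * K)"
        using wb abs_flip_gain_le[OF path t] rate_pos h by (auto simp: abs_mult n_def intro!: AE_I2 mult_mono)
      show "(\<lambda>\<omega>. w (J \<omega>) * flip_gain (n \<omega>) t) \<in> borel_measurable M"
        using borel_measurable_integrable[OF integrable_functionals(3)[OF t]]
        by (intro borel_measurable_times measurable_compose[OF J]) (auto simp: n_def)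
    qed
    have th: "0 \<le> t + h" using t h by simp
    note ints = integrable_functionals[OF t, folded n_def] integrable_functionals[OF th, folded n_def] int_flip
    define X where "X \<omega> = potential_at (n \<omega>) (t + h) - potential_at (n \<omega>) t + h * discount (n \<omega>) t
      + w (J \<omega>) * flip_gain (n \<omega>) t" for \<omega>
    have X_int: "integrable M X"
      unfolding X_def by (intro Bochner_Integration.integrable_add Bochner_Integration.integrable_diff integrable_mult_right ints)
    have "(\<integral>\<omega>. X \<omega> \<partial>M) = mean_potential (t + h) - mean_potential t + h * mean_discount t"
      unfolding X_def mean_potential_def mean_discount_def n_def[symmetric]
      using ints flip by (simp add: mult.commute[of "w _"])
    moreover have "\<bar>\<integral>\<omega>. X \<omega> \<partial>M\<bar> \<le> (\<integral>\<omega>. C0 * h\<^sup>2 + C1 * (h * indicator {1..} (J \<omega>)) + C2 * indicator {2..} (J \<omega>) \<partial>M)"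
      by (rule abs_integral_le[OF X_int])
         (use potential_increment[OF path t _ h(2)] h in
           \<open>auto simp: X_def w_def J_def n_def C0_def C1_def C2_def integrable_J[unfolded J_def]\<close>)
    moreover have "(\<integral>\<omega>. C0 * h\<^sup>2 + C1 * (h * indicator {1..} (J \<omega>)) + C2 * indicator {2..} (J \<omega>) \<partial>M)
        = C0 * h\<^sup>2 + C1 * (h * (1 - exp (- a))) + C2 * (1 - exp (- a) - a * exp (- a))"
      by (simp add: integrable_J prob_space p1'[simplified] p2')
    moreover have "\<dots> \<le> C0 * h\<^sup>2 + C1 * (h * a) + C2 * a\<^sup>2"
      using exp_minus_bounds[of a] a C h by (intro add_mono mult_left_mono order_refl) auto
    ultimately show ?thesis by (simp add: a_def power2_eq_square algebra_simps)
  qed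
  then show ?thesis by blast
qed

lemma mean_discount_lipschitz:
  assumes "0 \<le> t" "0 \<le> h"
  shows "\<bar>mean_discount (t + h) - mean_discount t\<bar> \<le> (s + \<mu>) * h"
proof -
  have th: "0 \<le> t + h" using assms by simp
  have "mean_discount (t + h) - mean_discount t = (\<integral>\<omega>. discount (\<lambda>u. N u \<omega>) (t + h) - discount (\<lambda>u. N u \<omega>) t \<partial>M)"
    unfolding mean_discount_def
    by (rule Bochner_Integration.integral_diff[symmetric]) (intro integrable_functionals assms th)+
  also have "\<bar>\<dots>\<bar> \<le> (\<integral>\<omega>. (s + \<mu>) * h \<partial>M)"
    by (rule abs_integral_le) (use discount_lipschitz[OF path] assms th in \<open>auto intro!: integrable_functionals\<close>)
  finally show ?thesis by (simp add: prob_space)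
qed

lemma mean_potential_has_derivative:
  assumes "0 < t"
  shows "(mean_potential has_real_derivative - mean_discount t) (at t)"
proof -
  obtain C where "\<And>t h. 0 \<le> t \<Longrightarrow> 0 < h \<Longrightarrow> h \<le> 1 \<Longrightarrow>
    \<bar>mean_potential (t + h) - mean_potential t + h * mean_discount t\<bar> \<le> C * h\<^sup>2"
    using mean_potential_increment by blast
  then show ?thesis
    using mean_discount_lipschitz
    by (intro has_derivative_of_quadratic_remainder[OF assms, of _ _ C "s + \<mu>"])
       (auto simp: abs_minus_commute)
qed

lemma mean_potential_0: "mean_potential 0 = \<phi> v y"
proof -
  have "mean_potential 0 = (\<integral>\<omega>. \<phi> v y \<partial>M)"
    unfolding mean_potential_def
    by (rule Bochner_Integration.integral_cong)
       (use poisson_processD(3)[OF poisson] in \<open>auto simp: potential_at_def discount_def velocity_at_def position_def\<close>)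
  then show ?thesis by (simp add: prob_space)
qed

lemma mean_potential_at_right_0: "(mean_potential \<longlongrightarrow> \<phi> v y) (at_right 0)"
proof -
  obtain C where C: "\<And>t h. 0 \<le> t \<Longrightarrow> 0 < h \<Longrightarrow> h \<le> 1 \<Longrightarrow>
    \<bar>mean_potential (t + h) - mean_potential t + h * mean_discount t\<bar> \<le> C * h\<^sup>2"
    using mean_potential_increment by blast
  have "((\<lambda>h. mean_potential h - mean_potential 0) \<longlongrightarrow> 0) (at_right 0)"
  proof (rule Lim_null_comparison)
    have "eventually (\<lambda>h. h \<in> {0<..<1}) (at_right (0::real))"
      by (rule eventually_at_right_real) simp
    then show "eventually (\<lambda>h. norm (mean_potential h - mean_potential 0) \<le> C * h\<^sup>2 + h * \<bar>mean_discount 0\<bar>) (at_right 0)"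
    proof eventually_elim
      case (elim h)
      then have "\<bar>mean_potential h - mean_potential 0 + h * mean_discount 0\<bar> \<le> C * h\<^sup>2"
        using C[of 0 h] by simp
      moreover have "\<bar>h * mean_discount 0\<bar> = h * \<bar>mean_discount 0\<bar>" using elim by (simp add: abs_mult)
      ultimately show ?case by simp
    qed
    have "((\<lambda>h. C * h\<^sup>2 + h * \<bar>mean_discount 0\<bar>) \<longlongrightarrow> C * 0\<^sup>2 + 0 * \<bar>mean_discount 0\<bar>) (at_right 0)"
      by (intro tendsto_intros)
    then show "((\<lambda>h. C * h\<^sup>2 + h * \<bar>mean_discount 0\<bar>) \<longlongrightarrow> 0) (at_right 0)" by simp
  qed
  from tendsto_add[OF this tendsto_const[of "mean_potential 0"]] show ?thesis
    by (simp add: mean_potential_0)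
qed

lemma mean_discount_eq:
  "mean_discount t = exp (- (s * t)) * (\<integral>\<omega>. exp (- (\<mu> * time_above y v (\<lambda>u. N u \<omega>) t)) \<partial>M)"
proof -
  have "discount n t = exp (- (s * t)) * exp (- (\<mu> * time_above y v n t))" for n
    by (simp add: discount_def flip: exp_add)
  then show ?thesis by (simp add: mean_discount_def)
qed

lemma abs_mean_potential_le:
  assumes "0 \<le> t"
  shows "\<bar>mean_potential t\<bar> \<le> K * exp (- (s * t))"
proof -
  have "\<bar>mean_potential t\<bar> \<le> (\<integral>\<omega>. K * exp (- (s * t)) \<partial>M)"
    unfolding mean_potential_def
  proof (rule abs_integral_le)
    fix \<omega> assume \<omega>: "\<omega> \<in> space M"
    let ?n = "\<lambda>u. N u \<omega>"
    have "discount ?n t \<le> exp (- (s * t))"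
      using time_above_bounds(1)[OF path[OF \<omega>] assms] mu_nonneg by (simp add: discount_def)
    then have "\<bar>discount ?n t\<bar> * \<bar>\<phi> (velocity_at ?n t) (position ?n t)\<bar> \<le> exp (- (s * t)) * K"
      using discount_bounds[OF path[OF \<omega>] assms]
      by (intro mult_mono phi_bound velocity_at_cases) auto
    then show "\<bar>potential_at ?n t\<bar> \<le> K * exp (- (s * t))"
      by (simp add: potential_at_def abs_mult mult.commute)
  qed (use assms in \<open>auto intro!: integrable_functionals\<close>)
  then show ?thesis by (simp add: prob_space)
qed

text \<open>The mean potential has derivative \<open>- mean_discount\<close>, starts at
  \<open>\<phi> v y\<close> and tends to 0 like \<open>exp (- (s * t))\<close>. The integrand being
  nonnegative, the fundamental theorem on the half-line also gives integrability.\<close>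

theorem laplace_mean_discount:
  "set_integrable lborel {0<..} mean_discount"
  "(LBINT t:{0<..}. mean_discount t) = \<phi> v y"
proof -
  have lim: "(mean_potential \<longlongrightarrow> 0) at_top"
  proof (rule Lim_null_comparison)
    show "eventually (\<lambda>t. norm (mean_potential t) \<le> K * exp (- (s * t))) at_top"
      using eventually_ge_at_top[of 0] by eventually_elim (simp add: abs_mean_potential_le)
    have "filterlim (\<lambda>t. s * t) at_top at_top"
      using s_pos by (intro filterlim_tendsto_pos_mult_at_top[OF tendsto_const _ filterlim_ident])
    then have "((\<lambda>t. exp (- (s * t))) \<longlongrightarrow> 0) at_top"
      by (intro filterlim_compose[OF exp_at_bot] filterlim_compose[OF filterlim_uminus_at_bot_at_top])
    from tendsto_mult_right_zero[OF this] show "((\<lambda>t. K * exp (- (s * t))) \<longlongrightarrow> 0) at_top" by simp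
  qed
  have cont: "isCont mean_discount t" if "0 < t" for t
  proof -
    have "(s + \<mu>)-lipschitz_on {0<..} mean_discount"
    proof (rule lipschitz_onI)
      fix t u :: real assume "t \<in> {0<..}" "u \<in> {0<..}"
      then show "dist (mean_discount t) (mean_discount u) \<le> (s + \<mu>) * dist t u"
        using mean_discount_lipschitz[of t "u - t"] mean_discount_lipschitz[of u "t - u"]
        by (cases "t \<le> u") (auto simp: dist_real_def abs_minus_commute)
    qed (use s_pos mu_nonneg in simp)
    then have "continuous_on {0<..} mean_discount" by (rule lipschitz_on_continuous_on)
    then show ?thesis using that by (simp add: continuous_on_eq_continuous_at)
  qed
  have nonneg: "0 \<le> mean_discount t" if "0 \<le> t" for t
    unfolding mean_discount_def using discount_bounds[OF path that]
    by (intro integral_nonneg_AE AE_I2) (auto simp: less_imp_le)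
  have *: "set_integrable lborel (einterval 0 \<infinity>) mean_discount" (is ?A)
    "(LBINT t=0..\<infinity>. mean_discount t) = - 0 - (- \<phi> v y)" (is ?B)
  proof -
    have d: "((\<lambda>t. - mean_potential t) has_real_derivative mean_discount t) (at t)" if "0 < t" for t
      using DERIV_minus[OF mean_potential_has_derivative[OF that]] by simp
    have l0: "(((\<lambda>t. - mean_potential t) \<circ> real_of_ereal) \<longlongrightarrow> - \<phi> v y) (at_right 0)"
      using tendsto_minus[OF mean_potential_at_right_0]
      unfolding zero_ereal_def ereal_tendsto_simps by simp
    have l1: "(((\<lambda>t. - mean_potential t) \<circ> real_of_ereal) \<longlongrightarrow> - 0) (at_left \<infinity>)"
      by (rule ereal_tendsto_simps1(3)[THEN iffD2, OF tendsto_minus[OF lim]])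
    show ?A ?B
      by (rule interval_integral_FTC_nonneg[OF _ _ _ _ l0 l1]; use d cont nonneg in \<open>auto intro!: AE_I2 simp: zero_ereal_def\<close>)+
  qed
  have e: "einterval 0 \<infinity> = {0<..}" by (auto simp: einterval_def zero_ereal_def)
  show "set_integrable lborel {0<..} mean_discount" using *(1) by (simp add: e)
  show "(LBINT t:{0<..}. mean_discount t) = \<phi> v y"
    using *(2) by (simp add: interval_lebesgue_integral_def e)
qed

end

section \<open>First passage and arcsine densities\<close>

text \<open>Taking the distribution function as the primitive supplies both limits at infinity. Its
  derivative at \<open>x\<close> is found by comparing it with an integral based at
  \<open>x - 1\<close>.\<close>

lemma normal_cdf_exists:
  obtains \<Phi> :: "real \<Rightarrow> real" where "\<And>x. (\<Phi> has_real_derivative std_normal_density x) (at x)"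
    "(\<Phi> \<longlongrightarrow> 0) at_bot" "(\<Phi> \<longlongrightarrow> 1) at_top"
proof -
  define D where "D = density lborel std_normal_density"
  interpret prob_space D unfolding D_def by (rule prob_space_normal_density) simp
  interpret D: real_distribution D
    by standard (simp_all add: D_def)
  have "(cdf D has_real_derivative std_normal_density x) (at x)" for x
  proof -
    have diff: "cdf D t = cdf D (x - 1) + (LBINT y=x - 1..t. std_normal_density y)" if "x - 1 < t" for t
    proof -
      have "cdf D t - cdf D (x - 1) = measure D {x - 1<..t}"
        by (rule D.cdf_diff_eq[OF that])
      also have "\<dots> = enn2real (\<integral>\<^sup>+ y. ennreal (indicator {x - 1<..t} y *\<^sub>R std_normal_density y) \<partial>lborel)"
        unfolding measure_def D_def
        by (subst emeasure_density) (auto intro!: arg_cong[where f = enn2real] nn_integral_cong simp: indicator_def)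
      also have "\<dots> = (LBINT y:{x - 1<..t}. std_normal_density y)"
        unfolding set_lebesgue_integral_def by (rule integral_eq_nn_integral[symmetric]) auto
      also have "\<dots> = (LBINT y=x - 1..t. std_normal_density y)"
        using that by (intro interval_integral_Ioc[symmetric]) simp
      finally show ?thesis by simp
    qed
    have "continuous_on {x - 1..x + 1} std_normal_density"
      unfolding normal_density_def by (intro continuous_intros) auto
    then have "((\<lambda>t. LBINT y=x - 1..t. std_normal_density y) has_vector_derivative std_normal_density x)
        (at x within {x - 1..x + 1})"
      by (intro interval_integral_FTC2) auto
    then have "((\<lambda>t. LBINT y=x - 1..t. std_normal_density y) has_real_derivative std_normal_density x) (at x)"
      by (simp add: has_real_derivative_iff_has_vector_derivative at_within_Icc_at)
    then have "((\<lambda>t. cdf D (x - 1) + (LBINT y=x - 1..t. std_normal_density y)) has_real_derivative std_normal_density x) (at x)"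
      using DERIV_add[OF DERIV_const, of _ _ x UNIV "cdf D (x - 1)"] by simp
    moreover have "eventually (\<lambda>t. cdf D t = cdf D (x - 1) + (LBINT y=x - 1..t. std_normal_density y)) (nhds x)"
      using eventually_nhds_in_open[of "{x - 1<..}" x] by (auto elim!: eventually_mono intro!: diff)
    ultimately show ?thesis by (subst DERIV_cong_ev[OF refl _ refl])
  qed
  then show thesis
    using D.cdf_lim_at_bot D.cdf_lim_at_top_prob by (rule that)
qed

lemma hitting_density_nonneg: "0 \<le> a \<Longrightarrow> 0 \<le> t \<Longrightarrow> 0 \<le> hitting_density a t"
  by (simp add: hitting_density_def)

lemma hitting_density_measurable [measurable]: "hitting_density a \<in> borel_measurable borel"
  unfolding hitting_density_def by measurable

lemma isCont_hitting_density: "0 < t \<Longrightarrow> isCont (hitting_density a) t"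
  unfolding hitting_density_def by (intro continuous_intros) auto

lemma FTC_nonneg_Ioi:
  fixes F f :: "real \<Rightarrow> real"
  assumes "\<And>x. a < x \<Longrightarrow> (F has_real_derivative f x) (at x)"
    and "\<And>x. a < x \<Longrightarrow> isCont f x" "\<And>x. a < x \<Longrightarrow> 0 \<le> f x"
    and "(F \<longlongrightarrow> A) (at_right a)" "(F \<longlongrightarrow> B) at_top"
  shows "set_integrable lborel {a<..} f" "(LBINT x:{a<..}. f x) = B - A"
proof -
  have l: "((F \<circ> real_of_ereal) \<longlongrightarrow> A) (at_right (ereal a))" "((F \<circ> real_of_ereal) \<longlongrightarrow> B) (at_left \<infinity>)"
    using assms(4,5) by (simp_all only: ereal_tendsto_simps1)
  have *: "set_integrable lborel (einterval a \<infinity>) f" "(LBINT x=a..\<infinity>. f x) = B - A"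
    by (rule interval_integral_FTC_nonneg[OF _ _ _ _ l]; use assms(1-3) in \<open>auto intro!: AE_I2\<close>)+
  have e: "einterval a \<infinity> = {a<..}" by (auto simp: einterval_def)
  show "set_integrable lborel {a<..} f" "(LBINT x:{a<..}. f x) = B - A"
    using * by (simp_all add: e interval_lebesgue_integral_def)
qed

lemma FTC_nonneg_Ioo:
  fixes F f :: "real \<Rightarrow> real"
  assumes "a < b" "\<And>x. a < x \<Longrightarrow> x < b \<Longrightarrow> (F has_real_derivative f x) (at x)"
    and "\<And>x. a < x \<Longrightarrow> x < b \<Longrightarrow> isCont f x" "\<And>x. a < x \<Longrightarrow> x < b \<Longrightarrow> 0 \<le> f x"
    and "(F \<longlongrightarrow> A) (at_right a)" "(F \<longlongrightarrow> B) (at_left b)"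
  shows "set_integrable lborel {a<..<b} f" "(LBINT x:{a<..<b}. f x) = B - A"
proof -
  have l: "((F \<circ> real_of_ereal) \<longlongrightarrow> A) (at_right (ereal a))" "((F \<circ> real_of_ereal) \<longlongrightarrow> B) (at_left (ereal b))"
    using assms(5,6) by (simp_all only: ereal_tendsto_simps1)
  have *: "set_integrable lborel (einterval a b) f" "(LBINT x=a..b. f x) = B - A"
    by (rule interval_integral_FTC_nonneg[OF _ _ _ _ l]; use assms(1-4) in \<open>auto intro!: AE_I2\<close>)+
  show "set_integrable lborel {a<..<b} f" "(LBINT x:{a<..<b}. f x) = B - A"
    using * assms(1) by (simp_all add: interval_lebesgue_integral_def)
qed

text \<open>The primitive is the distribution function of the first passage time of Brownian motion with drift
  \<open>b = \<surd>(2 s)\<close>, multiplied by the Girsanov factor \<open>e\<^bsup>- a b\<^esup>\<close>.\<close>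

lemma laplace_hitting_density:
  assumes a: "0 < a" and s: "0 < s"
  shows "set_integrable lborel {0<..} (\<lambda>t. hitting_density a t * exp (- (s * t)))"
    "(LBINT t:{0<..}. hitting_density a t * exp (- (s * t))) = exp (- (a * sqrt (2 * s)))"
proof -
  obtain \<Phi> where \<Phi>: "\<And>x. (\<Phi> has_real_derivative std_normal_density x) (at x)"
    "(\<Phi> \<longlongrightarrow> 0) at_bot" "(\<Phi> \<longlongrightarrow> 1) at_top"
    using normal_cdf_exists by blast
  define b where "b = sqrt (2 * s)"
  have b: "0 < b" "b\<^sup>2 = 2 * s" using s by (auto simp: b_def)
  define z1 z2 where "z1 t = b * sqrt t - a / sqrt t" and "z2 t = - (b * sqrt t) - a / sqrt t" for t
  define F where "F t = exp (- (a * b)) * \<Phi> (z1 t) + exp (a * b) * \<Phi> (z2 t)" for t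
  have deriv: "(F has_real_derivative hitting_density a t * exp (- (s * t))) (at t)" if t: "0 < t" for t
  proof -
    define w where "w = sqrt t"
    have w: "0 < w" "t = w\<^sup>2" "sqrt t = w" using t by (auto simp: w_def)
    have ds: "(sqrt has_real_derivative inverse w / 2) (at t)"
      using DERIV_real_sqrt[OF t] by (simp add: w_def)
    have d1: "(z1 has_real_derivative b * (inverse w / 2) + a * (inverse w / 2) / w\<^sup>2) (at t)"
      unfolding z1_def using w
      by (auto intro!: derivative_eq_intros ds simp: power2_eq_square)
    have d2: "(z2 has_real_derivative - (b * (inverse w / 2)) + a * (inverse w / 2) / w\<^sup>2) (at t)"
      unfolding z2_def using w
      by (auto intro!: derivative_eq_intros ds simp: power2_eq_square)
    \<comment> \<open>Completing the square: each Girsanov factor times its Gaussian density equals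
      this same \<open>e\<close>. In the derivative of \<open>F\<close> the terms with
      \<open>b\<close> therefore cancel and the terms with \<open>a\<close> add up.\<close>
    define e where "e = exp (- (a\<^sup>2 / (2 * t))) * exp (- (s * t)) / sqrt (2 * pi)"
    have n1: "exp (- (a * b)) * std_normal_density (z1 t) = e"
    proof -
      have "- (a * b) - (z1 t)\<^sup>2 / 2 = - (a\<^sup>2 / (2 * t)) - s * t"
        using w b by (simp add: z1_def power2_eq_square field_simps)
      then show ?thesis
        unfolding e_def std_normal_density_def by (simp add: mult_exp_exp)
    qed
    have n2: "exp (a * b) * std_normal_density (z2 t) = e"
    proof -
      have "a * b - (z2 t)\<^sup>2 / 2 = - (a\<^sup>2 / (2 * t)) - s * t"
        using w b by (simp add: z2_def power2_eq_square field_simps)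
      then show ?thesis
        unfolding e_def std_normal_density_def by (simp add: mult_exp_exp)
    qed
    have "(F has_real_derivative
        exp (- (a * b)) * (std_normal_density (z1 t) * (b * (inverse w / 2) + a * (inverse w / 2) / w\<^sup>2))
        + exp (a * b) * (std_normal_density (z2 t) * (- (b * (inverse w / 2)) + a * (inverse w / 2) / w\<^sup>2))) (at t)"
      unfolding F_def
      by (intro DERIV_add DERIV_cmult DERIV_chain2[OF \<Phi>(1)] d1 d2)
    moreover have "exp (- (a * b)) * (std_normal_density (z1 t) * (b * (inverse w / 2) + a * (inverse w / 2) / w\<^sup>2))
        + exp (a * b) * (std_normal_density (z2 t) * (- (b * (inverse w / 2)) + a * (inverse w / 2) / w\<^sup>2))
        = e * (a / (w * w\<^sup>2))"
      unfolding mult.assoc[symmetric] n1 n2 using w(1) by (simp add: field_simps)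
    moreover have "sqrt (2 * pi * t ^ 3) = sqrt (2 * pi) * (w * w\<^sup>2)"
    proof -
      have "2 * pi * t ^ 3 = 2 * pi * (w * w\<^sup>2)\<^sup>2" by (simp add: w(2) power2_eq_square power3_eq_cube)
      then show ?thesis using w(1) by (simp add: real_sqrt_mult)
    qed
    then have "e * (a / (w * w\<^sup>2)) = hitting_density a t * exp (- (s * t))"
      by (simp add: e_def hitting_density_def)
    ultimately show ?thesis by simp
  qed
  have bot: "filterlim z1 at_bot (at_right 0)" "filterlim z2 at_bot (at_right 0)" "filterlim z2 at_bot at_top"
    unfolding z1_def z2_def using a b(1) by real_asymp+
  have top: "filterlim z1 at_top at_top"
    unfolding z1_def using a b(1) by real_asymp
  have F0: "(F \<longlongrightarrow> exp (- (a * b)) * 0 + exp (a * b) * 0) (at_right 0)"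
    unfolding F_def by (intro tendsto_intros filterlim_compose[OF \<Phi>(2)] bot)
  have F1: "(F \<longlongrightarrow> exp (- (a * b)) * 1 + exp (a * b) * 0) at_top"
    unfolding F_def by (intro tendsto_intros filterlim_compose[OF \<Phi>(2)] filterlim_compose[OF \<Phi>(3)] bot top)
  have c: "isCont (\<lambda>t. hitting_density a t * exp (- (s * t))) t" if "0 < t" for t
    using isCont_hitting_density[OF that] by (intro continuous_intros) auto
  note * = FTC_nonneg_Ioi[OF deriv c _ F0 F1]
  show "set_integrable lborel {0<..} (\<lambda>t. hitting_density a t * exp (- (s * t)))"
    by (rule *(1)) (use a in \<open>auto intro!: mult_nonneg_nonneg hitting_density_nonneg\<close>)
  show "(LBINT t:{0<..}. hitting_density a t * exp (- (s * t))) = exp (- (a * sqrt (2 * s)))"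
    by (subst *(2)) (use a in \<open>auto intro!: mult_nonneg_nonneg hitting_density_nonneg simp: b_def\<close>)
qed

section \<open>The arcsine law\<close>

lemma arcsine_density_nonneg: "0 \<le> y \<Longrightarrow> y \<le> 1 \<Longrightarrow> 0 \<le> arcsine_density y"
  by (simp add: arcsine_density_def)

lemma arcsine_density_measurable [measurable]: "arcsine_density \<in> borel_measurable borel"
  unfolding arcsine_density_def by measurable

lemma isCont_arcsine_density: "0 < y \<Longrightarrow> y < 1 \<Longrightarrow> isCont arcsine_density y"
  unfolding arcsine_density_def by (intro continuous_intros) auto

text \<open>The primitive comes from the substitution y = sin(theta)^2, for which the arcsine law is
  uniform in theta and \<open>sqrt y / sqrt (1 - y)\<close> is tan(theta). The rational factor
  arises as the integral of exp(- s t - (r - s) t y) over t > 0; the case \<open>r = s\<close> gives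
  the total mass.\<close>

lemma arcsine_density_rational_integral:
  assumes s: "0 < s" and r: "0 < r"
  shows "set_integrable lborel {0<..<1} (\<lambda>y. arcsine_density y / (s + (r - s) * y))"
    "(LBINT y:{0<..<1}. arcsine_density y / (s + (r - s) * y)) = 1 / sqrt (s * r)"
proof -
  define k where "k = sqrt (r / s)"
  have k: "0 < k" "k\<^sup>2 = r / s" using s r by (auto simp: k_def)
  define F where "F y = 2 / (pi * sqrt (s * r)) * arctan (k * (sqrt y / sqrt (1 - y)))" for y
  have den: "0 < s + (r - s) * y" if "0 < y" "y < 1" for y
  proof -
    have "s + (r - s) * y = s * (1 - y) + r * y" by (simp add: algebra_simps)
    then show ?thesis using that s r by (simp add: add_pos_pos)
  qed
  have deriv: "(F has_real_derivative arcsine_density y / (s + (r - s) * y)) (at y)" if y: "0 < y" "y < 1" for y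
  proof -
    define p q where "p = sqrt y" and "q = sqrt (1 - y)"
    have p: "0 < p" "p\<^sup>2 = y" "0 < q" "q\<^sup>2 = 1 - y" using y by (auto simp: p_def q_def)
    have dp: "(sqrt has_real_derivative inverse p / 2) (at y)"
      using DERIV_real_sqrt[OF y(1)] by (simp add: p_def)
    have dq: "((\<lambda>y. sqrt (1 - y)) has_real_derivative - (inverse q / 2)) (at y)"
      unfolding q_def using y by (auto intro!: derivative_eq_intros)
    have "((\<lambda>y. sqrt y / sqrt (1 - y)) has_real_derivative (inverse p / 2 * q - p * (- (inverse q / 2))) / (q * q)) (at y)"
      using DERIV_divide[OF dp dq] p by (simp add: p_def q_def)
    also have "(inverse p / 2 * q - p * (- (inverse q / 2))) / (q * q) = (p\<^sup>2 + q\<^sup>2) / (2 * p * q * q\<^sup>2)"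
      using p(1,3) by (simp add: field_simps power2_eq_square)
    also have "\<dots> = 1 / (2 * p * q * q\<^sup>2)" using p by simp
    finally have d: "((\<lambda>y. sqrt y / sqrt (1 - y)) has_real_derivative 1 / (2 * p * q * q\<^sup>2)) (at y)" .
    have "(F has_real_derivative 2 / (pi * sqrt (s * r)) * (inverse (1 + (k * (sqrt y / sqrt (1 - y)))\<^sup>2) * (k * (1 / (2 * p * q * q\<^sup>2))))) (at y)"
      unfolding F_def by (intro DERIV_cmult DERIV_chain2[OF DERIV_arctan] d)
    moreover have "2 / (pi * sqrt (s * r)) * (inverse (1 + (k * (sqrt y / sqrt (1 - y)))\<^sup>2) * (k * (1 / (2 * p * q * q\<^sup>2))))
        = arcsine_density y / (s + (r - s) * y)"
    proof -
      have 1: "1 + (k * (sqrt y / sqrt (1 - y)))\<^sup>2 = (s + (r - s) * y) / (s * q\<^sup>2)"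
      proof -
        have "(sqrt y / sqrt (1 - y))\<^sup>2 = y / (1 - y)" using y by (simp add: power_divide)
        then have "1 + (k * (sqrt y / sqrt (1 - y)))\<^sup>2 = 1 + r / s * (y / (1 - y))"
          by (simp only: power_mult_distrib k(2))
        also have "\<dots> = (s + (r - s) * y) / (s * (1 - y))" using s y by (simp add: field_simps)
        finally show ?thesis by (simp only: p(4))
      qed
      have 2: "sqrt (s * r) = s * k"
        using s r by (simp add: k_def real_sqrt_mult real_sqrt_divide field_simps)
      have 3: "arcsine_density y = 1 / (pi * (p * q))"
        by (simp add: arcsine_density_def real_sqrt_mult p_def q_def)
      show ?thesis
      proof -
        have "2 / (pi * (s * k)) * (inverse (m / (s * q\<^sup>2)) * (k * (1 / (2 * p * q * q\<^sup>2)))) = 1 / (pi * (p * q)) / m"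
          if "0 < m" for m
          using s k(1) p(1,3) that by (simp add: field_simps)
        from this[OF den[OF y]] show ?thesis by (simp only: 1 2 3)
      qed
    qed
    ultimately show ?thesis by simp
  qed
  have F0: "(F \<longlongrightarrow> 0) (at_right 0)"
  proof -
    have "((\<lambda>y. k * (sqrt y / sqrt (1 - y))) \<longlongrightarrow> k * (sqrt 0 / sqrt (1 - 0))) (at_right 0)"
      by (intro tendsto_intros) auto
    then have "(F \<longlongrightarrow> 2 / (pi * sqrt (s * r)) * arctan (k * (sqrt 0 / sqrt (1 - 0)))) (at_right 0)"
      unfolding F_def by (rule tendsto_mult[OF tendsto_const tendsto_arctan])
    then show ?thesis by simp
  qed
  have F1: "(F \<longlongrightarrow> 1 / sqrt (s * r)) (at_left 1)"
  proof -
    have "filterlim (\<lambda>y. k * (sqrt y / sqrt (1 - y))) at_top (at_left 1)"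
      using k(1) by real_asymp
    then have "(F \<longlongrightarrow> 2 / (pi * sqrt (s * r)) * (pi / 2)) (at_left 1)"
      unfolding F_def by (intro tendsto_mult tendsto_const filterlim_compose[OF tendsto_arctan_at_top])
    then show ?thesis by simp
  qed
  have c: "isCont (\<lambda>y. arcsine_density y / (s + (r - s) * y)) y" if "0 < y" "y < 1" for y
    using den[OF that] isCont_arcsine_density[OF that] by (intro continuous_intros) auto
  have nonneg: "0 \<le> arcsine_density y / (s + (r - s) * y)" if "0 < y" "y < 1" for y
    using den[OF that] that by (intro divide_nonneg_pos arcsine_density_nonneg) auto
  note * = FTC_nonneg_Ioo[OF zero_less_one deriv c nonneg F0 F1]
  show "set_integrable lborel {0<..<1} (\<lambda>y. arcsine_density y / (s + (r - s) * y))"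
    "(LBINT y:{0<..<1}. arcsine_density y / (s + (r - s) * y)) = 1 / sqrt (s * r)"
    using * by auto
qed

lemma arcsine_density_integral:
  assumes "0 < y" "y \<le> 1"
  shows "set_integrable lborel {0<..<y} arcsine_density"
    "(LBINT x:{0<..<y}. arcsine_density x) = 2 / pi * arcsin (sqrt y)"
proof -
  have deriv: "((\<lambda>x. 2 / pi * arcsin (sqrt x)) has_real_derivative arcsine_density x) (at x)" if "0 < x" "x < y" for x
  proof -
    have x: "0 < x" "x < 1" using that assms by auto
    have "((\<lambda>x. 2 / pi * arcsin (sqrt x)) has_real_derivative 2 / pi * (inverse (sqrt (1 - (sqrt x)\<^sup>2)) * (inverse (sqrt x) / 2))) (at x)"
      using x by (intro DERIV_cmult DERIV_chain2[OF DERIV_arcsin] DERIV_real_sqrt)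
         (auto intro: less_le_trans[of _ 0])
    moreover have "2 / pi * (inverse (sqrt (1 - (sqrt x)\<^sup>2)) * (inverse (sqrt x) / 2)) = arcsine_density x"
      unfolding arcsine_density_def real_sqrt_mult using x by (simp add: divide_simps)
    ultimately show ?thesis by simp
  qed
  have cont: "continuous_on {0..1} (\<lambda>x. 2 / pi * arcsin (sqrt x))"
    by (intro continuous_intros) (auto intro: order_trans[of _ 0])
  have "((\<lambda>x. 2 / pi * arcsin (sqrt x)) \<longlongrightarrow> 2 / pi * arcsin (sqrt 0)) (at_right 0)"
    by (rule continuous_on_Icc_at_rightD[OF cont]) simp
  then have F0: "((\<lambda>x. 2 / pi * arcsin (sqrt x)) \<longlongrightarrow> 0) (at_right 0)" by simp
  have F1: "((\<lambda>x. 2 / pi * arcsin (sqrt x)) \<longlongrightarrow> 2 / pi * arcsin (sqrt y)) (at_left y)"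
    by (rule continuous_on_Icc_at_leftD[OF continuous_on_subset[OF cont]]) (use assms in auto)
  have c: "isCont arcsine_density x" if "0 < x" "x < y" for x
    using that assms by (intro isCont_arcsine_density) auto
  have nonneg: "0 \<le> arcsine_density x" if "0 < x" "x < y" for x
    using that assms by (intro arcsine_density_nonneg) auto
  note * = FTC_nonneg_Ioo[OF assms(1) deriv c nonneg F0 F1]
  show "set_integrable lborel {0<..<y} arcsine_density"
    "(LBINT x:{0<..<y}. arcsine_density x) = 2 / pi * arcsin (sqrt y)"
    using * by auto
qed

lemma sets_arcsine_distribution [simp, measurable_cong]: "sets arcsine_distribution = sets borel"
  by (simp add: arcsine_distribution_def)

lemma space_arcsine_distribution [simp]: "space arcsine_distribution = UNIV"
  by (simp add: arcsine_distribution_def)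

lemma emeasure_arcsine_distribution_atMost:
  assumes "0 < y" "y \<le> 1"
  shows "emeasure arcsine_distribution {..y} = ennreal (2 / pi * arcsin (sqrt y))"
proof -
  have "emeasure arcsine_distribution {..y} =
      (\<integral>\<^sup>+ x. ennreal (indicator {0<..<1} x * arcsine_density x) * indicator {..y} x \<partial>lborel)"
    unfolding arcsine_distribution_def by (subst emeasure_density) auto
  also have "\<dots> = (\<integral>\<^sup>+ x. ennreal (indicator {0<..<y} x *\<^sub>R arcsine_density x) \<partial>lborel)"
  proof (rule nn_integral_cong_AE)
    show "AE x in lborel. ennreal (indicator {0<..<1} x * arcsine_density x) * indicator {..y} x =
        ennreal (indicator {0<..<y} x *\<^sub>R arcsine_density x)"
      using AE_lborel_singleton[of y]
      by eventually_elim (use assms in \<open>auto simp: indicator_def\<close>)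
  qed
  also have "\<dots> = ennreal (2 / pi * arcsin (sqrt y))"
    using arcsine_density_integral[OF assms] assms unfolding set_integrable_def set_lebesgue_integral_def
    by (subst nn_integral_eq_integral) (auto intro!: arcsine_density_nonneg split: split_indicator)
  finally show ?thesis .
qed

lemma prob_space_arcsine_distribution: "prob_space arcsine_distribution"
proof
  have "emeasure arcsine_distribution UNIV =
      (\<integral>\<^sup>+ x. ennreal (indicator {0<..<1} x *\<^sub>R arcsine_density x) \<partial>lborel)"
    unfolding arcsine_distribution_def by (subst emeasure_density) auto
  also have "\<dots> = ennreal (2 / pi * arcsin (sqrt 1))"
    using arcsine_density_integral[of 1] unfolding set_integrable_def set_lebesgue_integral_def
    by (subst nn_integral_eq_integral) (auto intro!: arcsine_density_nonneg split: split_indicator)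
  finally show "emeasure arcsine_distribution (space arcsine_distribution) = 1" by simp
qed

lemma cdf_arcsine_distribution:
  assumes "0 \<le> y" "y \<le> 1"
  shows "cdf arcsine_distribution y = 2 / pi * arcsin (sqrt y)"
proof (cases "y = 0")
  case False
  then have "0 \<le> arcsin (sqrt y)" using assms arcsin_le_arcsin[of 0 "sqrt y"] by simp
  then show ?thesis
    using emeasure_arcsine_distribution_atMost[of y] assms False by (simp add: cdf_def measure_def)
next
  case True
  have "emeasure arcsine_distribution {..0} =
      (\<integral>\<^sup>+ x. ennreal (indicator {0<..<1} x * arcsine_density x) * indicator {..0} x \<partial>lborel)"
    unfolding arcsine_distribution_def by (subst emeasure_density) auto
  also have "\<dots> = (\<integral>\<^sup>+ x. 0 \<partial>(lborel :: real measure))"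
    by (rule nn_integral_cong) (auto simp: indicator_def)
  finally have "emeasure arcsine_distribution {..0} = 0" by simp
  then show ?thesis using True by (simp add: cdf_def measure_def)
qed

lemma nn_integral_arcsine_distribution:
  assumes [measurable]: "f \<in> borel_measurable borel"
  shows "(\<integral>\<^sup>+ y. f y \<partial>arcsine_distribution) = (\<integral>\<^sup>+ y. ennreal (indicator {0<..<1} y * arcsine_density y) * f y \<partial>lborel)"
  unfolding arcsine_distribution_def by (rule nn_integral_density) auto

lemma AE_arcsine_distribution: "AE y in arcsine_distribution. 0 < y \<and> y < 1"
  unfolding arcsine_distribution_def
  by (subst AE_density) (auto simp: indicator_def)

section \<open>Laplace transform of the limit law\<close>

lemma nn_integral_exp_Ioi:
  assumes "0 < c"
  shows "(\<integral>\<^sup>+ t. ennreal (exp (- (c * t))) * indicator {0<..} t \<partial>lborel) = ennreal (1 / c)"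
    and "set_integrable lborel {0<..} (\<lambda>t. exp (- (c * t)))"
    and "(LBINT t:{0<..}. exp (- (c * t))) = 1 / c"
proof -
  have d: "((\<lambda>t. - (exp (- (c * t)) / c)) has_real_derivative exp (- (c * t))) (at t)" for t
    using assms by (auto intro!: derivative_eq_intros)
  have 0: "((\<lambda>t. - (exp (- (c * t)) / c)) \<longlongrightarrow> - (exp (- (c * 0)) / c)) (at_right 0)"
    using assms by (intro tendsto_intros) auto
  have 1: "((\<lambda>t. - (exp (- (c * t)) / c)) \<longlongrightarrow> 0) at_top"
    using assms by real_asymp
  have ct: "isCont (\<lambda>t. exp (- (c * t))) t" for t by (intro continuous_intros)
  note * = FTC_nonneg_Ioi[OF d ct _ 0 1]
  show 2: "set_integrable lborel {0<..} (\<lambda>t. exp (- (c * t)))" by (rule *(1)) auto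
  show 3: "(LBINT t:{0<..}. exp (- (c * t))) = 1 / c" by (subst *(2)) auto
  have "(\<integral>\<^sup>+ t. ennreal (exp (- (c * t))) * indicator {0<..} t \<partial>lborel)
      = (\<integral>\<^sup>+ t. ennreal (indicator {0<..} t *\<^sub>R exp (- (c * t))) \<partial>lborel)"
    by (rule nn_integral_cong) (auto simp: indicator_def)
  also have "\<dots> = ennreal (1 / c)"
    using 2 3 unfolding set_integrable_def set_lebesgue_integral_def
    by (subst nn_integral_eq_integral) auto
  finally show "(\<integral>\<^sup>+ t. ennreal (exp (- (c * t))) * indicator {0<..} t \<partial>lborel) = ennreal (1 / c)" .
qed

section \<open>Transforms in time of the arcsine and passage parts\<close>

interpretation arcsine: prob_space arcsine_distribution
  by (rule prob_space_arcsine_distribution)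

text \<open>One minus the Laplace transform at \<open>\<mu>\<close> of \<open>r\<close> times an
  arcsine variable. For \<open>r\<close> at most 0 it vanishes, which encodes that no time above 0
  has been collected before the passage; the convolution below can then run over all passage
  times.\<close>

definition arcsine_gap :: "real \<Rightarrow> real \<Rightarrow> real" where
  "arcsine_gap \<mu> r = (\<integral>y. 1 - exp (- (\<mu> * max 0 r * y)) \<partial>arcsine_distribution)"

lemma integrable_arcsine_gap:
  assumes "0 \<le> \<mu>"
  shows "integrable arcsine_distribution (\<lambda>y. 1 - exp (- (\<mu> * max 0 r * y)))"
proof (rule arcsine.integrable_const_bound[where B = 1])
  show "AE y in arcsine_distribution. norm (1 - exp (- (\<mu> * max 0 r * y))) \<le> 1"
    using AE_arcsine_distribution by eventually_elim (use assms in auto)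
qed simp

lemma arcsine_gap_bounds:
  assumes "0 \<le> \<mu>"
  shows "0 \<le> arcsine_gap \<mu> r" "arcsine_gap \<mu> r \<le> 1" "r \<le> 0 \<Longrightarrow> arcsine_gap \<mu> r = 0"
proof -
  show "0 \<le> arcsine_gap \<mu> r"
    unfolding arcsine_gap_def
    by (rule integral_nonneg_AE) (use AE_arcsine_distribution in eventually_elim, use assms in auto)
  have "arcsine_gap \<mu> r \<le> (\<integral>y. 1 \<partial>arcsine_distribution)"
    unfolding arcsine_gap_def
    by (rule integral_mono_AE[OF integrable_arcsine_gap[OF assms]]) auto
  then show "arcsine_gap \<mu> r \<le> 1" by (simp add: arcsine.prob_space[simplified])
  show "arcsine_gap \<mu> r = 0" if "r \<le> 0"
    using that by (simp add: arcsine_gap_def max_def)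
qed

lemma arcsine_gap_lipschitz:
  assumes "0 \<le> \<mu>"
  shows "\<bar>arcsine_gap \<mu> r - arcsine_gap \<mu> r'\<bar> \<le> \<mu> * \<bar>r - r'\<bar>"
proof -
  note i = integrable_arcsine_gap[OF assms]
  have "arcsine_gap \<mu> r - arcsine_gap \<mu> r' =
      (\<integral>y. (1 - exp (- (\<mu> * max 0 r * y))) - (1 - exp (- (\<mu> * max 0 r' * y))) \<partial>arcsine_distribution)"
    unfolding arcsine_gap_def by (rule Bochner_Integration.integral_diff[symmetric]) (rule i)+
  also have "\<bar>\<dots>\<bar> \<le> (\<integral>y. \<mu> * \<bar>r - r'\<bar> \<partial>arcsine_distribution)"
  proof (rule order_trans[OF integral_abs_bound integral_mono_AE])
    show "AE y in arcsine_distribution. \<bar>(1 - exp (- (\<mu> * max 0 r * y))) - (1 - exp (- (\<mu> * max 0 r' * y)))\<bar> \<le> \<mu> * \<bar>r - r'\<bar>"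
      using AE_arcsine_distribution
    proof eventually_elim
      case (elim y)
      have "\<bar>(1 - exp (- (\<mu> * max 0 r * y))) - (1 - exp (- (\<mu> * max 0 r' * y)))\<bar>
          = \<bar>exp (- (\<mu> * max 0 r * y)) - exp (- (\<mu> * max 0 r' * y))\<bar>" by simp
      also have "\<dots> \<le> \<bar>\<mu> * max 0 r * y - \<mu> * max 0 r' * y\<bar>"
        by (rule exp_minus_lipschitz) (use assms elim in auto)
      also have "\<dots> = (\<mu> * \<bar>max 0 r - max 0 r'\<bar>) * y"
      proof -
        have "\<mu> * max 0 r * y - \<mu> * max 0 r' * y = \<mu> * (max 0 r - max 0 r') * y"
          by (simp only: right_diff_distrib left_diff_distrib)
        then show ?thesis using assms elim by (simp add: abs_mult)
      qed
      also have "\<dots> \<le> (\<mu> * \<bar>r - r'\<bar>) * 1"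
        using assms elim by (intro mult_mono mult_left_mono) (auto simp: max_def)
      finally show ?case by simp
    qed
  qed (intro integrable_abs Bochner_Integration.integrable_diff i, simp)
  finally show ?thesis by (simp add: arcsine.prob_space[simplified])
qed

lemma arcsine_gap_measurable [measurable]:
  assumes "0 \<le> \<mu>"
  shows "arcsine_gap \<mu> \<in> borel_measurable borel"
proof (rule borel_measurable_continuous_onI, rule lipschitz_on_continuous_on)
  show "\<mu>-lipschitz_on UNIV (arcsine_gap \<mu>)"
    using arcsine_gap_lipschitz[OF assms] assms by (auto simp: lipschitz_on_def dist_real_def)
qed

lemma nn_arcsine_gap:
  assumes "0 \<le> \<mu>"
  shows "ennreal (arcsine_gap \<mu> r) = (\<integral>\<^sup>+ y. ennreal (1 - exp (- (\<mu> * max 0 r * y))) \<partial>arcsine_distribution)"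
  unfolding arcsine_gap_def
  by (rule nn_integral_eq_integral[symmetric, OF integrable_arcsine_gap[OF assms]])
     (use AE_arcsine_distribution in eventually_elim, use assms in auto)

lemma nn_integral_arcsine_rational:
  assumes s: "0 < s" and mu: "0 < \<mu>"
  shows "(\<integral>\<^sup>+ y. ennreal (1 / s - 1 / (s + \<mu> * y)) \<partial>arcsine_distribution) = ennreal (1 / s - 1 / sqrt (s * (s + \<mu>)))"
proof -
  let ?f = "\<lambda>y. arcsine_density y / s - arcsine_density y / (s + \<mu> * y)"
  have 1: "set_integrable lborel {0<..<1} (\<lambda>y. arcsine_density y / s)"
    "(LBINT y:{0<..<1}. arcsine_density y / s) = 1 / s"
    using arcsine_density_rational_integral[OF s s] s by simp_all
  have 2: "set_integrable lborel {0<..<1} (\<lambda>y. arcsine_density y / (s + \<mu> * y))"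
    "(LBINT y:{0<..<1}. arcsine_density y / (s + \<mu> * y)) = 1 / sqrt (s * (s + \<mu>))"
    using arcsine_density_rational_integral[OF s, of "s + \<mu>"] s mu by simp_all
  have i: "set_integrable lborel {0<..<1} ?f"
    by (rule set_integral_diff(1)[OF 1(1) 2(1)])
  have nonneg: "0 \<le> 1 / s - 1 / (s + \<mu> * y)" if "0 < y" for y
    using frac_le[of 1 1 s "s + \<mu> * y"] s mu that by simp
  have "(\<integral>\<^sup>+ y. ennreal (1 / s - 1 / (s + \<mu> * y)) \<partial>arcsine_distribution)
      = (\<integral>\<^sup>+ y. ennreal (indicator {0<..<1} y *\<^sub>R ?f y) \<partial>lborel)"
  proof (subst nn_integral_arcsine_distribution, simp, rule nn_integral_cong)
    fix y :: real
    show "ennreal (indicator {0<..<1} y * arcsine_density y) * ennreal (1 / s - 1 / (s + \<mu> * y)) =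
         ennreal (indicator {0<..<1} y *\<^sub>R ?f y)"
    proof (cases "0 < y \<and> y < 1")
      case True
      then have "ennreal (arcsine_density y) * ennreal (1 / s - 1 / (s + \<mu> * y)) = ennreal (arcsine_density y * (1 / s - 1 / (s + \<mu> * y)))"
        by (intro ennreal_mult[symmetric] arcsine_density_nonneg nonneg) auto
      then show ?thesis using True by (simp add: right_diff_distrib)
    qed (auto simp: indicator_def)
  qed
  also have "\<dots> = ennreal (LBINT y:{0<..<1}. ?f y)"
    unfolding set_lebesgue_integral_def
  proof (rule nn_integral_eq_integral)
    have "?f y = arcsine_density y * (1 / s - 1 / (s + \<mu> * y))" for y
      by (simp add: right_diff_distrib)
    then show "AE y in lborel. 0 \<le> indicator {0<..<1} y *\<^sub>R ?f y"
      using nonneg by (auto intro!: AE_I2 mult_nonneg_nonneg arcsine_density_nonneg simp: indicator_def)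
  qed (use i in \<open>simp add: set_integrable_def\<close>)
  also have "(LBINT y:{0<..<1}. ?f y) = 1 / s - 1 / sqrt (s * (s + \<mu>))"
    by (subst set_integral_diff(2)[OF 1(1) 2(1)]) (simp only: 1(2) 2(2))
  finally show ?thesis .
qed

text \<open>By Tonelli the integral over \<open>t\<close> can be done first; for fixed
  \<open>y\<close> it equals \<open>1 / s - 1 / (s + \<mu> * y)\<close>, which the arcsine density
  integrates explicitly.\<close>

lemma laplace_arcsine_gap:
  assumes s: "0 < s" and mu: "0 < \<mu>"
  shows "(\<integral>\<^sup>+ t. ennreal (exp (- (s * t)) * arcsine_gap \<mu> t) * indicator {0<..} t \<partial>lborel)
    = ennreal (1 / s - 1 / sqrt (s * (s + \<mu>)))"
proof -
  interpret P: pair_sigma_finite lborel arcsine_distribution ..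
  have "(\<integral>\<^sup>+ t. ennreal (exp (- (s * t)) * arcsine_gap \<mu> t) * indicator {0<..} t \<partial>lborel)
      = (\<integral>\<^sup>+ t. \<integral>\<^sup>+ y. ennreal (exp (- (s * t))) * ennreal (1 - exp (- (\<mu> * max 0 t * y))) * indicator {0<..} t \<partial>arcsine_distribution \<partial>lborel)"
    using arcsine_gap_bounds[of \<mu>] mu
    by (intro nn_integral_cong)
       (simp add: ennreal_mult nn_arcsine_gap nn_integral_cmult nn_integral_multc)
  also have "\<dots> = (\<integral>\<^sup>+ y. \<integral>\<^sup>+ t. ennreal (exp (- (s * t))) * ennreal (1 - exp (- (\<mu> * max 0 t * y))) * indicator {0<..} t \<partial>lborel \<partial>arcsine_distribution)"
    by (rule P.Fubini'[symmetric]) measurable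
  also have "\<dots> = (\<integral>\<^sup>+ y. ennreal (1 / s - 1 / (s + \<mu> * y)) \<partial>arcsine_distribution)"
  proof (rule nn_integral_cong_AE)
    show "AE y in arcsine_distribution. (\<integral>\<^sup>+ t. ennreal (exp (- (s * t))) * ennreal (1 - exp (- (\<mu> * max 0 t * y))) * indicator {0<..} t \<partial>lborel)
        = ennreal (1 / s - 1 / (s + \<mu> * y))"
      using AE_arcsine_distribution
    proof eventually_elim
      case (elim y)
      have c: "0 < s + \<mu> * y" using s mu elim by (simp add: add_pos_pos)
      note e1 = nn_integral_exp_Ioi[OF s] and e2 = nn_integral_exp_Ioi[OF c]
      have "(\<integral>\<^sup>+ t. ennreal (exp (- (s * t))) * ennreal (1 - exp (- (\<mu> * max 0 t * y))) * indicator {0<..} t \<partial>lborel)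
          = (\<integral>\<^sup>+ t. ennreal (indicator {0<..} t *\<^sub>R (exp (- (s * t)) - exp (- ((s + \<mu> * y) * t)))) \<partial>lborel)"
      proof (rule nn_integral_cong)
        fix t :: real
        show "ennreal (exp (- (s * t))) * ennreal (1 - exp (- (\<mu> * max 0 t * y))) * indicator {0<..} t
            = ennreal (indicator {0<..} t *\<^sub>R (exp (- (s * t)) - exp (- ((s + \<mu> * y) * t))))"
        proof (cases "0 < t")
          case True
          have "exp (- (s * t)) * (1 - exp (- (\<mu> * t * y))) = exp (- (s * t)) - exp (- ((s + \<mu> * y) * t))"
            by (simp add: right_diff_distrib mult_exp_exp algebra_simps)
          moreover have "0 \<le> 1 - exp (- (\<mu> * t * y))" using True mu elim by simp
          ultimately show ?thesis using True by (simp add: max_def flip: ennreal_mult)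
        qed simp
      qed
      also have "\<dots> = ennreal (LBINT t:{0<..}. exp (- (s * t)) - exp (- ((s + \<mu> * y) * t)))"
        unfolding set_lebesgue_integral_def
      proof (rule nn_integral_eq_integral)
        show "integrable lborel (\<lambda>t. indicator {0<..} t *\<^sub>R (exp (- (s * t)) - exp (- ((s + \<mu> * y) * t))))"
          using set_integral_diff(1)[OF e1(2) e2(2)] by (simp add: set_integrable_def)
        show "AE t in lborel. 0 \<le> indicator {0<..} t *\<^sub>R (exp (- (s * t)) - exp (- ((s + \<mu> * y) * t)))"
          using mu elim by (auto intro!: AE_I2 mult_right_mono simp: indicator_def)
      qed
      also have "(LBINT t:{0<..}. exp (- (s * t)) - exp (- ((s + \<mu> * y) * t))) = 1 / s - 1 / (s + \<mu> * y)"
        using set_integral_diff(2)[OF e1(2) e2(2)] e1(3) e2(3) by simp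
      finally show ?case .
    qed
  qed
  also have "\<dots> = ennreal (1 / s - 1 / sqrt (s * (s + \<mu>)))"
    by (rule nn_integral_arcsine_rational[OF s mu])
  finally show ?thesis .
qed

text \<open>The law of the first passage of Brownian motion at distance \<open>a\<close>. Since
  \<open>hitting_density 0\<close> is identically zero, immediate passage at \<open>a = 0\<close>
  has to be entered as a point mass.\<close>

definition passage_measure :: "real \<Rightarrow> real measure" where
  "passage_measure a = (if a = 0 then return borel 0
    else density lborel (\<lambda>t. ennreal (indicator {0<..} t * hitting_density a t)))"

lemma sets_passage_measure [simp, measurable_cong]: "sets (passage_measure a) = sets borel"
  by (simp add: passage_measure_def)

lemma space_passage_measure [simp]: "space (passage_measure a) = UNIV"
  by (simp add: passage_measure_def)

text \<open>A density with finite values gives sigma-finiteness, and hence Tonelli, before anything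
  is known about the total mass.\<close>

lemma sigma_finite_passage_measure: "sigma_finite_measure (passage_measure a)"
proof (cases "a = 0")
  case True
  interpret prob_space "return borel (0::real)" by (rule prob_space_return) simp
  show ?thesis using True by (simp add: passage_measure_def sigma_finite_measure_axioms)
next
  case False
  then show ?thesis
    by (simp add: passage_measure_def)
       (subst sigma_finite_measure.sigma_finite_iff_density_finite[OF lborel.sigma_finite_measure_axioms]; simp)
qed

lemma AE_passage_measure:
  "AE u in passage_measure a. 0 \<le> u"
proof (cases "a = 0")
  case True
  have "AE u in return borel (0::real). 0 \<le> u" by (subst AE_return) auto
  moreover have "passage_measure a = return borel 0" using True by (simp add: passage_measure_def)
  ultimately show ?thesis by metis
next
  case False
  have "AE u in density lborel (\<lambda>t. ennreal (indicator {0<..} t * hitting_density a t)). 0 \<le> u"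
    by (subst AE_density) (auto simp: indicator_def)
  moreover have "passage_measure a = density lborel (\<lambda>t. ennreal (indicator {0<..} t * hitting_density a t))"
    using False by (simp add: passage_measure_def)
  ultimately show ?thesis by metis
qed

lemma laplace_passage_measure:
  assumes "0 \<le> a" "0 < s"
  shows "(\<integral>\<^sup>+ u. ennreal (exp (- (s * u))) \<partial>passage_measure a) = ennreal (exp (- (a * sqrt (2 * s))))"
proof (cases "a = 0")
  case True
  then show ?thesis by (simp add: passage_measure_def nn_integral_return)
next
  case False
  then have a: "0 < a" using assms by simp
  have "(\<integral>\<^sup>+ u. ennreal (exp (- (s * u))) \<partial>passage_measure a)
      = (\<integral>\<^sup>+ u. ennreal (indicator {0<..} u * hitting_density a u) * ennreal (exp (- (s * u))) \<partial>lborel)"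
    using False by (simp add: passage_measure_def nn_integral_density)
  also have "\<dots> = (\<integral>\<^sup>+ u. ennreal (indicator {0<..} u *\<^sub>R (hitting_density a u * exp (- (s * u)))) \<partial>lborel)"
    using a by (intro nn_integral_cong) (auto simp: indicator_def ennreal_mult hitting_density_nonneg)
  also have "\<dots> = ennreal (exp (- (a * sqrt (2 * s))))"
    using laplace_hitting_density[OF a assms(2)] a unfolding set_integrable_def set_lebesgue_integral_def
    by (subst nn_integral_eq_integral) (auto simp: hitting_density_nonneg indicator_def)
  finally show ?thesis .
qed

lemma integrable_exp_passage_measure:
  assumes "0 \<le> a" "0 < s"
  shows "integrable (passage_measure a) (\<lambda>u. exp (- (s * u)))"
    "(\<integral>u. exp (- (s * u)) \<partial>passage_measure a) = exp (- (a * sqrt (2 * s)))"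
proof -
  show "integrable (passage_measure a) (\<lambda>u. exp (- (s * u)))"
    by (rule integrableI_nonneg) (auto simp: laplace_passage_measure[OF assms])
  show "(\<integral>u. exp (- (s * u)) \<partial>passage_measure a) = exp (- (a * sqrt (2 * s)))"
    by (subst integral_eq_nn_integral) (auto simp: laplace_passage_measure[OF assms])
qed

text \<open>An arcsine time run during the time \<open>t - u\<close> that remains after a passage at
  \<open>u\<close>. At \<open>t = 1\<close> this is one minus the Laplace transform of
  \<open>Y_a\<close>; general \<open>t\<close> enters because the explicit formula is a Laplace
  transform in \<open>t\<close>.\<close>

definition passage_gap :: "real \<Rightarrow> real \<Rightarrow> real \<Rightarrow> real" where
  "passage_gap a \<mu> t = (\<integral>u. arcsine_gap \<mu> (t - u) \<partial>passage_measure a)"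

text \<open>The gap is at most 1 and vanishes for \<open>u\<close> beyond \<open>t\<close>, so it
  lies below exp(s (t - u)), whose integral against the passage measure is known.\<close>

lemma arcsine_gap_exp_bound:
  assumes "0 \<le> \<mu>" "0 < s"
  shows "arcsine_gap \<mu> (t - u) \<le> exp (s * t) * exp (- (s * u))"
proof (cases "t - u \<le> 0")
  case False
  then have "s * u \<le> s * t" using assms by simp
  then have "1 \<le> exp (s * t) * exp (- (s * u))" by (simp add: mult_exp_exp)
  then show ?thesis using arcsine_gap_bounds(2)[OF assms(1), of "t - u"] by linarith
qed (use arcsine_gap_bounds(3)[OF assms(1), of "t - u"] in simp)

lemma integrable_passage_gap:
  assumes "0 \<le> a" "0 \<le> \<mu>"
  shows "integrable (passage_measure a) (\<lambda>u. arcsine_gap \<mu> (t - u))"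
proof (rule Bochner_Integration.integrable_bound)
  show "integrable (passage_measure a) (\<lambda>u. exp (1 * t) * exp (- (1 * u)))"
    by (intro integrable_mult_right integrable_exp_passage_measure assms) simp
  show "AE u in passage_measure a. norm (arcsine_gap \<mu> (t - u)) \<le> norm (exp (1 * t) * exp (- (1 * u)))"
    using arcsine_gap_exp_bound[OF assms(2), of 1 t] arcsine_gap_bounds(1)[OF assms(2)] by (auto intro!: AE_I2)
qed (use assms in measurable)

text \<open>The passage measure has mass at most one, which is read off its Laplace transform as \<open>s \<rightarrow> 0\<close>.\<close>

lemma le_of_exp_bound:
  fixes A B t :: real
  assumes "0 \<le> B" "\<And>s. 0 < s \<Longrightarrow> A \<le> B * exp (s * t)"
  shows "A \<le> B"
proof (rule tendsto_lowerbound)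
  have "((\<lambda>s. B * exp (s * t)) \<longlongrightarrow> B * exp (0 * t)) (at_right 0)" by (intro tendsto_intros)
  then show "((\<lambda>s. B * exp (s * t)) \<longlongrightarrow> B) (at_right 0)" by simp
  show "eventually (\<lambda>s. A \<le> B * exp (s * t)) (at_right 0)"
    using eventually_at_right_less[of 0] by eventually_elim (rule assms(2))
qed simp

lemma integral_exp_passage_le:
  assumes "0 \<le> a" "0 < s"
  shows "(\<integral>u. exp (s * t) * exp (- (s * u)) \<partial>passage_measure a) \<le> exp (s * t)"
  using assms by (simp add: integrable_exp_passage_measure)

lemma passage_gap_bounds:
  assumes "0 \<le> a" "0 \<le> \<mu>"
  shows "0 \<le> passage_gap a \<mu> t" "passage_gap a \<mu> t \<le> 1"
proof -
  show "0 \<le> passage_gap a \<mu> t"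
    unfolding passage_gap_def by (intro integral_nonneg_AE AE_I2 arcsine_gap_bounds assms)
  show "passage_gap a \<mu> t \<le> 1"
  proof (rule le_of_exp_bound)
    fix s :: real assume s: "0 < s"
    have "passage_gap a \<mu> t \<le> (\<integral>u. exp (s * t) * exp (- (s * u)) \<partial>passage_measure a)"
      unfolding passage_gap_def
      by (intro integral_mono integrable_passage_gap integrable_mult_right integrable_exp_passage_measure
          arcsine_gap_exp_bound assms s)
    then show "passage_gap a \<mu> t \<le> 1 * exp (s * t)"
      using order_trans[OF _ integral_exp_passage_le[OF assms(1) s, of t]] by simp
  qed simp
qed

lemma passage_gap_lipschitz:
  assumes "0 \<le> a" "0 \<le> \<mu>"
  shows "\<bar>passage_gap a \<mu> t - passage_gap a \<mu> t'\<bar> \<le> \<mu> * \<bar>t - t'\<bar>"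
proof (rule le_of_exp_bound)
  show "0 \<le> \<mu> * \<bar>t - t'\<bar>" using assms by simp
  fix s :: real assume s: "0 < s"
  \<comment> \<open>Beyond \<open>?B\<close> both gaps vanish, and before it the weight exp(s (?B -
    u)) is at least 1. The weight makes the constant bound integrable and tends to 1 as
    \<open>s\<close> tends to 0.\<close>
  let ?B = "max t t'"
  note i = integrable_passage_gap[OF assms]
  have "passage_gap a \<mu> t - passage_gap a \<mu> t' = (\<integral>u. arcsine_gap \<mu> (t - u) - arcsine_gap \<mu> (t' - u) \<partial>passage_measure a)"
    unfolding passage_gap_def by (rule Bochner_Integration.integral_diff[symmetric]) (rule i)+
  also have "\<bar>\<dots>\<bar> \<le> (\<integral>u. (\<mu> * \<bar>t - t'\<bar>) * (exp (s * ?B) * exp (- (s * u))) \<partial>passage_measure a)"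
  proof (rule abs_integral_le)
    show "integrable (passage_measure a) (\<lambda>u. arcsine_gap \<mu> (t - u) - arcsine_gap \<mu> (t' - u))"
      by (intro Bochner_Integration.integrable_diff i)
    show "integrable (passage_measure a) (\<lambda>u. (\<mu> * \<bar>t - t'\<bar>) * (exp (s * ?B) * exp (- (s * u))))"
      by (intro integrable_mult_right integrable_exp_passage_measure assms s)
    fix u :: real
    show "\<bar>arcsine_gap \<mu> (t - u) - arcsine_gap \<mu> (t' - u)\<bar> \<le> (\<mu> * \<bar>t - t'\<bar>) * (exp (s * ?B) * exp (- (s * u)))"
    proof (cases "?B \<le> u")
      case True
      then show ?thesis using arcsine_gap_bounds(3)[OF assms(2)] assms by simp
    next
      case False
      then have "s * u \<le> s * ?B" using s by (intro mult_left_mono) auto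
      then have "1 \<le> exp (s * ?B) * exp (- (s * u))" by (simp add: mult_exp_exp)
      then have "(\<mu> * \<bar>t - t'\<bar>) * 1 \<le> (\<mu> * \<bar>t - t'\<bar>) * (exp (s * ?B) * exp (- (s * u)))"
        using assms by (intro mult_left_mono) auto
      then show ?thesis using arcsine_gap_lipschitz[OF assms(2), of "t - u" "t' - u"] by simp
    qed
  qed
  also have "\<dots> = (\<mu> * \<bar>t - t'\<bar>) * (\<integral>u. exp (s * ?B) * exp (- (s * u)) \<partial>passage_measure a)"
    by (rule integral_mult_right_zero)
  also have "\<dots> \<le> (\<mu> * \<bar>t - t'\<bar>) * exp (s * ?B)"
    using assms integral_exp_passage_le[OF assms(1) s] by (intro mult_left_mono) auto
  finally show "\<bar>passage_gap a \<mu> t - passage_gap a \<mu> t'\<bar> \<le> \<mu> * \<bar>t - t'\<bar> * exp (s * ?B)" .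
qed

lemma passage_gap_measurable:
  assumes "0 \<le> a" "0 \<le> \<mu>"
  shows "passage_gap a \<mu> \<in> borel_measurable borel"
proof (rule borel_measurable_continuous_onI, rule lipschitz_on_continuous_on)
  show "\<mu>-lipschitz_on UNIV (passage_gap a \<mu>)"
    using passage_gap_lipschitz[OF assms] assms by (auto simp: lipschitz_on_def dist_real_def)
qed

lemma nn_passage_gap:
  assumes "0 \<le> a" "0 \<le> \<mu>"
  shows "ennreal (passage_gap a \<mu> t) = (\<integral>\<^sup>+ u. ennreal (arcsine_gap \<mu> (t - u)) \<partial>passage_measure a)"
  unfolding passage_gap_def
  by (rule nn_integral_eq_integral[symmetric, OF integrable_passage_gap[OF assms]])
     (use arcsine_gap_bounds[OF assms(2)] in auto)

lemma inverse_sqrt_gap_nonneg: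
  fixes s \<mu> :: real
  assumes s: "0 < s" and mu: "0 < \<mu>"
  shows "0 \<le> 1 / s - 1 / sqrt (s * (s + \<mu>))"
proof -
  have "s = sqrt (s * s)" using s by simp
  also have "\<dots> \<le> sqrt (s * (s + \<mu>))" using s mu by (intro real_sqrt_le_mono mult_left_mono) auto
  finally show ?thesis using s mu by (simp add: frac_le)
qed

text \<open>\<open>passage_gap\<close> is a convolution, so its transform is the product of the
  transforms of the passage measure and of \<open>arcsine_gap\<close>.\<close>

lemma nn_laplace_passage_gap:
  assumes a: "0 \<le> a" and mu: "0 < \<mu>" and s: "0 < s"
  shows "(\<integral>\<^sup>+ t. ennreal (exp (- (s * t)) * passage_gap a \<mu> t) * indicator {0<..} t \<partial>lborel)
    = ennreal (exp (- (a * sqrt (2 * s))) * (1 / s - 1 / sqrt (s * (s + \<mu>))))"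
proof -
  interpret S: sigma_finite_measure "passage_measure a" by (rule sigma_finite_passage_measure)
  interpret P: pair_sigma_finite lborel "passage_measure a" ..
  have mu0: "0 \<le> \<mu>" using mu by simp
  note [measurable] = arcsine_gap_measurable[OF mu0]
  let ?c = "1 / s - 1 / sqrt (s * (s + \<mu>))"
  have c: "0 \<le> ?c" by (rule inverse_sqrt_gap_nonneg[OF s mu])
  have "(\<integral>\<^sup>+ t. ennreal (exp (- (s * t)) * passage_gap a \<mu> t) * indicator {0<..} t \<partial>lborel)
      = (\<integral>\<^sup>+ t. \<integral>\<^sup>+ u. ennreal (exp (- (s * t))) * ennreal (arcsine_gap \<mu> (t - u)) * indicator {0<..} t \<partial>passage_measure a \<partial>lborel)"
    using passage_gap_bounds[OF a mu0]
    by (intro nn_integral_cong)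
       (simp add: ennreal_mult nn_passage_gap[OF a mu0] nn_integral_cmult nn_integral_multc)
  also have "\<dots> = (\<integral>\<^sup>+ u. \<integral>\<^sup>+ t. ennreal (exp (- (s * t))) * ennreal (arcsine_gap \<mu> (t - u)) * indicator {0<..} t \<partial>lborel \<partial>passage_measure a)"
    by (rule P.Fubini'[symmetric]) measurable
  also have "\<dots> = (\<integral>\<^sup>+ u. ennreal (exp (- (s * u))) * ennreal ?c \<partial>passage_measure a)"
  proof (rule nn_integral_cong_AE)
    show "AE u in passage_measure a. (\<integral>\<^sup>+ t. ennreal (exp (- (s * t))) * ennreal (arcsine_gap \<mu> (t - u)) * indicator {0<..} t \<partial>lborel)
        = ennreal (exp (- (s * u))) * ennreal ?c"
      using AE_passage_measure
    proof eventually_elim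
      case (elim u)
      \<comment> \<open>Shift by the passage time, t = u + r. Negative \<open>r\<close> contribute
        nothing because the gap vanishes there, so the integral over positive \<open>r\<close>
        reappears for every \<open>u\<close> at least 0.\<close>
      have "(\<integral>\<^sup>+ t. ennreal (exp (- (s * t))) * ennreal (arcsine_gap \<mu> (t - u)) * indicator {0<..} t \<partial>lborel)
          = (\<integral>\<^sup>+ r. ennreal (exp (- (s * (u + 1 * r)))) * ennreal (arcsine_gap \<mu> ((u + 1 * r) - u)) * indicator {0<..} (u + 1 * r) \<partial>lborel)"
        by (subst nn_integral_real_affine[where c = 1 and t = u]) auto
      also have "\<dots> = (\<integral>\<^sup>+ r. ennreal (exp (- (s * u))) * (ennreal (exp (- (s * r)) * arcsine_gap \<mu> r) * indicator {0<..} r) \<partial>lborel)"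
      proof (rule nn_integral_cong)
        fix r :: real
        have e: "exp (- (s * (u + r))) = exp (- (s * u)) * exp (- (s * r))"
          by (simp add: mult_exp_exp algebra_simps)
        show "ennreal (exp (- (s * (u + 1 * r)))) * ennreal (arcsine_gap \<mu> ((u + 1 * r) - u)) * indicator {0<..} (u + 1 * r)
            = ennreal (exp (- (s * u))) * (ennreal (exp (- (s * r)) * arcsine_gap \<mu> r) * indicator {0<..} r)"
        proof (cases "0 < r")
          case True
          then show ?thesis using elim arcsine_gap_bounds(1)[OF mu0, of r] by (simp add: e ennreal_mult mult.assoc)
        next
          case False
          then show ?thesis using arcsine_gap_bounds(3)[OF mu0, of r] by simp
        qed
      qed
      also have "\<dots> = ennreal (exp (- (s * u))) * ennreal ?c"
        by (subst nn_integral_cmult) (auto simp: laplace_arcsine_gap[OF s mu])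
      finally show ?case .
    qed
  qed
  also have "\<dots> = ennreal (exp (- (a * sqrt (2 * s)))) * ennreal ?c"
    by (subst nn_integral_multc) (auto simp: laplace_passage_measure[OF a s])
  also have "\<dots> = ennreal (exp (- (a * sqrt (2 * s))) * ?c)"
    using c by (intro ennreal_mult[symmetric]) auto
  finally show ?thesis .
qed

lemma laplace_passage_gap:
  assumes a: "0 \<le> a" and mu: "0 < \<mu>" and s: "0 < s"
  shows "set_integrable lborel {0<..} (\<lambda>t. exp (- (s * t)) * passage_gap a \<mu> t)"
    "(LBINT t:{0<..}. exp (- (s * t)) * passage_gap a \<mu> t) = exp (- (a * sqrt (2 * s))) * (1 / s - 1 / sqrt (s * (s + \<mu>)))"
proof -
  have mu0: "0 \<le> \<mu>" using mu by simp
  note [measurable] = passage_gap_measurable[OF a mu0]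
  have c: "0 \<le> 1 / s - 1 / sqrt (s * (s + \<mu>))" by (rule inverse_sqrt_gap_nonneg[OF s mu])
  have nn: "(\<integral>\<^sup>+ t. ennreal (indicator {0<..} t *\<^sub>R (exp (- (s * t)) * passage_gap a \<mu> t)) \<partial>lborel)
      = ennreal (exp (- (a * sqrt (2 * s))) * (1 / s - 1 / sqrt (s * (s + \<mu>))))"
    unfolding nn_laplace_passage_gap[OF assms, symmetric]
    by (rule nn_integral_cong) (auto simp: indicator_def)
  have nonneg: "AE t in lborel. 0 \<le> indicator {0<..} t *\<^sub>R (exp (- (s * t)) * passage_gap a \<mu> t)"
    using passage_gap_bounds[OF a mu0] by auto
  show "set_integrable lborel {0<..} (\<lambda>t. exp (- (s * t)) * passage_gap a \<mu> t)"
    unfolding set_integrable_def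
    by (rule integrableI_nonneg) (use nn nonneg in auto)
  show "(LBINT t:{0<..}. exp (- (s * t)) * passage_gap a \<mu> t) = exp (- (a * sqrt (2 * s))) * (1 / s - 1 / sqrt (s * (s + \<mu>)))"
    unfolding set_lebesgue_integral_def using c
    by (subst integral_eq_nn_integral) (use nn nonneg in auto)
qed

section \<open>Laplace transform of the limit variable\<close>

lemma limit_variable_AE_range:
  assumes "is_limit_variable Q a Y"
  shows "AE y in distr Q borel Y. 0 \<le> y \<and> y \<le> 1"
  using assms by (subst AE_distr_iff) (auto simp: is_limit_variable_def)

text \<open>The last two factors of \<open>limit_density\<close> form the density of
  \<open>d\<close> times an arcsine variable, where \<open>d = 1 - u\<close> is the time left after
  the passage.\<close>

lemma nn_integral_arcsine_rescaled:
  assumes "0 < d" and [measurable]: "f \<in> borel_measurable borel"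
  shows "(\<integral>\<^sup>+ y. ennreal (arcsine_density (y / d) / d) * indicator {0<..<d} y * f y \<partial>lborel)
    = (\<integral>\<^sup>+ z. f (d * z) \<partial>arcsine_distribution)"
proof -
  have "(\<integral>\<^sup>+ y. ennreal (arcsine_density (y / d) / d) * indicator {0<..<d} y * f y \<partial>lborel)
      = ennreal \<bar>d\<bar> * (\<integral>\<^sup>+ z. ennreal (arcsine_density ((0 + d * z) / d) / d) * indicator {0<..<d} (0 + d * z) * f (0 + d * z) \<partial>lborel)"
    by (rule nn_integral_real_affine) (use assms in auto)
  also have "\<dots> = (\<integral>\<^sup>+ z. ennreal \<bar>d\<bar> * (ennreal (arcsine_density ((0 + d * z) / d) / d) * indicator {0<..<d} (0 + d * z) * f (0 + d * z)) \<partial>lborel)"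
    by (rule nn_integral_cmult[symmetric]) measurable
  also have "\<dots> = (\<integral>\<^sup>+ z. ennreal (indicator {0<..<1} z * arcsine_density z) * f (d * z) \<partial>lborel)"
  proof (rule nn_integral_cong)
    fix z :: real
    show "ennreal \<bar>d\<bar> * (ennreal (arcsine_density ((0 + d * z) / d) / d) * indicator {0<..<d} (0 + d * z) * f (0 + d * z))
        = ennreal (indicator {0<..<1} z * arcsine_density z) * f (d * z)"
    proof (cases "0 < z \<and> z < 1")
      case True
      then have "ennreal \<bar>d\<bar> * ennreal (arcsine_density z / d) = ennreal (\<bar>d\<bar> * (arcsine_density z / d))"
        using assms(1) by (intro ennreal_mult[symmetric] divide_nonneg_pos arcsine_density_nonneg) auto
      then have "ennreal \<bar>d\<bar> * ennreal (arcsine_density z / d) = ennreal (arcsine_density z)"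
        using assms(1) by simp
      then show ?thesis using True assms(1) by (simp flip: mult.assoc)
    next
      case False
      then have "\<not> (0 < d * z \<and> d * z < d)" using assms(1) by (auto simp: zero_less_mult_iff)
      then show ?thesis using False by (auto simp: indicator_def)
    qed
  qed
  also have "\<dots> = (\<integral>\<^sup>+ z. f (d * z) \<partial>arcsine_distribution)"
    by (rule nn_integral_arcsine_distribution[symmetric]) measurable
  finally show ?thesis .
qed

text \<open>Since \<open>1 - e\<^bsup>-\<mu> y\<^esup>\<close> vanishes at \<open>0\<close>, the atom of the limit law plays no role here. The Bochner
  integral \<^const>\<open>limit_density\<close> agrees with the extended integral only where the latter is finite,
  which is almost everywhere because the total mass is finite.\<close>

lemma nn_limit_variable_gap_pos:
  assumes a: "0 < a" and mu: "0 < \<mu>" and Y: "is_limit_variable Q a Y" and Q: "prob_space Q"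
  shows "(\<integral>\<^sup>+ y. ennreal (1 - exp (- (\<mu> * y))) \<partial>distr Q borel Y) = ennreal (passage_gap a \<mu> 1)"
proof -
  have mu0: "0 \<le> \<mu>" and a0: "0 \<le> a" using mu a by auto
  note [measurable] = arcsine_gap_measurable[OF mu0]
  define w where "w y = ennreal (1 - exp (- (\<mu> * y)))" for y
  have [measurable]: "w \<in> borel_measurable borel" unfolding w_def by measurable
  define k where "k u y = hitting_density a u / (1 - u) * arcsine_density (y / (1 - u))" for u y
  have [measurable]: "(\<lambda>(u, y). k u y) \<in> borel_measurable (borel \<Otimes>\<^sub>M borel)" unfolding k_def by measurable
  \<comment> \<open>The range of integration is built into the kernel, which makes it jointly
    measurable for Tonelli. For fixed \<open>u\<close> the same condition reads
    \<open>y < 1 - u\<close>.\<close>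
  define KK where "KK u y = (if 0 < u \<and> u < 1 - y then ennreal (k u y) else 0)" for u y
  have [measurable]: "(\<lambda>(u, y). KK u y) \<in> borel_measurable (borel \<Otimes>\<^sub>M borel)" unfolding KK_def by measurable
  define I where "I y = (\<integral>\<^sup>+ u. KK u y \<partial>lborel)" for y
  have [measurable]: "I \<in> borel_measurable borel" unfolding I_def by measurable
  have k_nonneg: "0 \<le> k u y" if "0 < y" "0 < u" "u < 1 - y" for u y
    unfolding k_def using that a by (intro mult_nonneg_nonneg divide_nonneg_pos hitting_density_nonneg arcsine_density_nonneg) auto
  have total: "(\<integral>\<^sup>+ y. w y * I y * indicator {0<..<1} y \<partial>lborel) = ennreal (passage_gap a \<mu> 1)"
  proof -
    have "(\<integral>\<^sup>+ y. w y * I y * indicator {0<..<1} y \<partial>lborel)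
        = (\<integral>\<^sup>+ y. \<integral>\<^sup>+ u. w y * KK u y * indicator {0<..<1} y \<partial>lborel \<partial>lborel)"
      unfolding I_def by (simp add: nn_integral_cmult nn_integral_multc)
    also have "\<dots> = (\<integral>\<^sup>+ u. \<integral>\<^sup>+ y. w y * KK u y * indicator {0<..<1} y \<partial>lborel \<partial>lborel)"
      by (rule lborel_pair.Fubini') measurable
    also have "\<dots> = (\<integral>\<^sup>+ u. ennreal (indicator {0<..} u * hitting_density a u) * ennreal (arcsine_gap \<mu> (1 - u)) \<partial>lborel)"
    proof (rule nn_integral_cong)
      fix u :: real
      show "(\<integral>\<^sup>+ y. w y * KK u y * indicator {0<..<1} y \<partial>lborel)
          = ennreal (indicator {0<..} u * hitting_density a u) * ennreal (arcsine_gap \<mu> (1 - u))"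
      proof (cases "0 < u \<and> u < 1")
        case True
        then have d: "0 < 1 - u" by simp
        have "(\<integral>\<^sup>+ y. w y * KK u y * indicator {0<..<1} y \<partial>lborel)
            = (\<integral>\<^sup>+ y. ennreal (hitting_density a u) * (ennreal (arcsine_density (y / (1 - u)) / (1 - u)) * indicator {0<..<1 - u} y * w y) \<partial>lborel)"
        proof (rule nn_integral_cong)
          fix y :: real
          show "w y * KK u y * indicator {0<..<1} y
              = ennreal (hitting_density a u) * (ennreal (arcsine_density (y / (1 - u)) / (1 - u)) * indicator {0<..<1 - u} y * w y)"
          proof (cases "0 < y \<and> y < 1 - u")
            case y: True
            have "ennreal (k u y) = ennreal (hitting_density a u * (arcsine_density (y / (1 - u)) / (1 - u)))"
              by (simp add: k_def)
            also have "\<dots> = ennreal (hitting_density a u) * ennreal (arcsine_density (y / (1 - u)) / (1 - u))"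
              using y True a by (intro ennreal_mult divide_nonneg_pos hitting_density_nonneg arcsine_density_nonneg) auto
            finally show ?thesis using y True by (simp add: mult_ac KK_def)
          qed (use True in \<open>auto simp: indicator_def KK_def\<close>)
        qed
        also have "\<dots> = ennreal (hitting_density a u) * (\<integral>\<^sup>+ z. w ((1 - u) * z) \<partial>arcsine_distribution)"
          by (subst nn_integral_cmult) (auto simp: nn_integral_arcsine_rescaled[OF d])
        also have "(\<integral>\<^sup>+ z. w ((1 - u) * z) \<partial>arcsine_distribution) = ennreal (arcsine_gap \<mu> (1 - u))"
          unfolding nn_arcsine_gap[OF mu0] w_def using d by (simp add: max_def mult.assoc)
        finally show ?thesis using True by simp
      next
        case False
        have "(\<integral>\<^sup>+ y. w y * KK u y * indicator {0<..<1} y \<partial>lborel) = (\<integral>\<^sup>+ y. 0 \<partial>(lborel :: real measure))"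
          by (rule nn_integral_cong) (use False in \<open>auto simp: indicator_def KK_def\<close>)
        moreover have "indicator {0<..} u * hitting_density a u = 0 \<or> arcsine_gap \<mu> (1 - u) = 0"
          using False arcsine_gap_bounds(3)[OF mu0, of "1 - u"] by (auto simp: indicator_def)
        ultimately show ?thesis by auto
      qed
    qed
    also have "\<dots> = (\<integral>\<^sup>+ u. ennreal (arcsine_gap \<mu> (1 - u)) \<partial>passage_measure a)"
      using a by (simp add: passage_measure_def nn_integral_density)
    also have "\<dots> = ennreal (passage_gap a \<mu> 1)"
      by (rule nn_passage_gap[OF a0 mu0, symmetric])
    finally show ?thesis .
  qed
  have finite: "AE y in lborel. 0 < y \<longrightarrow> y < 1 \<longrightarrow> ennreal (limit_density a y) = I y"
  proof -
    have "AE y in lborel. w y * I y * indicator {0<..<1} y \<noteq> \<infinity>"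
      by (rule nn_integral_PInf_AE) (auto simp: total)
    then show ?thesis
    proof eventually_elim
      case (elim y)
      show ?case
      proof (intro impI)
        assume y: "0 < y" "y < 1"
        \<comment> \<open>Finiteness is known for the product \<open>w y * I y\<close>; strict
          positivity of \<open>w y\<close> passes it on to \<open>I y\<close>.\<close>
        then have "w y \<noteq> 0" using mult_pos_pos[OF mu y(1)] by (simp add: w_def ennreal_eq_0_iff)
        then have fin: "I y < \<infinity>" using elim y by (auto simp: ennreal_mult_eq_top_iff less_top)
        have I_eq: "I y = (\<integral>\<^sup>+ u. ennreal (indicator {0<..<1 - y} u *\<^sub>R k u y) \<partial>lborel)"
          unfolding I_def by (rule nn_integral_cong) (auto simp: indicator_def KK_def)
        have "limit_density a y = enn2real (I y)"
          unfolding limit_density_def set_lebesgue_integral_def I_eq k_def[symmetric]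
          by (rule integral_eq_nn_integral) (use k_nonneg y in \<open>auto simp: indicator_def\<close>)
        then show "ennreal (limit_density a y) = I y" using fin by (simp add: less_top)
      qed
    qed
  qed
  let ?D = "distr Q borel Y"
  have law: "emeasure ?D A = ennreal (limit_atom a) * indicator A 0 + (\<integral>\<^sup>+ y \<in> A \<inter> {0<..<1}. ennreal (limit_density a y) \<partial>lborel)"
    if "A \<in> sets borel" for A
    using Y a that by (simp add: is_limit_variable_def)
  \<comment> \<open>The law is given set by set. Away from 0 it has a density, and an equality of
    measures allows integrals to be rewritten.\<close>
  have eq: "density ?D (indicator {0<..}) = density lborel (\<lambda>y. I y * indicator {0<..<1} y)"
  proof (rule measure_eqI)
    fix A assume "A \<in> sets (density ?D (indicator {0<..}))"
    then have A[measurable]: "A \<in> sets borel" by simp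
    have "emeasure (density ?D (indicator {0<..})) A = (\<integral>\<^sup>+ y. indicator {0<..} y * indicator A y \<partial>?D)"
      by (rule emeasure_density) auto
    also have "\<dots> = (\<integral>\<^sup>+ y. indicator (A \<inter> {0<..}) y \<partial>?D)"
      by (rule nn_integral_cong) (auto simp: indicator_def)
    also have "\<dots> = emeasure ?D (A \<inter> {0<..})" by simp
    also have "\<dots> = (\<integral>\<^sup>+ y \<in> (A \<inter> {0<..}) \<inter> {0<..<1}. ennreal (limit_density a y) \<partial>lborel)"
      by (subst law) auto
    also have "\<dots> = (\<integral>\<^sup>+ y. I y * indicator {0<..<1} y * indicator A y \<partial>lborel)"
      by (rule nn_integral_cong_AE) (use finite in eventually_elim, auto simp: indicator_def)
    also have "\<dots> = emeasure (density lborel (\<lambda>y. I y * indicator {0<..<1} y)) A"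
      by (subst emeasure_density) auto
    finally show "emeasure (density ?D (indicator {0<..})) A = emeasure (density lborel (\<lambda>y. I y * indicator {0<..<1} y)) A" .
  qed simp
  have "(\<integral>\<^sup>+ y. w y \<partial>?D) = (\<integral>\<^sup>+ y. indicator {0<..} y * w y \<partial>?D)"
  proof (rule nn_integral_cong_AE)
    show "AE y in ?D. w y = indicator {0<..} y * w y"
      using limit_variable_AE_range[OF Y]
      by eventually_elim (auto simp: indicator_def w_def)
  qed
  also have "\<dots> = (\<integral>\<^sup>+ y. w y \<partial>density ?D (indicator {0<..}))"
    by (rule nn_integral_density[symmetric]) auto
  also have "\<dots> = (\<integral>\<^sup>+ y. I y * indicator {0<..<1} y * w y \<partial>lborel)"
    unfolding eq by (rule nn_integral_density) auto
  also have "\<dots> = ennreal (passage_gap a \<mu> 1)"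
    unfolding total[symmetric] by (rule nn_integral_cong) (simp add: mult_ac)
  finally show ?thesis by (simp add: w_def)
qed

theorem limit_variable_laplace:
  assumes a: "0 \<le> a" and mu: "0 < \<mu>" and Y: "is_limit_variable Q a Y" and Q: "prob_space Q"
  shows "(\<integral>\<omega>. exp (- (\<mu> * Y \<omega>)) \<partial>Q) = 1 - passage_gap a \<mu> 1"
proof -
  interpret Q: prob_space Q by (rule Q)
  have mu0: "0 \<le> \<mu>" using mu by simp
  have Ym[measurable]: "Y \<in> borel_measurable Q" and range: "\<And>\<omega>. \<omega> \<in> space Q \<Longrightarrow> 0 \<le> Y \<omega> \<and> Y \<omega> \<le> 1"
    using Y by (auto simp: is_limit_variable_def)
  have nn: "(\<integral>\<^sup>+ y. ennreal (1 - exp (- (\<mu> * y))) \<partial>distr Q borel Y) = ennreal (passage_gap a \<mu> 1)"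
  proof (cases "a = 0")
    case True
    have "distr Q borel Y = arcsine_distribution" using Y True by (simp add: is_limit_variable_def)
    moreover have "passage_gap 0 \<mu> 1 = arcsine_gap \<mu> 1"
      using arcsine_gap_measurable[OF mu0]
      by (simp add: passage_gap_def passage_measure_def integral_return)
    ultimately show ?thesis using True nn_arcsine_gap[OF mu0, of 1] by simp
  next
    case False
    then show ?thesis using nn_limit_variable_gap_pos[OF _ mu Y Q] a by simp
  qed
  have int: "integrable Q (\<lambda>\<omega>. exp (- (\<mu> * Y \<omega>)))"
    by (rule Q.integrable_const_bound[where B = 1]) (use range mu in auto)
  have "(\<integral>\<omega>. 1 - exp (- (\<mu> * Y \<omega>)) \<partial>Q) = enn2real (\<integral>\<^sup>+ \<omega>. ennreal (1 - exp (- (\<mu> * Y \<omega>))) \<partial>Q)"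
    by (rule integral_eq_nn_integral) (use range mu in auto)
  also have "(\<integral>\<^sup>+ \<omega>. ennreal (1 - exp (- (\<mu> * Y \<omega>))) \<partial>Q) = ennreal (passage_gap a \<mu> 1)"
    using nn by (simp add: nn_integral_distr)
  finally have "(\<integral>\<omega>. 1 - exp (- (\<mu> * Y \<omega>)) \<partial>Q) = passage_gap a \<mu> 1"
    using passage_gap_bounds(1)[OF a mu0] by simp
  moreover have "(\<integral>\<omega>. 1 - exp (- (\<mu> * Y \<omega>)) \<partial>Q) = 1 - (\<integral>\<omega>. exp (- (\<mu> * Y \<omega>)) \<partial>Q)"
    by (subst Bochner_Integration.integral_diff) (use int in \<open>auto simp: Q.prob_space\<close>)
  ultimately show ?thesis by simp
qed

section \<open>Explicit solution of the backward equation\<close>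

text \<open>For killing rate \<open>q\<close> the homogeneous backward equation is a linear 2 by 2
  system with eigenvalues plus and minus sqrt((n + q)^2 - n^2).\<close>

definition decay :: "real \<Rightarrow> real \<Rightarrow> real" where
  "decay n q = sqrt (q * (q + 2 * n))"

text \<open>The ratio of the two velocity components in the mode that decays away from 0: the
  component moving away from the origin over the one moving towards it.\<close>

definition velocity_ratio :: "real \<Rightarrow> real \<Rightarrow> real" where
  "velocity_ratio n q = (n + q - decay n q) / n"

lemma decay_bounds:
  assumes "0 < n" "0 < q"
  shows "(decay n q)\<^sup>2 = q * (q + 2 * n)" "q < decay n q" "decay n q < n + q"
proof -
  show sq: "(decay n q)\<^sup>2 = q * (q + 2 * n)" using assms by (simp add: decay_def)
  show "q < decay n q"
    unfolding decay_def using assms by (intro real_less_rsqrt) (simp add: power2_eq_square algebra_simps)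
  show "decay n q < n + q"
  proof (rule power2_less_imp_less)
    have "(n + q)\<^sup>2 = (decay n q)\<^sup>2 + n\<^sup>2" unfolding sq by (simp add: power2_eq_square algebra_simps)
    then show "(decay n q)\<^sup>2 < (n + q)\<^sup>2" using assms by simp
  qed (use assms in simp)
qed

lemma velocity_ratio_bounds:
  assumes "0 < n" "0 < q"
  shows "0 < velocity_ratio n q" "velocity_ratio n q < 1"
    "n * velocity_ratio n q = n + q - decay n q" "(n + q + decay n q) * velocity_ratio n q = n"
proof -
  show "0 < velocity_ratio n q" "velocity_ratio n q < 1" "n * velocity_ratio n q = n + q - decay n q"
    using decay_bounds[OF assms] assms by (auto simp: velocity_ratio_def)
  have "(n + q + decay n q) * (n + q - decay n q) = n * n"
    using decay_bounds(1)[OF assms] by (simp add: power2_eq_square algebra_simps)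
  then show "(n + q + decay n q) * velocity_ratio n q = n"
    using assms by (simp add: velocity_ratio_def)
qed

text \<open>Continuity at 0, once for each velocity, gives two linear equations for the amplitudes
  on the two half-lines. \<open>coeff_below\<close> and \<open>coeff_above\<close> solve them, with
  determinant \<open>1 - velocity_ratio n r * velocity_ratio n s\<close> up to sign.\<close>

definition coeff_below :: "real \<Rightarrow> real \<Rightarrow> real \<Rightarrow> real" where
  "coeff_below n s r = (1 / r - 1 / s) * ((1 - velocity_ratio n r) / (1 - velocity_ratio n r * velocity_ratio n s))"

definition coeff_above :: "real \<Rightarrow> real \<Rightarrow> real \<Rightarrow> real" where
  "coeff_above n s r = - ((1 / r - 1 / s) * ((1 - velocity_ratio n s) / (1 - velocity_ratio n r * velocity_ratio n s)))"

definition velocity_coeff_below :: "real \<Rightarrow> real \<Rightarrow> real \<Rightarrow> real \<Rightarrow> real" where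
  "velocity_coeff_below n s r V = coeff_below n s r * (if V = 1 then 1 else velocity_ratio n s)"

definition velocity_coeff_above :: "real \<Rightarrow> real \<Rightarrow> real \<Rightarrow> real \<Rightarrow> real" where
  "velocity_coeff_above n s r V = coeff_above n s r * (if V = 1 then velocity_ratio n r else 1)"

text \<open>A single formula for both half-lines: each exponential is frozen at 1 on the other side,
  and the summand - 1 removes the upper mode below 0. The Lipschitz bound across the origin can thus
  be read off directly.\<close>

definition solution :: "real \<Rightarrow> real \<Rightarrow> real \<Rightarrow> real \<Rightarrow> real \<Rightarrow> real" where
  "solution n s r V x = 1 / s + velocity_coeff_below n s r V * exp (- (decay n s * max 0 (- x)))
    + velocity_coeff_above n s r V * (exp (- (decay n r * max 0 x)) - 1)"

lemma coeff_match:
  assumes "0 < n" "0 < s" "0 < r"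
  shows "1 / s + velocity_coeff_below n s r V - velocity_coeff_above n s r V = 1 / r"
proof -
  define p q where "p = velocity_ratio n r" and "q = velocity_ratio n s"
  have "p * q < 1"
    using velocity_ratio_bounds[of n r] velocity_ratio_bounds[of n s] assms mult_strict_mono[of p 1 q 1]
    by (simp add: p_def q_def)
  then have nz: "1 - p * q \<noteq> 0" by simp
  define d where "d = 1 / r - 1 / s"
  have "d * ((1 - p) / (1 - p * q)) + d * ((1 - q) / (1 - p * q)) * p = d * ((1 - p * q) / (1 - p * q))"
    unfolding times_divide_eq_right times_divide_eq_left add_divide_distrib[symmetric]
    by (rule arg_cong2[where f = divide]) (simp_all add: algebra_simps)
  moreover have "d * ((1 - p) / (1 - p * q)) * q + d * ((1 - q) / (1 - p * q)) = d * ((1 - p * q) / (1 - p * q))"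
    unfolding times_divide_eq_right times_divide_eq_left add_divide_distrib[symmetric]
    by (rule arg_cong2[where f = divide]) (simp_all add: algebra_simps)
  ultimately show ?thesis
    using nz
    unfolding velocity_coeff_below_def velocity_coeff_above_def coeff_below_def coeff_above_def
      p_def[symmetric] q_def[symmetric] d_def[symmetric]
    by (simp add: d_def)
qed

text \<open>On each half-line the function is the constant particular solution (\<open>1 / s\<close>
  below, \<open>1 / r\<close> above) plus an eigenmode, so the equation reduces to the two
  eigenvector relations in \<open>velocity_ratio_bounds\<close>.\<close>

lemma solution_ode:
  assumes n: "0 < n" and s: "0 < s" and r: "0 < r" and V: "V = 1 \<or> V = - 1" and x: "x \<noteq> 0"
  shows "(solution n s r V has_real_derivative
    V * ((s + (r - s) * heaviside x) * solution n s r V x - 1 - n * (solution n s r (- V) x - solution n s r V x))) (at x)"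
proof (cases "0 < x")
  case True
  define A k where "A = velocity_coeff_above n s r" and "k = decay n r"
  have eq: "solution n s r W z = 1 / r + A W * exp (- (k * z))" if "0 < z" for W z
    using that coeff_match[OF n s r, of W] by (simp add: solution_def A_def k_def algebra_simps)
  have "((\<lambda>z. 1 / r + A V * exp (- (k * z))) has_real_derivative A V * (exp (- (k * x)) * (- k))) (at x)"
    by (auto intro!: derivative_eq_intros)
  moreover have "eventually (\<lambda>z. solution n s r V z = 1 / r + A V * exp (- (k * z))) (nhds x)"
    using eventually_nhds_in_open[of "{0<..}" x] True by (auto elim!: eventually_mono simp: eq)
  ultimately have "(solution n s r V has_real_derivative A V * (exp (- (k * x)) * (- k))) (at x)"
    by (subst DERIV_cong_ev[OF refl _ refl])
  moreover have "V * ((n + r) * A V - n * A (- V)) = - k * A V"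
  proof -
    define p c where "p = velocity_ratio n r" and "c = coeff_above n s r"
    have 1: "(n + r) * p - n = - k * p" and 2: "(n + r) - n * p = k"
      using velocity_ratio_bounds(3,4)[OF n r] by (simp_all add: p_def k_def algebra_simps)
    have "V * ((n + r) * A V - n * A (- V)) = (if V = 1 then c * ((n + r) * p - n) else - (c * ((n + r) - n * p)))"
      using V by (auto simp: A_def velocity_coeff_above_def p_def c_def algebra_simps)
    also have "\<dots> = - k * A V"
      unfolding 1 2 using V by (auto simp: A_def velocity_coeff_above_def p_def c_def)
    finally show ?thesis .
  qed
  then have "V * ((s + (r - s) * heaviside x) * solution n s r V x - 1 - n * (solution n s r (- V) x - solution n s r V x))
      = A V * (exp (- (k * x)) * (- k))"
  proof -
    have "V * ((s + (r - s) * heaviside x) * solution n s r V x - 1 - n * (solution n s r (- V) x - solution n s r V x))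
      = V * ((n + r) * A V - n * A (- V)) * exp (- (k * x))"
      using True r by (simp add: eq heaviside_def algebra_simps)
    then show ?thesis using \<open>V * ((n + r) * A V - n * A (- V)) = - k * A V\<close> by simp
  qed
  ultimately show ?thesis by simp
next
  case False
  then have x: "x < 0" using x by simp
  define B k where "B = velocity_coeff_below n s r" and "k = decay n s"
  have eq: "solution n s r W z = 1 / s + B W * exp (k * z)" if "z < 0" for W z
    using that by (simp add: solution_def B_def k_def max_def)
  have "((\<lambda>z. 1 / s + B V * exp (k * z)) has_real_derivative B V * (exp (k * x) * k)) (at x)"
    by (auto intro!: derivative_eq_intros)
  moreover have "eventually (\<lambda>z. solution n s r V z = 1 / s + B V * exp (k * z)) (nhds x)"
    using eventually_nhds_in_open[of "{..<0}" x] x by (auto elim!: eventually_mono simp: eq)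
  ultimately have "(solution n s r V has_real_derivative B V * (exp (k * x) * k)) (at x)"
    by (subst DERIV_cong_ev[OF refl _ refl])
  moreover have key: "V * ((n + s) * B V - n * B (- V)) = k * B V"
  proof -
    define p c where "p = velocity_ratio n s" and "c = coeff_below n s r"
    have 1: "(n + s) * p - n = - k * p" and 2: "(n + s) - n * p = k"
      using velocity_ratio_bounds(3,4)[OF n s] by (simp_all add: p_def k_def algebra_simps)
    have "V * ((n + s) * B V - n * B (- V)) = (if V = 1 then c * ((n + s) - n * p) else - (c * ((n + s) * p - n)))"
      using V by (auto simp: B_def velocity_coeff_below_def p_def c_def algebra_simps)
    also have "\<dots> = k * B V"
      unfolding 1 2 using V by (auto simp: B_def velocity_coeff_below_def p_def c_def)
    finally show ?thesis .
  qed
  have "V * ((s + (r - s) * heaviside x) * solution n s r V x - 1 - n * (solution n s r (- V) x - solution n s r V x))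
      = V * ((n + s) * B V - n * B (- V)) * exp (k * x)"
    using x s by (simp add: eq heaviside_def algebra_simps)
  then have "V * ((s + (r - s) * heaviside x) * solution n s r V x - 1 - n * (solution n s r (- V) x - solution n s r V x))
      = B V * (exp (k * x) * k)" using key by simp
  ultimately show ?thesis by simp
qed

lemma exp_decay_lipschitz:
  fixes k x z :: real
  assumes "0 \<le> k"
  shows "\<bar>exp (- (k * max 0 x)) - exp (- (k * max 0 z))\<bar> \<le> k * \<bar>x - z\<bar>"
proof -
  have "\<bar>exp (- (k * max 0 x)) - exp (- (k * max 0 z))\<bar> \<le> \<bar>k * max 0 x - k * max 0 z\<bar>"
    using assms by (intro exp_minus_lipschitz) auto
  also have "\<dots> = k * \<bar>max 0 x - max 0 z\<bar>"
    using assms unfolding right_diff_distrib[symmetric] by (simp add: abs_mult)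
  also have "\<dots> \<le> k * \<bar>x - z\<bar>" using assms by (intro mult_left_mono) (auto simp: max_def)
  finally show ?thesis .
qed

lemma abs_velocity_coeff_le:
  assumes "0 < n" "0 < s" "0 < r"
  shows "\<bar>velocity_coeff_below n s r V\<bar> \<le> \<bar>coeff_below n s r\<bar>" "\<bar>velocity_coeff_above n s r V\<bar> \<le> \<bar>coeff_above n s r\<bar>"
proof -
  have *: "\<bar>c * p\<bar> \<le> \<bar>c\<bar>" if "0 < p" "p < 1" for c p :: real
    using that mult_left_mono[of p 1 "\<bar>c\<bar>"] by (simp add: abs_mult)
  show "\<bar>velocity_coeff_below n s r V\<bar> \<le> \<bar>coeff_below n s r\<bar>"
    using *[OF velocity_ratio_bounds(1,2)[OF assms(1,2)]] by (simp add: velocity_coeff_below_def)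
  show "\<bar>velocity_coeff_above n s r V\<bar> \<le> \<bar>coeff_above n s r\<bar>"
    using *[OF velocity_ratio_bounds(1,2)[OF assms(1,3)]] by (simp add: velocity_coeff_above_def)
qed

lemma solution_bound:
  assumes n: "0 < n" and s: "0 < s" and r: "0 < r"
  shows "\<bar>solution n s r V x\<bar> \<le> 1 / s + \<bar>coeff_below n s r\<bar> + \<bar>coeff_above n s r\<bar>"
proof -
  have k: "0 \<le> decay n s" "0 \<le> decay n r" using n s r by (auto simp: decay_def)
  have 1: "\<bar>velocity_coeff_below n s r V * exp (- (decay n s * max 0 (- x)))\<bar> \<le> \<bar>coeff_below n s r\<bar> * 1"
    unfolding abs_mult using abs_velocity_coeff_le[OF assms] k by (intro mult_mono) auto
  have 2: "\<bar>velocity_coeff_above n s r V * (exp (- (decay n r * max 0 x)) - 1)\<bar> \<le> \<bar>coeff_above n s r\<bar> * 1"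
    unfolding abs_mult using abs_velocity_coeff_le[OF assms] k by (intro mult_mono) auto
  have 3: "0 \<le> 1 / s" using s by simp
  define X Y where "X = velocity_coeff_below n s r V * exp (- (decay n s * max 0 (- x)))"
    and "Y = velocity_coeff_above n s r V * (exp (- (decay n r * max 0 x)) - 1)"
  have "\<bar>1 / s + X + Y\<bar> \<le> 1 / s + \<bar>X\<bar> + \<bar>Y\<bar>" using 3 by linarith
  then show ?thesis using 1 2 unfolding solution_def X_def Y_def by linarith
qed

lemma solution_lipschitz:
  assumes n: "0 < n" and s: "0 < s" and r: "0 < r"
  shows "\<bar>solution n s r V x - solution n s r V z\<bar>
    \<le> (\<bar>coeff_below n s r\<bar> * decay n s + \<bar>coeff_above n s r\<bar> * decay n r) * \<bar>x - z\<bar>"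
proof -
  have k: "0 \<le> decay n s" "0 \<le> decay n r" using n s r by (auto simp: decay_def)
  let ?e = "\<lambda>q x. exp (- (decay n q * max 0 x))"
  define B A where "B = velocity_coeff_below n s r V" and "A = velocity_coeff_above n s r V"
  define P Q where "P = ?e s (- x) - ?e s (- z)" and "Q = ?e r x - ?e r z"
  have eq: "solution n s r V x - solution n s r V z = B * P + A * Q"
    unfolding solution_def B_def A_def P_def Q_def by (simp only: right_diff_distrib)
  have "\<bar>P\<bar> \<le> decay n s * \<bar>x - z\<bar>" "\<bar>Q\<bar> \<le> decay n r * \<bar>x - z\<bar>"
    using exp_decay_lipschitz[OF k(1), of "- x" "- z"] exp_decay_lipschitz[OF k(2), of x z]
    by (simp_all add: P_def Q_def abs_minus_commute)
  then have "\<bar>B\<bar> * \<bar>P\<bar> \<le> \<bar>coeff_below n s r\<bar> * (decay n s * \<bar>x - z\<bar>)"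
    "\<bar>A\<bar> * \<bar>Q\<bar> \<le> \<bar>coeff_above n s r\<bar> * (decay n r * \<bar>x - z\<bar>)"
    using abs_velocity_coeff_le[OF assms, of V] unfolding B_def A_def by (intro mult_mono; simp)+
  moreover have "\<bar>B * P + A * Q\<bar> \<le> \<bar>B\<bar> * \<bar>P\<bar> + \<bar>A\<bar> * \<bar>Q\<bar>"
    using abs_triangle_ineq[of "B * P" "A * Q"] by (simp only: abs_mult)
  ultimately show ?thesis unfolding eq distrib_right mult.assoc by linarith
qed

text \<open>\<open>1 - velocity_ratio n q\<close> behaves like sqrt(2 q / n), so numerator and
  denominator of the last quotient both vanish. Multiplying them by \<open>sqrt n\<close> and
  writing 1 - p q = (1 - p) + p (1 - q) exposes the limit.\<close>

lemma ratio_limits: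
  assumes s: "0 < s" and r: "0 < r"
  shows "((\<lambda>n. velocity_ratio n s) \<longlongrightarrow> 1) at_top"
    "((\<lambda>n. decay n s / sqrt n) \<longlongrightarrow> sqrt (2 * s)) at_top"
    "((\<lambda>n. (1 - velocity_ratio n r) / (1 - velocity_ratio n r * velocity_ratio n s)) \<longlongrightarrow> sqrt r / (sqrt r + sqrt s)) at_top"
proof -
  have one: "((\<lambda>n. velocity_ratio n q) \<longlongrightarrow> 1) at_top" if "0 < q" for q
    unfolding velocity_ratio_def decay_def using that by real_asymp
  have dec: "((\<lambda>n. decay n q / sqrt n) \<longlongrightarrow> sqrt (2 * q)) at_top" if "0 < q" for q
  proof -
    have "((\<lambda>n. sqrt (q * (q + 2 * n) / n)) \<longlongrightarrow> sqrt (2 * q)) at_top"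
      using that by (intro tendsto_real_sqrt) real_asymp
    then show ?thesis by (simp add: decay_def real_sqrt_divide)
  qed
  define u where "u q n = sqrt n * (1 - velocity_ratio n q)" for q n
  have u_lim: "(u q \<longlongrightarrow> sqrt (2 * q)) at_top" if q: "0 < q" for q
  proof -
    have "((\<lambda>n. q / sqrt n) \<longlongrightarrow> 0) at_top" using q by real_asymp
    from tendsto_diff[OF dec[OF q] this]
    have "((\<lambda>n. decay n q / sqrt n - q / sqrt n) \<longlongrightarrow> sqrt (2 * q)) at_top" by simp
    moreover have "eventually (\<lambda>n. decay n q / sqrt n - q / sqrt n = u q n) at_top"
      using eventually_gt_at_top[of 0]
    proof eventually_elim
      case (elim n)
      have "1 - velocity_ratio n q = (decay n q - q) / n"
        using elim by (simp add: velocity_ratio_def field_simps)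
      then have "u q n = sqrt n * ((decay n q - q) / (sqrt n * sqrt n))"
        using elim by (simp add: u_def)
      moreover have "S * (x / (S * S)) = x / S" if "0 < S" for S x :: real using that by simp
      ultimately have "u q n = (decay n q - q) / sqrt n" using elim by (simp only: real_sqrt_gt_zero)
      then show ?case by (simp only: diff_divide_distrib)
    qed
    ultimately show ?thesis by (rule Lim_transform_eventually)
  qed
  show "((\<lambda>n. velocity_ratio n s) \<longlongrightarrow> 1) at_top" "((\<lambda>n. decay n s / sqrt n) \<longlongrightarrow> sqrt (2 * s)) at_top"
    using one dec s by auto
  have pos: "0 < sqrt (2 * r) + 1 * sqrt (2 * s)" using s r by (simp add: add_pos_pos)
  have "((\<lambda>n. u r n / (u r n + velocity_ratio n r * u s n)) \<longlongrightarrow> sqrt (2 * r) / (sqrt (2 * r) + 1 * sqrt (2 * s))) at_top"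
    by (intro tendsto_divide tendsto_add tendsto_mult u_lim one s r) (use pos in linarith)
  moreover have "sqrt (2 * r) / (sqrt (2 * r) + 1 * sqrt (2 * s)) = sqrt r / (sqrt r + sqrt s)"
  proof -
    have "sqrt (2 * r) / (sqrt (2 * r) + 1 * sqrt (2 * s)) = (sqrt 2 * sqrt r) / (sqrt 2 * (sqrt r + sqrt s))"
      by (simp only: real_sqrt_mult distrib_left mult_1)
    then show ?thesis by (simp only: mult_divide_mult_cancel_left_if) simp
  qed
  moreover have "eventually (\<lambda>n. u r n / (u r n + velocity_ratio n r * u s n)
      = (1 - velocity_ratio n r) / (1 - velocity_ratio n r * velocity_ratio n s)) at_top"
    using eventually_gt_at_top[of 0]
  proof eventually_elim
    case (elim n)
    have "u r n + velocity_ratio n r * u s n = sqrt n * (1 - velocity_ratio n r * velocity_ratio n s)"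
      by (simp add: u_def algebra_simps)
    then show ?case using elim by (simp add: u_def)
  qed
  ultimately show "((\<lambda>n. (1 - velocity_ratio n r) / (1 - velocity_ratio n r * velocity_ratio n s)) \<longlongrightarrow> sqrt r / (sqrt r + sqrt s)) at_top"
    by (auto dest: Lim_transform_eventually)
qed

lemma sqrt_fraction_identity:
  assumes "0 < s" "0 < r"
  shows "(1 / r - 1 / s) * (sqrt r / (sqrt r + sqrt s)) = 1 / sqrt (s * r) - 1 / s"
proof -
  define p q where "p = sqrt r" and "q = sqrt s"
  have pq: "0 < p" "0 < q" "r = p * p" "s = q * q" using assms by (auto simp: p_def q_def)
  have "(1 / (p * p) - 1 / (q * q)) * (p / (p + q)) = (q - p) / ((p * q) * (p * q)) * ((q + p) * (p / (p + q)))"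
    using pq(1,2) by (simp add: divide_simps) (simp add: algebra_simps)
  also have "(q + p) * (p / (p + q)) = p" using pq(1,2) by (simp add: add.commute)
  also have "(q - p) / ((p * q) * (p * q)) * p = 1 / (q * p) - 1 / (q * q)" using pq(1,2) by (simp add: field_simps)
  finally have "(1 / (p * p) - 1 / (q * q)) * (p / (p + q)) = 1 / (q * p) - 1 / (q * q)" .
  moreover have "sqrt (s * r) = q * p" by (simp add: real_sqrt_mult p_def q_def)
  ultimately show ?thesis by (simp add: p_def q_def assms(1,2) less_imp_le)
qed

text \<open>The velocity \<open>V\<close> enters only through a factor
  \<open>velocity_ratio\<close>, which tends to 1, so the limit does not depend on it. Since
  \<open>a\<close> is at most 0, the exponential belonging to the upper half-line tends to 1 and its
  term drops out.\<close>

lemma solution_tendsto: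
  fixes n y :: "'i \<Rightarrow> real"
  assumes s: "0 < s" and r: "0 < r" and a: "a \<le> 0"
    and n: "filterlim n at_top F" and y: "((\<lambda>i. y i * sqrt (n i)) \<longlongrightarrow> a) F"
  shows "((\<lambda>i. solution (n i) s r V (y i)) \<longlongrightarrow> 1 / s - exp (- ((- a) * sqrt (2 * s))) * (1 / s - 1 / sqrt (s * r))) F"
proof -
  note lim = filterlim_compose[OF _ n]
  have ratio: "((\<lambda>i. velocity_ratio (n i) s) \<longlongrightarrow> 1) F" "((\<lambda>i. velocity_ratio (n i) r) \<longlongrightarrow> 1) F"
    using ratio_limits(1)[OF s s] ratio_limits(1)[OF r r] by (auto intro: lim)
  define b where "b = (1 / r - 1 / s) * (sqrt r / (sqrt r + sqrt s))"
  define c where "c = - ((1 / r - 1 / s) * (sqrt s / (sqrt s + sqrt r)))"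
  have "((\<lambda>i. coeff_below (n i) s r) \<longlongrightarrow> b) F"
    unfolding coeff_below_def b_def by (intro tendsto_mult tendsto_const lim[OF ratio_limits(3)[OF s r]])
  from tendsto_mult[OF this tendsto_const[of 1]] tendsto_mult[OF this ratio(1)]
  have below: "((\<lambda>i. velocity_coeff_below (n i) s r V) \<longlongrightarrow> b) F"
    by (cases "V = 1") (simp_all add: velocity_coeff_below_def)
  have "((\<lambda>i. coeff_above (n i) s r) \<longlongrightarrow> c) F"
    unfolding coeff_above_def c_def
    using lim[OF ratio_limits(3)[OF r s]]
    by (intro tendsto_minus tendsto_mult tendsto_const) (simp add: mult.commute)
  from tendsto_mult[OF this tendsto_const[of 1]] tendsto_mult[OF this ratio(2)]
  have above: "((\<lambda>i. velocity_coeff_above (n i) s r V) \<longlongrightarrow> c) F"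
    by (cases "V = 1") (simp_all add: velocity_coeff_above_def)
  have n_pos: "eventually (\<lambda>i. 0 < n i) F"
    using n by (simp add: filterlim_at_top_dense)
  \<comment> \<open>Writing the product as \<open>decay / sqrt n\<close> times
    \<open>y * sqrt n\<close> separates two known limits; the sign \<open>\<sigma>\<close> selects
    the half-line.\<close>
  have exponent: "((\<lambda>i. decay (n i) q * max 0 (\<sigma> * y i)) \<longlongrightarrow> sqrt (2 * q) * max 0 (\<sigma> * a)) F" if q: "0 < q" for q \<sigma>
  proof -
    have "((\<lambda>i. (decay (n i) q / sqrt (n i)) * max 0 (\<sigma> * (y i * sqrt (n i)))) \<longlongrightarrow> sqrt (2 * q) * max 0 (\<sigma> * a)) F"
      by (intro tendsto_mult tendsto_max tendsto_const y lim[OF ratio_limits(2)[OF q q]])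
    moreover have "eventually (\<lambda>i. (decay (n i) q / sqrt (n i)) * max 0 (\<sigma> * (y i * sqrt (n i))) = decay (n i) q * max 0 (\<sigma> * y i)) F"
      using n_pos
    proof eventually_elim
      case (elim i)
      have "max 0 (\<sigma> * (y i * sqrt (n i))) = sqrt (n i) * max 0 (\<sigma> * y i)"
        using elim by (auto simp: max_def mult_le_0_iff zero_le_mult_iff mult.commute mult.left_commute)
      then show ?case using elim by simp
    qed
    ultimately show ?thesis by (rule Lim_transform_eventually)
  qed
  have "((\<lambda>i. solution (n i) s r V (y i)) \<longlongrightarrow> 1 / s + b * exp (- (sqrt (2 * s) * max 0 (- 1 * a)))
      + c * (exp (- (sqrt (2 * r) * max 0 (1 * a))) - 1)) F"
    using tendsto_add[OF tendsto_add[OF tendsto_const[of "1 / s"]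
        tendsto_mult[OF below tendsto_exp[OF tendsto_minus[OF exponent[OF s, of "- 1"]]]]]
        tendsto_mult[OF above tendsto_diff[OF tendsto_exp[OF tendsto_minus[OF exponent[OF r, of 1]]] tendsto_const[of 1]]]]
    by (simp add: solution_def)
  moreover have "1 / s + b * exp (- (sqrt (2 * s) * max 0 (- 1 * a))) + c * (exp (- (sqrt (2 * r) * max 0 (1 * a))) - 1)
      = 1 / s - exp (- ((- a) * sqrt (2 * s))) * (1 / s - 1 / sqrt (s * r))"
  proof -
    have m: "max 0 (- 1 * a) = - a" "max 0 (1 * a) = 0" using a by auto
    have b: "b = 1 / sqrt (s * r) - 1 / s" unfolding b_def by (rule sqrt_fraction_identity[OF s r])
    show ?thesis unfolding m b by (simp add: algebra_simps)
  qed
  ultimately show ?thesis by (simp only:)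
qed

section \<open>Inversion of Laplace transforms\<close>

lemma polynomial_approximation_unit_interval:
  fixes f :: "real \<Rightarrow> real"
  assumes "continuous_on {0..1} f" "0 < e"
  obtains a N where "\<And>x. x \<in> {0..1} \<Longrightarrow> \<bar>f x - (\<Sum>i\<le>N. a i * x ^ i)\<bar> < e"
proof -
  obtain g where "real_polynomial_function g" "\<And>x. x \<in> {0..1} \<Longrightarrow> \<bar>f x - g x\<bar> < e"
    using Stone_Weierstrass_real_polynomial_function[OF compact_Icc assms] by blast
  then show thesis using that unfolding real_polynomial_function_iff_sum by blast
qed

lemma exp_power_nat: "exp (- x) ^ i = exp (- (real i * x))" for x :: real
  by (simp flip: exp_of_nat_mult)

text \<open>In the variable w = exp(- y) the exponentials with integer rates are the monomials, and
  polynomials are uniformly dense by Weierstrass.\<close>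

lemma exponential_moments_determine_limit:
  fixes P :: "'i \<Rightarrow> 'a measure" and X :: "'i \<Rightarrow> 'a \<Rightarrow> real" and Z :: "'b \<Rightarrow> real" and f :: "real \<Rightarrow> real"
  assumes P: "\<And>i. prob_space (P i)" and Q: "prob_space Q"
    and X: "\<And>i. X i \<in> borel_measurable (P i)" and Z: "Z \<in> borel_measurable Q"
    and X_range: "\<And>i \<omega>. \<omega> \<in> space (P i) \<Longrightarrow> X i \<omega> \<in> {0..1}"
    and Z_range: "\<And>\<omega>. \<omega> \<in> space Q \<Longrightarrow> Z \<omega> \<in> {0..1}"
    and lim: "\<And>k::nat. 0 < k \<Longrightarrow> ((\<lambda>i. \<integral>\<omega>. exp (- (real k * X i \<omega>)) \<partial>P i) \<longlongrightarrow> (\<integral>\<omega>. exp (- (real k * Z \<omega>)) \<partial>Q)) F"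
    and f: "continuous_on UNIV f"
  shows "((\<lambda>i. \<integral>\<omega>. f (X i \<omega>) \<partial>P i) \<longlongrightarrow> (\<integral>\<omega>. f (Z \<omega>) \<partial>Q)) F"
proof (rule tendstoI)
  fix e :: real assume e: "0 < e"
  \<comment> \<open>Values \<open>y\<close> in [0, 1] correspond to \<open>w\<close> in
    [exp(-1), 1]. The maximum extends the function continuously down to \<open>w = 0\<close>, where
    the logarithm would be singular.\<close>
  define h where "h w = f (- ln (max w (exp (- 1))))" for w
  have "0 < max w (exp (- 1))" for w :: real by (simp add: less_max_iff_disj)
  then have "continuous_on {0..1} h"
    unfolding h_def by (intro continuous_intros continuous_on_compose2[OF f]) (auto simp: less_imp_neq[symmetric])
  then obtain a N where a: "\<And>w. w \<in> {0..1} \<Longrightarrow> \<bar>h w - (\<Sum>k\<le>N. a k * w ^ k)\<bar> < e / 3"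
    using polynomial_approximation_unit_interval[of h "e / 3"] e by auto
  define p where "p y = (\<Sum>k\<le>N. a k * exp (- (real k * y)))" for y
  have approx: "\<bar>f y - p y\<bar> \<le> e / 3" if "y \<in> {0..1}" for y
  proof -
    have "max (exp (- y)) (exp (- 1)) = exp (- y)" using that by simp
    then have "h (exp (- y)) = f y" by (simp add: h_def)
    then show ?thesis using a[of "exp (- y)"] that by (simp add: p_def exp_power_nat)
  qed
  have key: "integrable R (\<lambda>\<omega>. exp (- (real k * W \<omega>)))" "\<bar>(\<integral>\<omega>. f (W \<omega>) \<partial>R) - (\<Sum>k\<le>N. a k * (\<integral>\<omega>. exp (- (real k * W \<omega>)) \<partial>R))\<bar> \<le> e / 3"
    if R: "prob_space R" and W: "W \<in> borel_measurable R" and W_range: "\<And>\<omega>. \<omega> \<in> space R \<Longrightarrow> W \<omega> \<in> {0..1}"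
    for R :: "'c measure" and W k
  proof -
    interpret prob_space R by (rule R)
    show i: "integrable R (\<lambda>\<omega>. exp (- (real k * W \<omega>)))" for k
      by (rule integrable_const_bound[where B = 1]) (use W W_range in auto)
    have fW: "(\<lambda>\<omega>. f (W \<omega>)) \<in> borel_measurable R"
      using borel_measurable_continuous_onI[OF f] W by measurable
    have p_int: "integrable R (\<lambda>\<omega>. p (W \<omega>))" unfolding p_def using i by auto
    have d_int: "integrable R (\<lambda>\<omega>. f (W \<omega>) - p (W \<omega>))"
      by (rule integrable_const_bound[where B = "e / 3"])
         (use fW borel_measurable_integrable[OF p_int] approx W_range in auto)
    have "integrable R (\<lambda>\<omega>. f (W \<omega>))"
      using Bochner_Integration.integrable_add[OF d_int p_int] by simp
    then have "(\<integral>\<omega>. f (W \<omega>) \<partial>R) - (\<integral>\<omega>. p (W \<omega>) \<partial>R) = (\<integral>\<omega>. f (W \<omega>) - p (W \<omega>) \<partial>R)"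
      using p_int by simp
    also have "\<bar>\<dots>\<bar> \<le> (\<integral>\<omega>. e / 3 \<partial>R)"
      by (rule abs_integral_le[OF d_int]) (use approx W_range in auto)
    finally show "\<bar>(\<integral>\<omega>. f (W \<omega>) \<partial>R) - (\<Sum>k\<le>N. a k * (\<integral>\<omega>. exp (- (real k * W \<omega>)) \<partial>R))\<bar> \<le> e / 3"
      using i by (simp add: p_def prob_space)
  qed
  have "((\<lambda>i. \<Sum>k\<le>N. a k * (\<integral>\<omega>. exp (- (real k * X i \<omega>)) \<partial>P i)) \<longlongrightarrow> (\<Sum>k\<le>N. a k * (\<integral>\<omega>. exp (- (real k * Z \<omega>)) \<partial>Q))) F"
  proof (intro tendsto_sum tendsto_mult tendsto_const)
    fix k
    show "((\<lambda>i. \<integral>\<omega>. exp (- (real k * X i \<omega>)) \<partial>P i) \<longlongrightarrow> (\<integral>\<omega>. exp (- (real k * Z \<omega>)) \<partial>Q)) F"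
      using lim[of k] prob_space.prob_space[OF P] prob_space.prob_space[OF Q] by (cases "k = 0") auto
  qed
  from tendstoD[OF this, of "e / 3"] e
  have "eventually (\<lambda>i. dist (\<Sum>k\<le>N. a k * (\<integral>\<omega>. exp (- (real k * X i \<omega>)) \<partial>P i)) (\<Sum>k\<le>N. a k * (\<integral>\<omega>. exp (- (real k * Z \<omega>)) \<partial>Q)) < e / 3) F"
    by simp
  then show "eventually (\<lambda>i. dist (\<integral>\<omega>. f (X i \<omega>) \<partial>P i) (\<integral>\<omega>. f (Z \<omega>) \<partial>Q) < e) F"
  proof eventually_elim
    case (elim i)
    show ?case
      using elim key(2)[OF P X X_range, of i] key(2)[OF Q Z Z_range] unfolding dist_real_def by linarith
  qed
qed

text \<open>A continuous step falling from 1 to 0 between \<open>u\<close> and \<open>u'\<close> has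
  its mean between the distribution function at \<open>u\<close> and at \<open>u'\<close>. Placing
  such steps on either side of a continuity point squeezes the limit.\<close>

lemma converges_in_distributionI:
  fixes P :: "'i \<Rightarrow> 'a measure" and X :: "'i \<Rightarrow> 'a \<Rightarrow> real" and Z :: "'b \<Rightarrow> real"
  assumes P: "\<And>i. prob_space (P i)" and Q: "prob_space Q"
    and X: "\<And>i. X i \<in> borel_measurable (P i)" and Z: "Z \<in> borel_measurable Q"
    and lim: "\<And>f :: real \<Rightarrow> real. continuous_on UNIV f \<Longrightarrow> (\<And>x. \<bar>f x\<bar> \<le> 1) \<Longrightarrow>
      ((\<lambda>i. \<integral>\<omega>. f (X i \<omega>) \<partial>P i) \<longlongrightarrow> (\<integral>\<omega>. f (Z \<omega>) \<partial>Q)) F"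
  shows "converges_in_distribution (\<lambda>i. distr (P i) borel (X i)) (distr Q borel Z) F"
  unfolding converges_in_distribution_def
proof (intro allI impI)
  fix y assume cont: "isCont (cdf (distr Q borel Z)) y"
  have up: "cdf (distr R borel W) u \<le> (\<integral>\<omega>. cts_step u u' (W \<omega>) \<partial>R)"
    and low: "(\<integral>\<omega>. cts_step u u' (W \<omega>) \<partial>R) \<le> cdf (distr R borel W) u'"
    if R: "prob_space R" and W: "W \<in> borel_measurable R" and u: "u < u'" for R :: "'c measure" and W u u'
  proof -
    interpret D: real_distribution "distr R borel W"
      unfolding real_distribution_def real_distribution_axioms_def using prob_space.prob_space_distr[OF R W] by simp
    have "cts_step u u' \<in> borel_measurable borel"
      using cts_step_uniformly_continuous[OF u] by (intro borel_measurable_continuous_onI uniformly_continuous_imp_continuous)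
    then have "(\<integral>\<omega>. cts_step u u' (W \<omega>) \<partial>R) = (\<integral>x. cts_step u u' x \<partial>distr R borel W)"
      by (rule integral_distr[OF W, symmetric])
    then show "cdf (distr R borel W) u \<le> (\<integral>\<omega>. cts_step u u' (W \<omega>) \<partial>R)"
      "(\<integral>\<omega>. cts_step u u' (W \<omega>) \<partial>R) \<le> cdf (distr R borel W) u'"
      using D.cdf_cts_step[OF u] by simp_all
  qed
  have step_lim: "((\<lambda>i. \<integral>\<omega>. cts_step u u' (X i \<omega>) \<partial>P i) \<longlongrightarrow> (\<integral>\<omega>. cts_step u u' (Z \<omega>) \<partial>Q)) F" if "u < u'" for u u'
  proof (rule lim)
    show "continuous_on UNIV (cts_step u u')"
      by (rule uniformly_continuous_imp_continuous[OF cts_step_uniformly_continuous[OF that]])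
    show "\<bar>cts_step u u' x\<bar> \<le> 1" for x
      using that by (auto simp: cts_step_def divide_simps)
  qed
  show "((\<lambda>i. cdf (distr (P i) borel (X i)) y) \<longlongrightarrow> cdf (distr Q borel Z) y) F"
  proof (rule tendstoI)
    fix e :: real assume e: "0 < e"
    from cont have "eventually (\<lambda>z. dist (cdf (distr Q borel Z) z) (cdf (distr Q borel Z) y) < e / 2) (at y)"
      using e by (intro tendstoD) (auto simp: isCont_def)
    then obtain d where d: "0 < d" "\<And>z. z \<noteq> y \<Longrightarrow> dist z y < d \<Longrightarrow> dist (cdf (distr Q borel Z) z) (cdf (distr Q borel Z) y) < e / 2"
      by (auto simp: eventually_at)
    let ?G = "cdf (distr Q borel Z)"
    have c: "?G (y + d / 2) < ?G y + e / 2" "?G y - e / 2 < ?G (y - d / 2)"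
    proof -
      have "dist (?G (y + d / 2)) (?G y) < e / 2" "dist (?G (y - d / 2)) (?G y) < e / 2"
        by (rule d(2); use d(1) in \<open>simp add: dist_real_def\<close>)+
      then show "?G (y + d / 2) < ?G y + e / 2" "?G y - e / 2 < ?G (y - d / 2)"
        unfolding dist_real_def by linarith+
    qed
    have "eventually (\<lambda>i. dist (\<integral>\<omega>. cts_step y (y + d / 2) (X i \<omega>) \<partial>P i) (\<integral>\<omega>. cts_step y (y + d / 2) (Z \<omega>) \<partial>Q) < e / 2) F"
      "eventually (\<lambda>i. dist (\<integral>\<omega>. cts_step (y - d / 2) y (X i \<omega>) \<partial>P i) (\<integral>\<omega>. cts_step (y - d / 2) y (Z \<omega>) \<partial>Q) < e / 2) F"
      using tendstoD[OF step_lim[of y "y + d / 2"], of "e / 2"] tendstoD[OF step_lim[of "y - d / 2" y], of "e / 2"] e d(1)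
      by simp_all
    then show "eventually (\<lambda>i. dist (cdf (distr (P i) borel (X i)) y) (?G y) < e) F"
    proof eventually_elim
      case (elim i)
      have "cdf (distr (P i) borel (X i)) y \<le> (\<integral>\<omega>. cts_step y (y + d / 2) (X i \<omega>) \<partial>P i)"
        by (rule up[OF P X]) (use d in simp)
      moreover have "(\<integral>\<omega>. cts_step y (y + d / 2) (Z \<omega>) \<partial>Q) \<le> ?G (y + d / 2)"
        by (rule low[OF Q Z]) (use d in simp)
      moreover have "(\<integral>\<omega>. cts_step (y - d / 2) y (X i \<omega>) \<partial>P i) \<le> cdf (distr (P i) borel (X i)) y"
        by (rule low[OF P X]) (use d in simp)
      moreover have "?G (y - d / 2) \<le> (\<integral>\<omega>. cts_step (y - d / 2) y (Z \<omega>) \<partial>Q)"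
        by (rule up[OF Q Z]) (use d in simp)
      ultimately show ?case using elim c unfolding dist_real_def by linarith
    qed
  qed
qed

section \<open>Recovering the value at time 1 from transforms in time\<close>

lemma set_integral_finite_sum:
  fixes f :: "'k \<Rightarrow> 'a \<Rightarrow> real"
  assumes "finite A" "\<And>k. k \<in> A \<Longrightarrow> set_integrable M S (f k)"
  shows "set_integrable M S (\<lambda>x. \<Sum>k\<in>A. f k x) \<and> (LINT x:S|M. (\<Sum>k\<in>A. f k x)) = (\<Sum>k\<in>A. LINT x:S|M. f k x)"
  using assms
proof (induction A rule: finite_induct)
  case empty
  then show ?case by (simp add: set_integrable_def set_lebesgue_integral_def)
next
  case (insert k A)
  then have 1: "set_integrable M S (f k)" and 2: "set_integrable M S (\<lambda>x. \<Sum>k\<in>A. f k x)"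
    and 3: "(LINT x:S|M. (\<Sum>k\<in>A. f k x)) = (\<Sum>k\<in>A. LINT x:S|M. f k x)" by auto
  show ?case
    using set_integral_add[OF 1 2] 3 insert.hyps by simp
qed

text \<open>Polynomials in \<open>e\<^bsup>- t\<^esup>\<close> approximate a bump function around \<open>1\<close>, and the Lipschitz bound replaces
  \<open>D i t\<close> by \<open>D i 1\<close> under the bump.\<close>

lemma laplace_transform_pointwise:
  fixes D :: "'i \<Rightarrow> real \<Rightarrow> real"
  assumes bound: "\<And>i t. 0 < t \<Longrightarrow> \<bar>D i t\<bar> \<le> 1"
    and lip: "\<And>i t u. 0 < t \<Longrightarrow> 0 < u \<Longrightarrow> \<bar>D i t - D i u\<bar> \<le> L * \<bar>t - u\<bar>"
    and L: "0 \<le> L"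
    and lim: "\<And>k::nat. 0 < k \<Longrightarrow> ((\<lambda>i. LBINT t:{0<..}. exp (- (real k * t)) * D i t) \<longlongrightarrow> 0) F"
  shows "((\<lambda>i. D i 1) \<longlongrightarrow> 0) F"
proof (rule tendstoI)
  fix e :: real assume e: "0 < e"
  \<comment> \<open>Half the width of the bump: at most 1/2, so its support stays within (0, 2), and
    small enough that the Lipschitz error \<open>L * d\<close> is at most \<open>e / 3\<close>. The
    added \<open>e / 12\<close> gives a strict bound.\<close>
  define d where "d = min (1 / 2) (e / (3 * (L + 1)))"
  have d: "0 < d" "d \<le> 1 / 2" and Ld: "L * d < e / 3 + e / 12"
  proof -
    show "0 < d" using e L by (simp add: d_def)
    show "d \<le> 1 / 2" unfolding d_def by (rule min.cobounded1)
    have "L * d \<le> L * (e / (3 * (L + 1)))" using L by (intro mult_left_mono) (auto simp: d_def)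
    also have "\<dots> \<le> e / 3" using L e by (simp add: field_simps)
    finally show "L * d < e / 3 + e / 12" using e by simp
  qed
  define \<psi> where "\<psi> t = max 0 (1 - \<bar>t - 1\<bar> / d)" for t :: real
  have psi: "0 \<le> \<psi> t" "\<psi> t \<le> 1" for t using d by (auto simp: \<psi>_def)
  have psi0: "\<psi> t = 0" if "\<bar>t - 1\<bar> \<ge> d" for t using that d by (auto simp: \<psi>_def field_simps)
  have psi_cont: "continuous_on S \<psi>" for S unfolding \<psi>_def by (intro continuous_intros) (use d in auto)
  have D_meas: "set_borel_measurable lborel {0<..} (\<lambda>t. g t * D i t)" if "continuous_on UNIV g" for g i
  proof -
    have "continuous_on {0<..} (D i)"
    proof (rule lipschitz_on_continuous_on)
      show "L-lipschitz_on {0<..} (D i)" using lip L by (auto simp: lipschitz_on_def dist_real_def)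
    qed
    then have "continuous_on {0<..} (\<lambda>t. g t * D i t)"
      using that by (intro continuous_intros) (auto intro: continuous_on_subset)
    then show ?thesis
      unfolding set_borel_measurable_def
      using borel_measurable_continuous_on_indicator[of "{0<..}" "\<lambda>t. g t * D i t"] by simp
  qed
  have exp_int: "set_integrable lborel {0<..} (\<lambda>t. C * exp (- (1 * t)))" for C :: real
    using nn_integral_exp_Ioi(2)[of 1] by simp
  have D_int: "set_integrable lborel {0<..} (\<lambda>t. g t * D i t)"
    if "continuous_on UNIV g" "\<And>t. 0 < t \<Longrightarrow> \<bar>g t\<bar> \<le> C * exp (- t)" for g i C
  proof (rule set_integrable_bound[OF exp_int[of C] D_meas[OF that(1)]])
    show "AE t in lborel. t \<in> {0<..} \<longrightarrow> norm (g t * D i t) \<le> norm (C * exp (- (1 * t)))"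
    proof (intro AE_I2 impI)
      fix t :: real assume "t \<in> {0<..}"
      then have "\<bar>g t * D i t\<bar> \<le> (C * exp (- t)) * 1"
        unfolding abs_mult using that(2)[of t] bound[of t i] by (intro mult_mono) auto
      then show "norm (g t * D i t) \<le> norm (C * exp (- (1 * t)))" by simp
    qed
  qed
  define I where "I = (LBINT t:{0<..}. \<psi> t)"
  have psi_le: "\<bar>\<psi> t\<bar> \<le> exp 2 * exp (- t)" if "0 < t" for t
  proof (cases "t \<le> 2")
    case True
    then have "1 \<le> exp 2 * exp (- t)" by (simp add: mult_exp_exp)
    then show ?thesis using psi[of t] by simp
  next
    case False
    then show ?thesis using psi0[of t] d by simp
  qed
  have psi_int: "set_integrable lborel {0<..} \<psi>"
  proof (rule set_integrable_bound[OF exp_int[of "exp 2"]])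
    show "set_borel_measurable lborel {0<..} \<psi>"
      using borel_measurable_continuous_onI[OF psi_cont] by (simp add: set_borel_measurable_def)
    show "AE t in lborel. t \<in> {0<..} \<longrightarrow> norm (\<psi> t) \<le> norm (exp 2 * exp (- (1 * t)))"
      using psi_le by auto
  qed
  \<comment> \<open>The tent is at least 1/2 on the middle half of its support, an interval of
    length \<open>d\<close>.\<close>
  have I_pos: "0 < I"
  proof -
    have "d / 2 = (LBINT t:{1 - d / 2..1 + d / 2}. 1 / 2)"
      using d by (simp add: set_lebesgue_integral_def)
    also have "\<dots> = (LBINT t:{0<..}. indicator {1 - d / 2..1 + d / 2} t / 2)"
      unfolding set_lebesgue_integral_def using d
      by (intro Bochner_Integration.integral_cong) (auto simp: indicator_def)
    also have "\<dots> \<le> I"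
      unfolding I_def
    proof (rule set_integral_mono[OF _ psi_int])
      show "set_integrable lborel {0<..} (\<lambda>t. indicator {1 - d / 2..1 + d / 2} t / 2 :: real)"
      proof -
        have "integrable lborel (\<lambda>t. indicator {1 - d / 2..1 + d / 2} t / 2 :: real)"
          by (simp add: emeasure_lborel_Icc_eq integrable_real_indicator)
        then show ?thesis unfolding set_integrable_def by (rule integrable_mult_indicator[rotated]) simp
      qed
      fix t :: real
      show "indicator {1 - d / 2..1 + d / 2} t / 2 \<le> \<psi> t"
      proof (cases "t \<in> {1 - d / 2..1 + d / 2}")
        case True
        then have "1 - d / 2 \<le> t" "t \<le> 1 + d / 2" by auto
        then have "\<bar>t - 1\<bar> \<le> d / 2" unfolding abs_le_iff by linarith
        then have "\<bar>t - 1\<bar> / d \<le> 1 / 2" using d by (simp add: field_simps)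
        then have "1 / 2 \<le> 1 - \<bar>t - 1\<bar> / d" by linarith
        also have "\<dots> \<le> \<psi> t" unfolding \<psi>_def by (rule max.cobounded2)
        finally show ?thesis using True by simp
      qed (use psi in simp)
    qed
    finally show ?thesis using d by simp
  qed
  \<comment> \<open>A factor exp(- t) is split off before approximating, so the approximation of the
    bump contains only rates \<open>Suc k\<close>, all integrable on the half-line, and its error is
    bounded by a multiple of exp(- t). The cut at exp(-2) is harmless because the bump vanishes for
    \<open>t\<close> at least 2.\<close>
  define h where "h w = \<psi> (- ln (max w (exp (- 2)))) / max w (exp (- 2))" for w
  have m: "0 < max w (exp (- 2))" for w :: real by (simp add: less_max_iff_disj)
  have "continuous_on {0..1} h"
    unfolding h_def
    by (intro continuous_intros continuous_on_compose2[OF psi_cont[of UNIV]]) (use m in \<open>auto simp: less_imp_neq[symmetric]\<close>)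
  then obtain a K where a: "\<And>w. w \<in> {0..1} \<Longrightarrow> \<bar>h w - (\<Sum>k\<le>K. a k * w ^ k)\<bar> < e * I / 3"
    using polynomial_approximation_unit_interval[of h "e * I / 3"] e I_pos by auto
  have h_eq: "\<psi> t = exp (- t) * h (exp (- t))" if "0 < t" for t
  proof (cases "t \<le> 2")
    case True
    then have "max (exp (- t)) (exp (- 2)) = exp (- t)" by simp
    then show ?thesis by (simp add: h_def)
  next
    case False
    then have "max (exp (- t)) (exp (- 2)) = exp (- 2)" by simp
    then show ?thesis using psi0[of t] psi0[of 2] False d by (simp add: h_def)
  qed
  define p where "p t = (\<Sum>k\<le>K. a k * exp (- (real (Suc k) * t)))" for t
  have approx: "\<bar>\<psi> t - p t\<bar> \<le> (e * I / 3) * exp (- t)" if "0 < t" for t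
  proof -
    have "p t = exp (- t) * (\<Sum>k\<le>K. a k * exp (- t) ^ k)"
      unfolding p_def sum_distrib_left exp_power_nat
      by (intro sum.cong refl) (simp add: mult_exp_exp algebra_simps)
    then have "\<psi> t - p t = exp (- t) * (h (exp (- t)) - (\<Sum>k\<le>K. a k * exp (- t) ^ k))"
      using h_eq[OF that] by (simp add: right_diff_distrib)
    also have "\<bar>\<dots>\<bar> \<le> exp (- t) * (e * I / 3)"
      unfolding abs_mult using a[of "exp (- t)"] that by (intro mult_mono) auto
    finally show ?thesis by (simp add: mult.commute)
  qed
  have k_int: "set_integrable lborel {0<..} (\<lambda>t. exp (- (real (Suc k) * t)) * D i t)" for k i
    by (rule D_int[where C = 1]) (auto intro!: continuous_intros)
  have ak_int: "set_integrable lborel {0<..} (\<lambda>t. a k * (exp (- (real (Suc k) * t)) * D i t))" for k i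
    by (intro set_integrable_mult_right k_int)
  have p_eq: "p t * D i t = (\<Sum>k\<le>K. a k * (exp (- (real (Suc k) * t)) * D i t))" for i t
    unfolding p_def sum_distrib_right by (rule sum.cong) (simp_all only: mult.assoc)
  have fs: "set_integrable lborel {0<..} (\<lambda>t. p t * D i t) \<and> (LBINT t:{0<..}. p t * D i t)
      = (\<Sum>k\<le>K. LBINT t:{0<..}. a k * (exp (- (real (Suc k) * t)) * D i t))" for i
    unfolding p_eq by (rule set_integral_finite_sum[OF finite_atMost ak_int])
  have pD: "set_integrable lborel {0<..} (\<lambda>t. p t * D i t)" for i using fs by blast
  have sum_eq: "(LBINT t:{0<..}. p t * D i t) = (\<Sum>k\<le>K. a k * (LBINT t:{0<..}. exp (- (real (Suc k) * t)) * D i t))" for i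
  proof -
    have "(LBINT t:{0<..}. p t * D i t) = (\<Sum>k\<le>K. LBINT t:{0<..}. a k * (exp (- (real (Suc k) * t)) * D i t))"
      using fs by blast
    also have "\<dots> = (\<Sum>k\<le>K. a k * (LBINT t:{0<..}. exp (- (real (Suc k) * t)) * D i t))"
      by (intro sum.cong refl set_integral_mult_right)
    finally show ?thesis .
  qed
  have "((\<lambda>i. LBINT t:{0<..}. p t * D i t) \<longlongrightarrow> (\<Sum>k\<le>K. a k * 0)) F"
    unfolding sum_eq by (intro tendsto_sum tendsto_mult tendsto_const lim) simp
  then have "eventually (\<lambda>i. dist (LBINT t:{0<..}. p t * D i t) 0 < e * I / 12) F"
    using e I_pos by (intro tendstoD) auto
  then show "eventually (\<lambda>i. dist (D i 1) 0 < e) F"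
  proof eventually_elim
    case (elim i)
    have psiD: "set_integrable lborel {0<..} (\<lambda>t. \<psi> t * D i t)"
      by (rule D_int[OF psi_cont psi_le])
    have psi1: "set_integrable lborel {0<..} (\<lambda>t. \<psi> t * D i 1)"
      using psi_int by simp
    have 1: "\<bar>(LBINT t:{0<..}. \<psi> t * D i t) - (LBINT t:{0<..}. p t * D i t)\<bar> \<le> e * I / 3"
    proof -
      have "(LBINT t:{0<..}. \<psi> t * D i t) - (LBINT t:{0<..}. p t * D i t) = (LBINT t:{0<..}. \<psi> t * D i t - p t * D i t)"
        by (rule set_integral_diff(2)[OF psiD pD, symmetric])
      also have "\<bar>\<dots>\<bar> \<le> (LBINT t:{0<..}. (e * I / 3) * exp (- (1 * t)))"
        unfolding set_lebesgue_integral_def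
      proof (rule abs_integral_le)
        show "integrable lborel (\<lambda>t. indicator {0<..} t *\<^sub>R (\<psi> t * D i t - p t * D i t))"
          using set_integral_diff(1)[OF psiD pD] by (simp add: set_integrable_def)
        show "integrable lborel (\<lambda>t. indicator {0<..} t *\<^sub>R ((e * I / 3) * exp (- (1 * t))))"
          using exp_int[of "e * I / 3"] by (simp add: set_integrable_def)
        fix t :: real
        show "\<bar>indicator {0<..} t *\<^sub>R (\<psi> t * D i t - p t * D i t)\<bar> \<le> indicator {0<..} t *\<^sub>R ((e * I / 3) * exp (- (1 * t)))"
        proof (cases "0 < t")
          case True
          have "\<bar>(\<psi> t - p t) * D i t\<bar> \<le> ((e * I / 3) * exp (- t)) * 1"
            unfolding abs_mult using approx[OF True] bound[OF True, of i] e I_pos by (intro mult_mono) auto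
          then show ?thesis using True by (simp add: left_diff_distrib)
        qed simp
      qed
      also have "\<dots> = e * I / 3"
        using nn_integral_exp_Ioi(3)[of 1] by simp
      finally show ?thesis .
    qed
    have 2: "\<bar>(LBINT t:{0<..}. \<psi> t * D i t) - (LBINT t:{0<..}. \<psi> t * D i 1)\<bar> \<le> I * (L * d)"
    proof -
      have "(LBINT t:{0<..}. \<psi> t * D i t) - (LBINT t:{0<..}. \<psi> t * D i 1) = (LBINT t:{0<..}. \<psi> t * D i t - \<psi> t * D i 1)"
        by (rule set_integral_diff(2)[OF psiD psi1, symmetric])
      also have "\<bar>\<dots>\<bar> \<le> (LBINT t:{0<..}. \<psi> t * (L * d))"
        unfolding set_lebesgue_integral_def
      proof (rule abs_integral_le)
        show "integrable lborel (\<lambda>t. indicator {0<..} t *\<^sub>R (\<psi> t * D i t - \<psi> t * D i 1))"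
          using set_integral_diff(1)[OF psiD psi1] by (simp add: set_integrable_def)
        have "set_integrable lborel {0<..} (\<lambda>t. \<psi> t * (L * d))" using psi_int by simp
        then show "integrable lborel (\<lambda>t. indicator {0<..} t *\<^sub>R (\<psi> t * (L * d)))" by (simp add: set_integrable_def)
        fix t :: real
        show "\<bar>indicator {0<..} t *\<^sub>R (\<psi> t * D i t - \<psi> t * D i 1)\<bar> \<le> indicator {0<..} t *\<^sub>R (\<psi> t * (L * d))"
        proof (cases "0 < t \<and> \<bar>t - 1\<bar> < d")
          case True
          have "\<bar>D i t - D i 1\<bar> \<le> L * \<bar>t - 1\<bar>" using True by (intro lip) auto
          also have "\<dots> \<le> L * d" using True L by (intro mult_left_mono) auto
          finally have "\<psi> t * \<bar>D i t - D i 1\<bar> \<le> \<psi> t * (L * d)" by (rule mult_left_mono[OF _ psi(1)])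
          moreover have "\<psi> t * D i t - \<psi> t * D i 1 = \<psi> t * (D i t - D i 1)" by (simp only: right_diff_distrib)
          ultimately show ?thesis using True psi(1)[of t] by (simp add: abs_mult)
        next
          case False
          then show ?thesis using psi0[of t] by (auto simp: indicator_def)
        qed
      qed
      also have "\<dots> = I * (L * d)" by (simp add: I_def)
      finally show ?thesis .
    qed
    have 3: "(LBINT t:{0<..}. \<psi> t * D i 1) = I * D i 1" by (simp add: I_def)
    \<comment> \<open>Error budget in units of \<open>e * I\<close>: 1/3 for the approximation, 1/3
      + 1/12 for freezing \<open>D\<close> at time 1, and 1/12 for the transforms, 5/6 in
      total.\<close>
    have "I * (L * d) \<le> I * (e / 3 + e / 12)" using Ld I_pos by (intro mult_left_mono) auto
    also have "I * (e / 3 + e / 12) = e * I / 3 + e * I / 12" by (simp add: algebra_simps)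
    finally have "\<bar>I * D i 1\<bar> < e * I"
      using 1 2 3 elim mult_pos_pos[OF e I_pos] unfolding dist_real_def by linarith
    then have "I * \<bar>D i 1\<bar> < I * e" using I_pos by (simp add: abs_mult mult.commute)
    then show ?case using I_pos by (simp add: dist_real_def)
  qed
qed

section \<open>Convergence of the occupation time\<close>

lemma path_continuous_time_above:
  assumes "v \<noteq> 0"
  shows "path_continuous t (\<lambda>n. time_above y v n t)"
  using assms time_above_tendsto by (auto simp: path_continuous_def)

lemma time_above_measurable:
  fixes N :: "real \<Rightarrow> 'a \<Rightarrow> nat"
  assumes "v \<noteq> 0" "0 \<le> t"
    and "\<And>u. 0 \<le> u \<Longrightarrow> N u \<in> measurable M (count_space UNIV)"
    and "\<And>\<omega>. \<omega> \<in> space M \<Longrightarrow> counting_path (\<lambda>u. N u \<omega>)"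
    and "\<And>\<omega>. \<omega> \<in> space M \<Longrightarrow> right_continuous_path (\<lambda>u. N u \<omega>)"
  shows "(\<lambda>\<omega>. time_above y v (\<lambda>u. N u \<omega>) t) \<in> borel_measurable M"
  by (rule path_functional_measurable[OF path_continuous_time_above[OF assms(1)] assms(2-5)])

lemma poisson_time_above_measurable:
  assumes "poisson_process M rate N" "v \<noteq> 0" "0 \<le> t"
  shows "(\<lambda>\<omega>. time_above y v (\<lambda>u. N u \<omega>) t) \<in> borel_measurable M"
  by (rule time_above_measurable[OF assms(2,3) poisson_processD(2,4,5)[OF assms(1)]])

lemma laplace_mean_exp_time_above:
  fixes s \<mu> n y v :: real and M :: "'a measure" and N :: "real \<Rightarrow> 'a \<Rightarrow> nat"
  assumes P: "poisson_process M n N" and n: "0 < n" and s: "0 < s" and mu: "0 < \<mu>" and v: "v = 1 \<or> v = - 1"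
  defines "G \<equiv> \<lambda>t. \<integral>\<omega>. exp (- (\<mu> * time_above y v (\<lambda>u. N u \<omega>) t)) \<partial>M"
  shows "set_integrable lborel {0<..} (\<lambda>t. exp (- (s * t)) * G t)"
    "(LBINT t:{0<..}. exp (- (s * t)) * G t) = solution n s (s + \<mu>) v y"
proof -
  define K where "K = 1 / s + \<bar>coeff_below n s (s + \<mu>)\<bar> + \<bar>coeff_above n s (s + \<mu>)\<bar>"
  define L where "L = \<bar>coeff_below n s (s + \<mu>)\<bar> * decay n s + \<bar>coeff_above n s (s + \<mu>)\<bar> * decay n (s + \<mu>)"
  have r: "0 < s + \<mu>" using s mu by simp
  interpret prob_space M by (rule poisson_processD(1)[OF P])
  interpret poisson_potential s \<mu> n K L y v "solution n s (s + \<mu>)" M N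
  proof (unfold_locales, goal_cases)
    case 4
    show ?case using s by (simp add: K_def)
  next
    case 5
    show ?case using n s r by (simp add: L_def decay_def)
  next
    case (7 V x)
    show ?case unfolding K_def by (rule solution_bound[OF n s r])
  next
    case (8 V x z)
    show ?case unfolding L_def by (rule solution_lipschitz[OF n s r])
  next
    case (9 V x)
    show ?case using solution_ode[OF n s r 9(1,2)] by simp
  qed (use n s mu v P in auto)
  have eq: "mean_discount = (\<lambda>t. exp (- (s * t)) * G t)"
    by (simp add: fun_eq_iff mean_discount_eq G_def)
  show "set_integrable lborel {0<..} (\<lambda>t. exp (- (s * t)) * G t)"
    "(LBINT t:{0<..}. exp (- (s * t)) * G t) = solution n s (s + \<mu>) v y"
    using laplace_mean_discount by (simp_all add: eq)
qed

text \<open>The time above 0 is 1-Lipschitz in \<open>t\<close> on every path, so the mean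
  exponentials are Lipschitz with constant \<open>\<mu>\<close> whatever the index and its
  probability space. Together with the same constant for \<open>passage_gap\<close> this is the
  uniform bound that inversion requires.\<close>

lemma mean_exp_time_above_tendsto:
  fixes M :: "'i \<Rightarrow> 'a measure" and n y :: "'i \<Rightarrow> real"
  assumes P: "\<And>i. poisson_process (M i) (n i) (N i)" and n: "\<And>i. 0 < n i" and v: "v = 1 \<or> v = - 1"
    and n_lim: "filterlim n at_top F" and y_lim: "((\<lambda>i. y i * sqrt (n i)) \<longlongrightarrow> a) F"
    and a: "a \<le> 0" and mu: "0 < \<mu>"
  shows "((\<lambda>i. \<integral>\<omega>. exp (- (\<mu> * time_above (y i) v (\<lambda>u. N i u \<omega>) 1)) \<partial>M i) \<longlongrightarrow> 1 - passage_gap (- a) \<mu> 1) F"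
proof -
  define G where "G i t = (\<integral>\<omega>. exp (- (\<mu> * time_above (y i) v (\<lambda>u. N i u \<omega>) t)) \<partial>M i)" for i t
  define D where "D i t = G i t - (1 - passage_gap (- a) \<mu> t)" for i t
  have a': "0 \<le> - a" and mu0: "0 \<le> \<mu>" and v0: "v \<noteq> 0" using a mu v by auto
  have int: "integrable (M i) (\<lambda>\<omega>. exp (- (\<mu> * time_above (y i) v (\<lambda>u. N i u \<omega>) t)))" if t: "0 \<le> t" for i t
  proof -
    interpret prob_space "M i" by (rule poisson_processD(1)[OF P])
    show ?thesis
      by (rule integrable_const_bound[where B = 1])
         (use poisson_time_above_measurable[OF P v0 t] mu0 time_above_bounds(1)[OF poisson_processD(4)[OF P] t] in auto)
  qed
  have G_bounds: "0 \<le> G i t" "G i t \<le> 1" if t: "0 \<le> t" for i t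
  proof -
    interpret prob_space "M i" by (rule poisson_processD(1)[OF P])
    show "0 \<le> G i t" unfolding G_def by (rule integral_nonneg_AE) simp
    have "G i t \<le> (\<integral>\<omega>. 1 \<partial>M i)"
      unfolding G_def
      by (rule integral_mono[OF int[OF t]])
         (use mu0 time_above_bounds(1)[OF poisson_processD(4)[OF P] t] in auto)
    then show "G i t \<le> 1" by (simp add: prob_space)
  qed
  have G_lip: "\<bar>G i t - G i u\<bar> \<le> \<mu> * \<bar>t - u\<bar>" if t: "0 \<le> t" "0 \<le> u" for i t u
  proof -
    interpret prob_space "M i" by (rule poisson_processD(1)[OF P])
    let ?A = "\<lambda>\<omega> t. time_above (y i) v (\<lambda>u. N i u \<omega>) t"
    have "G i t - G i u = (\<integral>\<omega>. exp (- (\<mu> * ?A \<omega> t)) - exp (- (\<mu> * ?A \<omega> u)) \<partial>M i)"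
      unfolding G_def by (rule Bochner_Integration.integral_diff[symmetric]) (intro int t)+
    also have "\<bar>\<dots>\<bar> \<le> (\<integral>\<omega>. \<mu> * \<bar>t - u\<bar> \<partial>M i)"
    proof (rule abs_integral_le)
      fix \<omega> assume \<omega>: "\<omega> \<in> space (M i)"
      note path = poisson_processD(4)[OF P \<omega>]
      have "\<bar>exp (- (\<mu> * ?A \<omega> t)) - exp (- (\<mu> * ?A \<omega> u))\<bar> \<le> \<bar>\<mu> * ?A \<omega> t - \<mu> * ?A \<omega> u\<bar>"
        by (rule exp_minus_lipschitz) (use mu0 time_above_bounds(1)[OF path] t in auto)
      also have "\<dots> = \<mu> * \<bar>?A \<omega> t - ?A \<omega> u\<bar>"
        using mu0 unfolding right_diff_distrib[symmetric] by (simp add: abs_mult)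
      also have "\<dots> \<le> \<mu> * \<bar>t - u\<bar>"
      proof (rule mult_left_mono[OF _ mu0])
        show "\<bar>?A \<omega> t - ?A \<omega> u\<bar> \<le> \<bar>t - u\<bar>"
          using time_above_diff_bounds[OF path, of t u] time_above_diff_bounds[OF path, of u t] t
          by (cases "t \<le> u") (auto simp: abs_le_iff)
      qed
      finally show "\<bar>exp (- (\<mu> * ?A \<omega> t)) - exp (- (\<mu> * ?A \<omega> u))\<bar> \<le> \<mu> * \<bar>t - u\<bar>" .
    qed (intro Bochner_Integration.integrable_diff int t, simp)
    finally show ?thesis by (simp add: prob_space)
  qed
  have "((\<lambda>i. D i 1) \<longlongrightarrow> 0) F"
  proof (rule laplace_transform_pointwise[where L = "2 * \<mu>"])
    show "\<bar>D i t\<bar> \<le> 1" if "0 < t" for i t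
      using G_bounds[of t i] passage_gap_bounds[OF a' mu0, of t] that by (auto simp: D_def abs_le_iff)
    show "\<bar>D i t - D i u\<bar> \<le> 2 * \<mu> * \<bar>t - u\<bar>" if "0 < t" "0 < u" for i t u
      using G_lip[of t u i] passage_gap_lipschitz[OF a' mu0, of t u] that by (auto simp: D_def)
    show "0 \<le> 2 * \<mu>" using mu0 by simp
    fix k :: nat assume "0 < k"
    then have s: "0 < real k" by simp
    have r: "0 < real k + \<mu>" using s mu by simp
    \<comment> \<open>The transform of \<open>1 - passage_gap (- a) \<mu>\<close> at
      \<open>s = k\<close>, and at the same time the limit of \<open>solution\<close> with killing
      rates \<open>k\<close> and \<open>k + \<mu>\<close>.\<close>
    let ?c = "1 / real k - exp (- ((- a) * sqrt (2 * real k))) * (1 / real k - 1 / sqrt (real k * (real k + \<mu>)))"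
    have eq: "(LBINT t:{0<..}. exp (- (real k * t)) * D i t) = solution (n i) (real k) (real k + \<mu>) v (y i) - ?c" for i
    proof -
      note g = laplace_mean_exp_time_above[OF P n s mu v, of i "y i", folded G_def]
      note e = nn_integral_exp_Ioi(2,3)[OF s] and h = laplace_passage_gap[OF a' mu s]
      have "(\<lambda>t. exp (- (real k * t)) * D i t) = (\<lambda>t. exp (- (real k * t)) * G i t
          - (exp (- (real k * t)) - exp (- (real k * t)) * passage_gap (- a) \<mu> t))"
        by (simp add: D_def fun_eq_iff algebra_simps)
      then show ?thesis
        using set_integral_diff(2)[OF g(1) set_integral_diff(1)[OF e(1) h(1)]]
          set_integral_diff(2)[OF e(1) h(1)] g(2) e(2) h(2) by simp
    qed
    have "((\<lambda>i. solution (n i) (real k) (real k + \<mu>) v (y i) - ?c) \<longlongrightarrow> ?c - ?c) F"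
      by (intro tendsto_diff tendsto_const solution_tendsto[OF s r a n_lim y_lim])
    then show "((\<lambda>i. LBINT t:{0<..}. exp (- (real k * t)) * D i t) \<longlongrightarrow> 0) F" by (simp add: eq)
  qed
  from tendsto_add[OF this tendsto_const[of "1 - passage_gap (- a) \<mu> 1"]]
  show ?thesis by (simp add: D_def G_def)
qed

lemma expectation_time_above_tendsto:
  fixes M :: "'i \<Rightarrow> 'a measure" and n y :: "'i \<Rightarrow> real" and f :: "real \<Rightarrow> real"
  assumes P: "\<And>i. poisson_process (M i) (n i) (N i)" and n: "\<And>i. 0 < n i" and v: "v = 1 \<or> v = - 1"
    and n_lim: "filterlim n at_top F" and y_lim: "((\<lambda>i. y i * sqrt (n i)) \<longlongrightarrow> a) F"
    and a: "a \<le> 0" and Q: "prob_space Q" and Y: "is_limit_variable Q (- a) Y" and f: "continuous_on UNIV f"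
  shows "((\<lambda>i. \<integral>\<omega>. f (time_above (y i) v (\<lambda>u. N i u \<omega>) 1) \<partial>M i) \<longlongrightarrow> (\<integral>\<omega>. f (Y \<omega>) \<partial>Q)) F"
proof (rule exponential_moments_determine_limit[where X = "\<lambda>i \<omega>. time_above (y i) v (\<lambda>u. N i u \<omega>) 1" and Z = Y and f = f])
  show "(\<lambda>\<omega>. time_above (y i) v (\<lambda>u. N i u \<omega>) 1) \<in> borel_measurable (M i)" for i
    by (rule poisson_time_above_measurable[OF P]) (use v in auto)
  show "Y \<in> borel_measurable Q" "\<And>\<omega>. \<omega> \<in> space Q \<Longrightarrow> Y \<omega> \<in> {0..1}"
    using Y by (simp_all add: is_limit_variable_def)
  show "time_above (y i) v (\<lambda>u. N i u \<omega>) 1 \<in> {0..1}" if "\<omega> \<in> space (M i)" for i \<omega>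
    using time_above_bounds[OF poisson_processD(4)[OF P that], of 1] by simp
  show "((\<lambda>i. \<integral>\<omega>. exp (- (real k * time_above (y i) v (\<lambda>u. N i u \<omega>) 1)) \<partial>M i) \<longlongrightarrow> (\<integral>\<omega>. exp (- (real k * Y \<omega>)) \<partial>Q)) F"
    if "0 < k" for k :: nat
    using mean_exp_time_above_tendsto[OF P n v n_lim y_lim a, of "real k"] that a
      limit_variable_laplace[OF _ _ Y Q, of "real k"] by simp
qed (use Q f poisson_processD(1)[OF P] in auto)

lemma time_above_converges:
  fixes M :: "'i \<Rightarrow> 'a measure" and n y :: "'i \<Rightarrow> real"
  assumes P: "\<And>i. poisson_process (M i) (n i) (N i)" and n: "\<And>i. 0 < n i" and v: "v = 1 \<or> v = - 1"
    and n_lim: "filterlim n at_top F" and y_lim: "((\<lambda>i. y i * sqrt (n i)) \<longlongrightarrow> a) F"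
    and a: "a \<le> 0" and Q: "prob_space Q" and Y: "is_limit_variable Q (- a) Y"
  shows "converges_in_distribution (\<lambda>i. distr (M i) borel (\<lambda>\<omega>. time_above (y i) v (\<lambda>u. N i u \<omega>) 1)) (distr Q borel Y) F"
proof (rule converges_in_distributionI)
  show "(\<lambda>\<omega>. time_above (y i) v (\<lambda>u. N i u \<omega>) 1) \<in> borel_measurable (M i)" for i
    by (rule poisson_time_above_measurable[OF P]) (use v in auto)
  show "Y \<in> borel_measurable Q" using Y by (simp add: is_limit_variable_def)
qed (use expectation_time_above_tendsto[OF assms] Q poisson_processD(1)[OF P] in auto)

text \<open>Reversing the signs of start and velocity turns \<open>a\<close> into \<open>- a\<close>
  and the time above into one minus itself, so the previous case is applied to the test function x
  -> f(1 - x).\<close>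

lemma time_above_converges_reflected:
  fixes M :: "'i \<Rightarrow> 'a measure" and n y :: "'i \<Rightarrow> real"
  assumes P: "\<And>i. poisson_process (M i) (n i) (N i)" and n: "\<And>i. 0 < n i" and v: "v = 1 \<or> v = - 1"
    and n_lim: "filterlim n at_top F" and y_lim: "((\<lambda>i. y i * sqrt (n i)) \<longlongrightarrow> a) F"
    and a: "0 \<le> a" and Q: "prob_space Q" and Y: "is_limit_variable Q a Y"
  shows "converges_in_distribution (\<lambda>i. distr (M i) borel (\<lambda>\<omega>. time_above (y i) v (\<lambda>u. N i u \<omega>) 1))
    (distr Q borel (\<lambda>\<omega>. 1 - Y \<omega>)) F"
proof (rule converges_in_distributionI)
  show "(\<lambda>\<omega>. time_above (y i) v (\<lambda>u. N i u \<omega>) 1) \<in> borel_measurable (M i)" for i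
    by (rule poisson_time_above_measurable[OF P]) (use v in auto)
  have "Y \<in> borel_measurable Q" using Y by (simp add: is_limit_variable_def)
  then show "(\<lambda>\<omega>. 1 - Y \<omega>) \<in> borel_measurable Q" by measurable
  fix f :: "real \<Rightarrow> real" assume f: "continuous_on UNIV f"
  have v': "- v = 1 \<or> - v = - 1" and v0: "v \<noteq> 0" using v by auto
  have y': "((\<lambda>i. - y i * sqrt (n i)) \<longlongrightarrow> - a) F" using tendsto_minus[OF y_lim] by simp
  have "((\<lambda>i. \<integral>\<omega>. f (1 - time_above (- y i) (- v) (\<lambda>u. N i u \<omega>) 1) \<partial>M i) \<longlongrightarrow> (\<integral>\<omega>. f (1 - Y \<omega>) \<partial>Q)) F"
    by (rule expectation_time_above_tendsto[OF P n v' n_lim y' _ Q, where f = "\<lambda>x. f (1 - x)"])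
       (use a Y in \<open>auto intro!: continuous_intros continuous_on_compose2[OF f]\<close>)
  moreover have "(\<integral>\<omega>. f (1 - time_above (- y i) (- v) (\<lambda>u. N i u \<omega>) 1) \<partial>M i)
      = (\<integral>\<omega>. f (time_above (y i) v (\<lambda>u. N i u \<omega>) 1) \<partial>M i)" for i
    by (rule Bochner_Integration.integral_cong)
       (use time_above_reflect[OF poisson_processD(4)[OF P] v0, where t = 1] in auto)
  ultimately show "((\<lambda>i. \<integral>\<omega>. f (time_above (y i) v (\<lambda>u. N i u \<omega>) 1) \<partial>M i) \<longlongrightarrow> (\<integral>\<omega>. f (1 - Y \<omega>) \<partial>Q)) F"
    by simp
qed (use Q poisson_processD(1)[OF P] in auto)

section \<open>Scaling and the random initial velocity\<close>

lemma set_lborel_integral_rescale: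
  fixes f :: "real \<Rightarrow> real"
  assumes "0 < T"
  shows "(LBINT u:{0..t}. f u) = T * (LBINT r:{0..t / T}. f (r * T))"
proof -
  have i: "indicator {0..t} (0 + T * r) = (indicator {0..t / T} r :: real)" for r
    using assms by (auto simp: indicator_def zero_le_mult_iff field_simps)
  have "(LBINT u:{0..t}. f u) = \<bar>T\<bar> *\<^sub>R (LBINT r. indicator {0..t} (0 + T * r) *\<^sub>R f (0 + T * r))"
    unfolding set_lebesgue_integral_def using assms by (intro lborel_integral_real_affine) simp
  then show ?thesis using assms unfolding i set_lebesgue_integral_def by (simp add: mult.commute)
qed

lemma telegraph_rescale:
  assumes "0 < T"
  shows "telegraph (w * c) n (r * T) = c * T * telegraph w (\<lambda>u. n (u * T)) r"
  unfolding telegraph_def using assms by (subst set_lborel_integral_rescale[OF assms]) simp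

lemma occupation_rescale:
  assumes T: "0 < T" and c: "0 < c"
  shows "occupation T x (telegraph (w * c) n) = time_above (x / (c * T)) w (\<lambda>u. n (u * T)) 1"
proof -
  have "heaviside (x + c * T * z) = heaviside (x / (c * T) + z)" for z
  proof -
    have "x + c * T * z = (c * T) * (x / (c * T) + z)" using T c by (simp add: field_simps)
    moreover have "0 < c * T" using T c by simp
    ultimately show ?thesis unfolding heaviside_def by (simp only: mult_less_cancel_left_pos[of "c * T" 0, simplified])
  qed
  then show ?thesis
    unfolding occupation_def time_above_def using T
    by (subst set_lborel_integral_rescale[OF T]) (simp add: telegraph_rescale[OF T])
qed

lemma poisson_process_rescale:
  assumes P: "poisson_process M rate N" and T: "0 < T"
  shows "poisson_process M (rate * T) (\<lambda>u. N (u * T))"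
  unfolding poisson_process_def
proof (intro conjI allI impI ballI)
  show "prob_space M" by (rule poisson_processD(1)[OF P])
  show "N (t * T) \<in> M \<rightarrow>\<^sub>M count_space UNIV" if "0 \<le> t" for t
    using that T by (intro poisson_processD(2)[OF P]) simp
  show "N (0 * T) \<omega> = 0" if "\<omega> \<in> space M" for \<omega>
    using poisson_processD(3)[OF P that] by simp
  show "N (s * T) \<omega> \<le> N (t * T) \<omega>" if "\<omega> \<in> space M" "0 \<le> s" "s \<le> t" for \<omega> s t
    using counting_path_mono[OF poisson_processD(4)[OF P that(1)], of "s * T" "t * T"] that T
    by (simp add: mult_right_mono)
  show "continuous (at_right t) (\<lambda>s. real (N (s * T) \<omega>))" if "\<omega> \<in> space M" "0 \<le> t" for \<omega> t
  proof -
    have "((\<lambda>s. real (N s \<omega>)) \<longlongrightarrow> real (N (t * T) \<omega>)) (at_right (t * T))"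
      using poisson_processD(5)[OF P that(1)] that(2) T
      by (simp add: right_continuous_path_def continuous_within)
    moreover have "filterlim (\<lambda>s. s * T) (at_right (t * T)) (at_right t)"
      unfolding filterlim_at
    proof (rule conjI)
      show "\<forall>\<^sub>F s in at_right t. s * T \<in> {t * T<..} \<and> s * T \<noteq> t * T"
        using eventually_at_right_less[of t] by eventually_elim (use T in auto)
      show "((\<lambda>s. s * T) \<longlongrightarrow> t * T) (at_right t)" by (intro tendsto_intros)
    qed
    ultimately show ?thesis unfolding continuous_within by (rule filterlim_compose)
  qed
  show "prob_space.indep_vars M (\<lambda>_. count_space UNIV) (\<lambda>i \<omega>. N (t (Suc i) * T) \<omega> - N (t i * T) \<omega>) {..<n}"
    if "0 \<le> t 0" "\<forall>i<n. t i < t (Suc i)" for n and t :: "nat \<Rightarrow> real"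
    by (rule poisson_processD(7)[OF P, of "\<lambda>i. t i * T"]) (use that T in auto)
  show "distr M (count_space UNIV) (\<lambda>\<omega>. N (t * T) \<omega> - N (s * T) \<omega>) = measure_pmf (poisson_pmf (rate * T * (t - s)))"
    if "0 \<le> s" "s < t" for s t
    using poisson_processD(6)[OF P, of "s * T" "t * T"] that T by (simp add: algebra_simps)
qed

section \<open>Random initial velocity\<close>

lemma time_above_velocity_measurable:
  assumes "counting_path n"
  shows "(\<lambda>v. time_above y v n t) \<in> borel_measurable borel"
proof -
  define S where "S r = telegraph 1 n (max 0 r)" for r
  have [measurable]: "S \<in> borel_measurable borel"
    unfolding S_def by (rule telegraph_max_measurable[OF assms])
  have "time_above y v n t = (\<integral>r. indicator {0..t} r *\<^sub>R heaviside (y + v * S r) \<partial>lborel)" for v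
    unfolding time_above_def set_lebesgue_integral_def
    by (rule Bochner_Integration.integral_cong) (auto simp: indicator_def S_def telegraph_def)
  moreover have "(\<lambda>v. \<integral>r. indicator {0..t} r *\<^sub>R heaviside (y + v * S r) \<partial>lborel) \<in> borel_measurable borel"
    by measurable
  ultimately show ?thesis by simp
qed

text \<open>A random velocity makes the path functional itself random. On a grid, however, the path
  takes countably many values; for each of them the time above is a Borel function of the velocity,
  and the grid limit finishes.\<close>

lemma random_velocity_measurable:
  fixes N :: "real \<Rightarrow> 'a \<Rightarrow> nat"
  assumes P: "poisson_process M rate N" and W: "W \<in> borel_measurable M" and t: "0 \<le> t"
  shows "(\<lambda>\<omega>. time_above y (W \<omega>) (\<lambda>u. N u \<omega>) t) \<in> borel_measurable M"
proof (rule borel_measurable_LIMSEQ_real)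
  define p where "p m \<omega> = (\<lambda>u. N (grid_time t m (grid_index t m u)) \<omega>)" for m \<omega>
  have conv: "paths_converge t (\<lambda>m. p m \<omega>) (\<lambda>u. N u \<omega>)" if "\<omega> \<in> space M" for \<omega>
    unfolding p_def using poisson_processD(4,5)[OF P that] t
    by (intro grid_paths_converge) (auto simp: right_continuous_path_def)
  show "(\<lambda>m. time_above y (W \<omega>) (p m \<omega>) t) \<longlonglongrightarrow> time_above y (W \<omega>) (\<lambda>u. N u \<omega>) t" if "\<omega> \<in> space M" for \<omega>
  \<comment> \<open>At zero velocity the zero set may be all of the time axis, so convergence of the
    time above cannot be quoted; but the path then stands still and the sequence is
    constant.\<close>
  proof (cases "W \<omega> = 0")
    case True
    then show ?thesis by (simp add: time_above_def telegraph_def)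
  next
    case False
    then show ?thesis by (rule time_above_tendsto[OF conv[OF that]])
  qed
  fix m
  let ?r = "\<lambda>\<omega>. \<lambda>i\<in>{..Suc m}. N (grid_time t m i) \<omega>"
  let ?I = "PiE {..Suc m} (\<lambda>_. UNIV) :: (nat \<Rightarrow> nat) set"
  \<comment> \<open>Tuples that are not nondecreasing are sent to 0, since measurability in the
    velocity is available for counting paths; no sample point produces such a tuple.\<close>
  define f where "f x \<omega> = (if counting_path (\<lambda>u. x (grid_index t m u)) then time_above y (W \<omega>) (\<lambda>u. x (grid_index t m u)) t else 0)"
    for x :: "nat \<Rightarrow> nat" and \<omega>
  have "?r \<in> measurable M (PiM {..Suc m} (\<lambda>_. count_space UNIV))"
    using poisson_processD(2)[OF P] t grid_time_bounds by (intro measurable_restrict) auto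
  then have r: "?r \<in> measurable M (count_space ?I)"
    by (simp add: count_space_PiM_finite)
  have "(\<lambda>\<omega>. f (?r \<omega>) \<omega>) \<in> borel_measurable M"
  proof (rule measurable_compose_countable'[OF _ r])
    show "f x \<in> borel_measurable M" for x
      using measurable_compose[OF W time_above_velocity_measurable] by (cases "counting_path (\<lambda>u. x (grid_index t m u))") (simp_all add: f_def[abs_def])
    show "countable ?I" by (rule countable_PiE) auto
  qed
  moreover have "f (?r \<omega>) \<omega> = time_above y (W \<omega>) (p m \<omega>) t" if "\<omega> \<in> space M" for \<omega>
    using conv[OF that] grid_index_le unfolding f_def p_def paths_converge_def by simp
  ultimately show "(\<lambda>\<omega>. time_above y (W \<omega>) (p m \<omega>) t) \<in> borel_measurable M"
    by (simp cong: measurable_cong)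
qed

lemma telegraph_dataD:
  assumes "telegraph_data M rate c N V"
  shows "poisson_process M rate N" "V \<in> borel_measurable M"
    "measure M {\<omega> \<in> space M. V \<omega> = c} = 1 / 2" "measure M {\<omega> \<in> space M. V \<omega> = - c} = 1 / 2"
    "prob_space.indep_set M (sets (vimage_algebra (space M) V borel))
       (sets (vimage_algebra (space M) (\<lambda>\<omega>. \<lambda>t\<in>{0..}. N t \<omega>) (PiM {0..} (\<lambda>_. count_space UNIV))))"
  using assms by (auto simp: telegraph_data_def)

text \<open>Splitting over the two values of the velocity and using independence, the law is the
  average of the two conditional laws exactly and for every \<open>T\<close>, so the unconditional
  limit needs no analysis of its own.\<close>

lemma cdf_random_velocity:
  assumes data: "telegraph_data M rate c N V" and T: "0 < T" and c: "0 < c"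
  shows "cdf (distr M borel (\<lambda>\<omega>. occupation T x (telegraph (V \<omega>) (\<lambda>u. N u \<omega>)))) z
    = (cdf (distr M borel (\<lambda>\<omega>. occupation T x (telegraph c (\<lambda>u. N u \<omega>)))) z
      + cdf (distr M borel (\<lambda>\<omega>. occupation T x (telegraph (- c) (\<lambda>u. N u \<omega>)))) z) / 2"
proof -
  note P = telegraph_dataD(1)[OF data] and Vm[measurable] = telegraph_dataD(2)[OF data]
  note P' = poisson_process_rescale[OF P T]
  interpret prob_space M by (rule poisson_processD(1)[OF P])
  define E where "E v \<omega> = occupation T x (telegraph v (\<lambda>u. N u \<omega>))" for v \<omega>
  have E_eq: "E v \<omega> = time_above (x / (c * T)) (v / c) (\<lambda>u. N (u * T) \<omega>) 1" for v \<omega>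
    using occupation_rescale[OF T c, of x "v / c" "\<lambda>u. N u \<omega>"] c by (simp add: E_def)
  have EV[measurable]: "(\<lambda>\<omega>. E (V \<omega>) \<omega>) \<in> borel_measurable M"
    unfolding E_eq by (rule random_velocity_measurable[OF P']) auto
  let ?A = "vimage_algebra (space M) (\<lambda>\<omega>. \<lambda>t\<in>{0..}. N t \<omega>) (PiM {0..} (\<lambda>_. count_space UNIV))"
  have N_A: "N u \<in> measurable ?A (count_space UNIV)" if "0 \<le> u" for u
  proof -
    have "(\<lambda>\<omega>. \<lambda>t\<in>{0..}. N t \<omega>) \<in> measurable ?A (PiM {0..} (\<lambda>_. count_space UNIV))"
      by (rule measurable_vimage_algebra1) (auto simp: space_PiM)
    then have "(\<lambda>\<omega>. (\<lambda>t\<in>{0..}. N t \<omega>) u) \<in> measurable ?A (count_space UNIV)"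
      by (rule measurable_compose[OF _ measurable_component_singleton]) (use that in simp)
    then show ?thesis using that by simp
  qed
  \<comment> \<open>Independence refers to the sigma-algebra generated by the counting process, so
    measurability is needed with respect to \<open>?A\<close> and not just to
    \<open>M\<close>.\<close>
  have E_A: "E v \<in> borel_measurable ?A" if "v \<noteq> 0" for v
    unfolding E_eq using that c T poisson_processD(2,4,5)[OF P']
    by (intro time_above_measurable) (auto intro!: N_A)
  have E_M[measurable]: "E v \<in> borel_measurable M" if "v \<noteq> 0" for v
    unfolding E_eq using that c by (intro poisson_time_above_measurable[OF P']) auto
  have cdf_eq: "cdf (distr M borel X) z = prob {\<omega> \<in> space M. X \<omega> \<le> z}" if "X \<in> borel_measurable M" for X
    using that by (simp add: cdf_def measure_distr vimage_def Int_def conj_commute)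
  have half: "prob {\<omega> \<in> space M. V \<omega> = v \<and> E v \<omega> \<le> z} = prob {\<omega> \<in> space M. E v \<omega> \<le> z} / 2"
    if v: "v = c \<or> v = - c" for v
  proof -
    have v0: "v \<noteq> 0" using v c by auto
    have 1: "{\<omega> \<in> space M. V \<omega> = v} \<in> sets (vimage_algebra (space M) V borel)"
      using in_vimage_algebra[of "{v}" borel V "space M"] by (simp add: vimage_def Int_def conj_commute)
    have 2: "{\<omega> \<in> space M. E v \<omega> \<le> z} \<in> sets ?A"
      using measurable_sets[OF E_A[OF v0], of "{..z}"] by (simp add: vimage_def Int_def conj_commute)
    have "prob ({\<omega> \<in> space M. V \<omega> = v} \<inter> {\<omega> \<in> space M. E v \<omega> \<le> z})
        = prob {\<omega> \<in> space M. V \<omega> = v} * prob {\<omega> \<in> space M. E v \<omega> \<le> z}"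
      by (rule indep_setD[OF telegraph_dataD(5)[OF data] 1 2])
    moreover have "{\<omega> \<in> space M. V \<omega> = v} \<inter> {\<omega> \<in> space M. E v \<omega> \<le> z} = {\<omega> \<in> space M. V \<omega> = v \<and> E v \<omega> \<le> z}" by auto
    moreover have "prob {\<omega> \<in> space M. V \<omega> = v} = 1 / 2" using telegraph_dataD(3,4)[OF data] v by auto
    ultimately show ?thesis by simp
  qed
  \<comment> \<open>The two values are distinct because \<open>c\<close> is positive, so their
    probabilities 1/2 add up to 1 and no other value has mass.\<close>
  have "prob {\<omega> \<in> space M. V \<omega> = c \<or> V \<omega> = - c} = prob ({\<omega> \<in> space M. V \<omega> = c} \<union> {\<omega> \<in> space M. V \<omega> = - c})"
    by (rule arg_cong[where f = prob]) auto
  also have "\<dots> = prob {\<omega> \<in> space M. V \<omega> = c} + prob {\<omega> \<in> space M. V \<omega> = - c}"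
    using c by (intro finite_measure_Union) auto
  finally have "prob {\<omega> \<in> space M. V \<omega> = c \<or> V \<omega> = - c} = 1"
    using telegraph_dataD(3,4)[OF data] by simp
  then have "AE \<omega> in M. V \<omega> = c \<or> V \<omega> = - c" by (subst (asm) prob_Collect_eq_1) auto
  then have "prob {\<omega> \<in> space M. E (V \<omega>) \<omega> \<le> z}
      = prob ({\<omega> \<in> space M. V \<omega> = c \<and> E c \<omega> \<le> z} \<union> {\<omega> \<in> space M. V \<omega> = - c \<and> E (- c) \<omega> \<le> z})"
    using E_M[of c] E_M[of "- c"] c by (intro finite_measure_eq_AE) auto
  also have "\<dots> = prob {\<omega> \<in> space M. V \<omega> = c \<and> E c \<omega> \<le> z} + prob {\<omega> \<in> space M. V \<omega> = - c \<and> E (- c) \<omega> \<le> z}"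
    using E_M[of c] E_M[of "- c"] c by (intro finite_measure_Union) auto
  also have "\<dots> = (prob {\<omega> \<in> space M. E c \<omega> \<le> z} + prob {\<omega> \<in> space M. E (- c) \<omega> \<le> z}) / 2"
    by (simp add: half)
  finally show ?thesis
    using cdf_eq[OF EV] cdf_eq[OF E_M[of c]] cdf_eq[OF E_M[of "- c"]] c by (simp add: E_def[abs_def])
qed

lemma converges_in_distribution_mean:
  assumes "converges_in_distribution \<mu>1 \<nu> F" "converges_in_distribution \<mu>2 \<nu> F"
    and "eventually (\<lambda>T. \<forall>z. cdf (\<mu> T) z = (cdf (\<mu>1 T) z + cdf (\<mu>2 T) z) / 2) F"
  shows "converges_in_distribution \<mu> \<nu> F"
  unfolding converges_in_distribution_def
proof (intro allI impI)
  fix y assume "isCont (cdf \<nu>) y"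
  then have "((\<lambda>T. (cdf (\<mu>1 T) y + cdf (\<mu>2 T) y) / 2) \<longlongrightarrow> (cdf \<nu> y + cdf \<nu> y) / 2) F"
    using assms(1,2) by (intro tendsto_intros) (auto simp: converges_in_distribution_def)
  moreover have "eventually (\<lambda>T. (cdf (\<mu>1 T) y + cdf (\<mu>2 T) y) / 2 = cdf (\<mu> T) y) F"
    using assms(3) by eventually_elim simp
  ultimately show "((\<lambda>T. cdf (\<mu> T) y) \<longlongrightarrow> cdf \<nu> y) F"
    using Lim_transform_eventually by force
qed

lemma converges_in_distribution_cong:
  assumes "converges_in_distribution \<mu> \<nu> F" "eventually (\<lambda>T. \<mu> T = \<mu>' T) F"
  shows "converges_in_distribution \<mu>' \<nu> F"
  unfolding converges_in_distribution_def
proof (intro allI impI)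
  fix y assume "isCont (cdf \<nu>) y"
  then have "((\<lambda>T. cdf (\<mu> T) y) \<longlongrightarrow> cdf \<nu> y) F"
    using assms(1) by (simp add: converges_in_distribution_def)
  moreover have "eventually (\<lambda>T. cdf (\<mu> T) y = cdf (\<mu>' T) y) F"
    using assms(2) by eventually_elim simp
  ultimately show "((\<lambda>T. cdf (\<mu>' T) y) \<longlongrightarrow> cdf \<nu> y) F" by (rule Lim_transform_eventually)
qed

text \<open>Identifies the prescribed normalisation of the start with \<open>y * sqrt n\<close> for
  \<open>y = x / (c * T)\<close> and \<open>n = l * T\<close>.\<close>

lemma scaled_start:
  fixes c l T x :: real
  assumes "0 < c" "0 < l" "0 < T"
  shows "x / (c * T) * sqrt (l * T) = (c\<^sup>2 * T / l) powr (- 1 / 2) * x"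
proof -
  have "(c\<^sup>2 * T / l) powr (- 1 / 2) = inverse ((c\<^sup>2 * T / l) powr (1 / 2))"
    by (simp add: powr_minus[symmetric])
  also have "\<dots> = inverse (sqrt (c\<^sup>2 * T / l))" using assms by (simp add: powr_half_sqrt)
  also have "sqrt (c\<^sup>2 * T / l) = c * sqrt T / sqrt l" using assms by (simp add: real_sqrt_divide real_sqrt_mult)
  finally have 1: "(c\<^sup>2 * T / l) powr (- 1 / 2) = sqrt l / (c * sqrt T)" by (simp add: field_simps)
  have "sqrt (l * T) / T = sqrt l / sqrt T"
    using assms by (simp add: real_sqrt_mult field_simps)
  then have "x / c * (sqrt (l * T) / T) = x / c * (sqrt l / sqrt T)" by simp
  then show ?thesis unfolding 1 by (simp add: mult.commute)
qed

theorem theorem2p3: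
  fixes M :: "real \<Rightarrow> 'a measure"
    and N :: "real \<Rightarrow> real \<Rightarrow> 'a \<Rightarrow> nat"
    and V\<^sub>0 :: "real \<Rightarrow> 'a \<Rightarrow> real"
    and c lam x :: "real \<Rightarrow> real"
    and a :: real
    and Q :: "'b measure"
    and Y :: "real \<Rightarrow> 'b \<Rightarrow> real"
  assumes "\<And>T. T > 0 \<Longrightarrow> c T > 0"
    and "\<And>T. T > 0 \<Longrightarrow> lam T > 0"
    and "\<And>T. T > 0 \<Longrightarrow> telegraph_data (M T) (lam T) (c T) (N T) (V\<^sub>0 T)"
    and "prob_space Q"
    and "\<And>b. b \<ge> 0 \<Longrightarrow> is_limit_variable Q b (Y b)"
    and "filterlim (\<lambda>T. lam T * T) at_top at_top"
    and "((\<lambda>T. ((c T)\<^sup>2 * T / lam T) powr (- 1 / 2) * x T) \<longlongrightarrow> a) at_top"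
  shows "(\<forall>\<eta> \<in> {(\<lambda>T \<omega>. occupation T (x T) (telegraph (V\<^sub>0 T \<omega>) (\<lambda>u. N T u \<omega>))),
                (\<lambda>T \<omega>. occupation T (x T) (telegraph (c T) (\<lambda>u. N T u \<omega>))),
                (\<lambda>T \<omega>. occupation T (x T) (telegraph (- c T) (\<lambda>u. N T u \<omega>)))}.
            (a \<le> 0 \<longrightarrow> converges_in_distribution (\<lambda>T. distr (M T) borel (\<eta> T))
                         (distr Q borel (Y (- a))) at_top) \<and>
            (a \<ge> 0 \<longrightarrow> converges_in_distribution (\<lambda>T. distr (M T) borel (\<eta> T))
                         (distr Q borel (\<lambda>\<omega>. 1 - Y a \<omega>)) at_top) \<and>
            (a = 0 \<longrightarrow> converges_in_distribution (\<lambda>T. distr (M T) borel (\<eta> T))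
                         arcsine_distribution at_top)) \<and>
         (\<forall>y \<in> {0..1}. cdf arcsine_distribution y = 2 / pi * arcsin (sqrt y))"
proof -
  define \<eta> where "\<eta> w T \<omega> = occupation T (x T) (telegraph (w * c T) (\<lambda>u. N T u \<omega>))" for w T \<omega>
  define \<eta>0 where "\<eta>0 T \<omega> = occupation T (x T) (telegraph (V\<^sub>0 T \<omega>) (\<lambda>u. N T u \<omega>))" for T \<omega>
  \<comment> \<open>The hypotheses hold for positive \<open>T\<close> only, whereas the convergence
    lemmas ask for a Poisson process at every index. Replacing \<open>T\<close> by
    \<open>max 1 T\<close> supplies one everywhere and changes nothing eventually.\<close>
  define \<tau> :: "real \<Rightarrow> real" where "\<tau> T = max 1 T" for T
  have tau: "0 < \<tau> T" for T by (simp add: \<tau>_def)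
  have tau_eq: "eventually (\<lambda>T. \<tau> T = T) at_top"
    using eventually_ge_at_top[of 1] by eventually_elim (simp add: \<tau>_def)
  define n where "n T = lam (\<tau> T) * \<tau> T" for T
  define y where "y T = x (\<tau> T) / (c (\<tau> T) * \<tau> T)" for T
  define N' where "N' T u = N (\<tau> T) (u * \<tau> T)" for T u
  note c = assms(1)[OF tau] and l = assms(2)[OF tau] and data = assms(3)[OF tau]
  have P: "poisson_process (M (\<tau> T)) (n T) (N' T)" for T
    unfolding n_def N'_def by (rule poisson_process_rescale[OF telegraph_dataD(1)[OF data] tau])
  have n: "0 < n T" for T using l tau by (simp add: n_def)
  have n_lim: "filterlim n at_top at_top"
  proof (rule filterlim_cong[OF refl refl, THEN iffD2, OF _ assms(6)])
    show "eventually (\<lambda>T. n T = lam T * T) at_top"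
      using tau_eq by eventually_elim (simp add: n_def)
  qed
  have y_lim: "((\<lambda>T. y T * sqrt (n T)) \<longlongrightarrow> a) at_top"
  proof (rule Lim_transform_eventually[OF assms(7)])
    show "eventually (\<lambda>T. ((c T)\<^sup>2 * T / lam T) powr (- 1 / 2) * x T = y T * sqrt (n T)) at_top"
      using tau_eq
    proof eventually_elim
      case (elim T)
      show ?case using scaled_start[OF c[of T] l[of T] tau[of T], of "x T"] elim by (simp add: y_def n_def)
    qed
  qed
  have conditional: "converges_in_distribution (\<lambda>T. distr (M T) borel (\<eta> w T)) \<nu> at_top"
    if "converges_in_distribution (\<lambda>T. distr (M (\<tau> T)) borel (\<lambda>\<omega>. time_above (y T) w (\<lambda>u. N' T u \<omega>) 1)) \<nu> at_top" for w \<nu>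
  proof (rule converges_in_distribution_cong[OF that])
    show "eventually (\<lambda>T. distr (M (\<tau> T)) borel (\<lambda>\<omega>. time_above (y T) w (\<lambda>u. N' T u \<omega>) 1) = distr (M T) borel (\<eta> w T)) at_top"
      using tau_eq
    proof eventually_elim
      case (elim T)
      have "\<eta> w T = (\<lambda>\<omega>. time_above (y T) w (\<lambda>u. N' T u \<omega>) 1)"
      proof (rule ext)
        fix \<omega>
        show "\<eta> w T \<omega> = time_above (y T) w (\<lambda>u. N' T u \<omega>) 1"
          using occupation_rescale[OF tau[of T] c[of T], of "x T" w "\<lambda>u. N T u \<omega>"] elim
          by (simp add: \<eta>_def y_def N'_def)
      qed
      then show ?case using elim by (simp only:)
    qed
  qed
  have mixture: "converges_in_distribution (\<lambda>T. distr (M T) borel (\<eta>0 T)) \<nu> at_top"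
    if "converges_in_distribution (\<lambda>T. distr (M T) borel (\<eta> 1 T)) \<nu> at_top"
      "converges_in_distribution (\<lambda>T. distr (M T) borel (\<eta> (- 1) T)) \<nu> at_top" for \<nu>
  proof (rule converges_in_distribution_mean[OF that])
    show "eventually (\<lambda>T. \<forall>z. cdf (distr (M T) borel (\<eta>0 T)) z
        = (cdf (distr (M T) borel (\<eta> 1 T)) z + cdf (distr (M T) borel (\<eta> (- 1) T)) z) / 2) at_top"
      using eventually_gt_at_top[of 0]
    proof eventually_elim
      case (elim T)
      show ?case
        using cdf_random_velocity[OF assms(3)[OF elim] elim assms(1)[OF elim], of "x T"]
        by (simp add: \<eta>_def[abs_def] \<eta>0_def[abs_def])
    qed
  qed
  have family: "converges_in_distribution (\<lambda>T. distr (M T) borel (\<xi> T)) \<nu> at_top"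
    if \<xi>: "\<xi> \<in> {\<eta>0, \<eta> 1, \<eta> (- 1)}"
      and conv: "\<And>v. v = 1 \<or> v = - 1 \<Longrightarrow> converges_in_distribution
        (\<lambda>T. distr (M (\<tau> T)) borel (\<lambda>\<omega>. time_above (y T) v (\<lambda>u. N' T u \<omega>) 1)) \<nu> at_top" for \<xi> \<nu>
    using \<xi> conditional[OF conv[of 1]] conditional[OF conv[of "- 1"]] mixture by auto
  have below: "converges_in_distribution (\<lambda>T. distr (M T) borel (\<xi> T)) (distr Q borel (Y (- a))) at_top"
    if "\<xi> \<in> {\<eta>0, \<eta> 1, \<eta> (- 1)}" "a \<le> 0" for \<xi>
    by (rule family[OF that(1)], rule time_above_converges[OF P n _ n_lim y_lim that(2) assms(4)])
       (use assms(5) that in auto)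
  have above: "converges_in_distribution (\<lambda>T. distr (M T) borel (\<xi> T)) (distr Q borel (\<lambda>\<omega>. 1 - Y a \<omega>)) at_top"
    if "\<xi> \<in> {\<eta>0, \<eta> 1, \<eta> (- 1)}" "0 \<le> a" for \<xi>
    by (rule family[OF that(1)], rule time_above_converges_reflected[OF P n _ n_lim y_lim that(2) assms(4)])
       (use assms(5) that in auto)
  \<comment> \<open>At \<open>a = 0\<close> the definition of the limit variable says that
    \<open>Y 0\<close> has the arcsine law, so this is the case \<open>a \<le> 0\<close>
    rewritten.\<close>
  have zero: "converges_in_distribution (\<lambda>T. distr (M T) borel (\<xi> T)) arcsine_distribution at_top"
    if "\<xi> \<in> {\<eta>0, \<eta> 1, \<eta> (- 1)}" "a = 0" for \<xi>
    using below[OF that(1)] that(2) assms(5)[of 0] by (simp add: is_limit_variable_def)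
  have set_eq: "{(\<lambda>T \<omega>. occupation T (x T) (telegraph (V\<^sub>0 T \<omega>) (\<lambda>u. N T u \<omega>))),
                (\<lambda>T \<omega>. occupation T (x T) (telegraph (c T) (\<lambda>u. N T u \<omega>))),
                (\<lambda>T \<omega>. occupation T (x T) (telegraph (- c T) (\<lambda>u. N T u \<omega>)))} = {\<eta>0, \<eta> 1, \<eta> (- 1)}"
    by (simp add: \<eta>_def[abs_def] \<eta>0_def[abs_def])
  show ?thesis
    unfolding set_eq using below above zero cdf_arcsine_distribution by simp
qed

end
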